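(* Let $G$ be a unicyclic graph, let $r\ge1$ denote the number of non-trivial rooted trees attached to the cycle in $G$, and let $\lambda_{\mathrm{lead}}=\lambda_{\mathrm{lead}}(\mathbf{X}_G)$ be the leading partition of $\mathbf{X}_G$. \begin{enumerate} \item If $r=1$, then $\lambda_{\mathrm{lead}}=\lambda_{\mathrm{LC}}(G\setminus e)$, where $e$ is chosen to be an edge in the cycle incident to the root of the non-trivial tree. \item If $r\ge2$, then $\lambda_{\mathrm{lead}}=\lambda_{\mathrm{LC}}(G)$. \end{enumerate}
   Context: All graphs are finite and simple. The chromatic symmetric function of a graph $G$ with vertices $v_1,\dots,v_n$ is $\mathbf{X}_G=\sum_\kappa x_{\kappa(v_1)}\cdots x_{\kappa(v_n)}$, summed over all proper colorings $\kappa:V(G)\to\mathbb{N}$. The star graph $\mathsf{St}_k$ on $k$ vertices is the tree with one central vertex adjacent to $k-1$ leaves ($\mathsf{St}_1$ is a single vertex); $\mathfrak{st}_k:=\mathbf{X}_{\mathsf{St}_k}$, and for a partition $\lambda=(\lambda_1,\dots,\lambda_\ell)$, $\mathfrak{st}_\lambda:=\mathfrak{st}_{\lambda_1}\cdots\mathfrak{st}_{\lambda_\ell}$. The set $\{\mathfrak{st}_\lambda:\lambda\vdash n\}$ is a $\mathbb{Q}$-basis (the star-basis) of the space of homogeneous symmetric functions of degree $n$, so $\mathbf{X}_G=\sum_{\lambda\vdash n}c_\lambda\mathfrak{st}_\lambda$ with uniquely determined coefficients $c_\lambda$. Partitions of $n$ are ordered lexicographically: $\mu\le\lambda$ if $\mu=\lambda$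 or, for some $j$, $\mu_i=\lambda_i$ for $i<j$ and $\mu_j<\lambda_j$. The leading partition $\lambda_{\mathrm{lead}}(\mathbf{X}_G)$ is the smallest partition $\lambda$ in lexicographic order with $c_\lambda\ne0$. A unicyclic graph is a graph containing exactly one cycle. If its cycle has vertices $v_1,\dots,v_c$, then after deleting the edges of the cycle, the connected component $T_i$ containing $v_i$ is a tree, regarded as rooted at $v_i$; $T_i$ is non-trivial if it has more than one vertex, and $r$ is the number of non-trivial $T_i$. A leaf is a vertex of degree one; an internal vertex has degree at least two; an internal edge is an edge both of whose endpoints are internal vertices; $I(H)$ is the set of internal edges of a graph $H$. For a graph $H$, $\lambda_{\mathrm{LC}}(H)$ is the partition whose parts are the orders (numbers of vertices) of the connected components of $H\setminus I(H)$, the graph obtained from $H$ by deleting all its internal edges (keeping all vertices). $G\setminus e$ is the graph obtained from $G$ by deleting the edge $e$. *)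

theory Defs
  imports Complex_Main "HOL-Library.Multiset" "HOL-Library.FuncSet"
begin

section \<open>Finite simple graphs\<close>

text \<open>A graph is given by its vertex set \<open>V\<close> and its edge set \<open>E\<close>; an edge is the
  two-element set of its endpoints. No connectedness is assumed anywhere.\<close>

definition simple_graph :: "'a set \<Rightarrow> 'a set set \<Rightarrow> bool" where
  "simple_graph V E \<longleftrightarrow> finite V \<and> (\<forall>e\<in>E. e \<subseteq> V \<and> card e = 2)"

definition degree :: "'a set set \<Rightarrow> 'a \<Rightarrow> nat" where
  "degree E v = card {e \<in> E. v \<in> e}"

definition internal_edges :: "'a set set \<Rightarrow> 'a set set" where
  "internal_edges E = {e \<in> E. \<forall>v\<in>e. degree E v \<ge> 2}"

definition component :: "'a set set \<Rightarrow> 'a \<Rightarrow> 'a set" where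
  "component E v = {(u, w). {u, w} \<in> E}\<^sup>* `` {v}"

definition components :: "'a set \<Rightarrow> 'a set set \<Rightarrow> 'a set set" where
  "components V E = component E ` V"

definition cycle_edges :: "'a list \<Rightarrow> 'a set set" where
  "cycle_edges vs = {{vs ! i, vs ! (Suc i mod length vs)} | i. i < length vs}"

definition is_cycle :: "'a set set \<Rightarrow> 'a list \<Rightarrow> bool" where
  "is_cycle E vs \<longleftrightarrow> length vs \<ge> 3 \<and> distinct vs \<and> cycle_edges vs \<subseteq> E"

text \<open>A cycle is counted as a subgraph: vertex sequences that differ by rotation or reversal
  have the same edge set, and hence describe the same cycle.\<close>

definition unicyclic :: "'a set \<Rightarrow> 'a set set \<Rightarrow> bool" where
  "unicyclic V E \<longleftrightarrow>
     simple_graph V E \<and> (\<exists>!C. \<exists>vs. is_cycle E vs \<and> C = cycle_edges vs)"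

definition rooted_tree :: "'a set set \<Rightarrow> 'a list \<Rightarrow> 'a \<Rightarrow> 'a set" where
  "rooted_tree E vs v = component (E - cycle_edges vs) v"

definition nontrivial_roots :: "'a set set \<Rightarrow> 'a list \<Rightarrow> 'a set" where
  "nontrivial_roots E vs = {v \<in> set vs. card (rooted_tree E vs v) > 1}"


section \<open>Partitions\<close>

text \<open>Partitions are weakly decreasing lists of positive parts.\<close>

definition partitions :: "nat \<Rightarrow> nat list set" where
  "partitions n = {l. sorted_wrt (\<ge>) l \<and> 0 \<notin> set l \<and> sum_list l = n}"

text \<open>Only partitions of the same number are compared; then neither list is a proper prefix of
  the other.\<close>

definition lex_le :: "nat list \<Rightarrow> nat list \<Rightarrow> bool" where
  "lex_le mu la \<longleftrightarrow> mu = la \<or>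
     (\<exists>j. j < length mu \<and> j < length la \<and> (\<forall>i<j. mu ! i = la ! i) \<and> mu ! j < la ! j)"

definition lambda_LC :: "'a set \<Rightarrow> 'a set set \<Rightarrow> nat list" where
  "lambda_LC V E =
     rev (sorted_list_of_multiset
       (image_mset card (mset_set (components V (E - internal_edges E)))))"


section \<open>Chromatic symmetric functions and the star basis\<close>

text \<open>The monomial \<open>x\<^bsub>k1\<^esub> \<dots> x\<^bsub>kn\<^esub>\<close> in the variables indexed by the natural numbers
  is the multiset \<open>{#k1, \<dots>, kn#}\<close>; a formal power series over the rationals maps each
  monomial to its coefficient.\<close>

type_synonym series = "nat multiset \<Rightarrow> rat"

definition ser_one :: series where
  "ser_one M = (if M = {#} then 1 else 0)"

definition ser_mult :: "series \<Rightarrow> series \<Rightarrow> series" where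
  "ser_mult f g M = (\<Sum>A\<in>{A. A \<subseteq># M}. f A * g (M - A))"

definition proper_colorings :: "'a set \<Rightarrow> 'a set set \<Rightarrow> ('a \<Rightarrow> nat) set" where
  "proper_colorings V E =
     {\<kappa> \<in> V \<rightarrow>\<^sub>E UNIV. \<forall>u\<in>V. \<forall>w\<in>V. {u, w} \<in> E \<longrightarrow> \<kappa> u \<noteq> \<kappa> w}"

text \<open>A coloring \<open>\<kappa>\<close> contributes the monomial \<open>image_mset \<kappa> (mset_set V)\<close>.\<close>

definition chromatic :: "'a set \<Rightarrow> 'a set set \<Rightarrow> series" where
  "chromatic V E M =
     of_nat (card {\<kappa> \<in> proper_colorings V E. image_mset \<kappa> (mset_set V) = M})"

definition star :: "nat \<Rightarrow> series" where
  "star k = chromatic {0..<k} {{0, i} | i. 1 \<le> i \<and> i < k}"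

definition star_part :: "nat list \<Rightarrow> series" where
  "star_part la = foldr (\<lambda>k. ser_mult (star k)) la ser_one"

text \<open>The family of coefficients \<open>c\<close> of \<open>f\<close> in the star-basis of degree \<open>n\<close>, extended by zero
  to lists that are not partitions of \<open>n\<close>. For \<open>f\<close> symmetric and homogeneous of degree \<open>n\<close> it
  exists and is unique because the star functions form a basis.\<close>

definition star_coeff :: "nat \<Rightarrow> series \<Rightarrow> nat list \<Rightarrow> rat" where
  "star_coeff n f = (THE c. (\<forall>la. la \<notin> partitions n \<longrightarrow> c la = 0) \<and>
     (\<forall>M. f M = (\<Sum>la\<in>partitions n. c la * star_part la M)))"

definition lambda_lead :: "nat \<Rightarrow> series \<Rightarrow> nat list" where
  "lambda_lead n f = (THE la. la \<in> partitions n \<and> star_coeff n f la \<noteq> 0 \<and>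
     (\<forall>mu\<in>partitions n. star_coeff n f mu \<noteq> 0 \<longrightarrow> lex_le la mu))"

end

theory Submission
  imports Defs "HOL-Library.Multiset_Order" "HOL-Library.Disjoint_Sets"
begin

text \<open>For an edge \<open>e\<close>, the deletion-near-contraction relation writes \<open>X\<^sub>G\<close> as \<open>X\<close> of the deletion plus
  \<open>X\<close> of the near-contraction (contract \<open>e\<close> and hang a leaf at the new vertex) minus \<open>X\<close> of the
  contraction with an extra isolated vertex. Encode partitions as multisets, ordered by the multiset
  order, which is the lexicographic order. For an internal edge without short cycles through it,
  none of the three graphs has a smaller leaf-component partition than \<open>G\<close>; at least one of deletion
  and contraction has the same one, and the near-contraction never has.
  The coefficient at this partition has sign \<open>(-1)\<^sup>d\<close>, where \<open>d\<close> counts the internal vertices without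
  leaf neighbors: the deletion preserves \<open>d\<close> and the contraction lowers it by one exactly when they
  preserve the partition, so nothing cancels. This settles forests by induction on the number of
  internal edges, and unicyclic graphs with \<open>r \<ge> 2\<close> by induction on the length of the cycle,
  contracting a cycle edge at a root. For \<open>r = 1\<close> the coefficient at the leaf-component partition of
  \<open>G\<close> vanishes; expanding at an edge incident to the root, the deletion is a forest with the claimed
  leading partition, and the two other terms shorten the cycle.

  Uniqueness of the coefficients is a double triangularity: star products are triangular in the power
  sums by inclusion-exclusion over edge sets, and power sums are triangular in the monomials.\<close>

section \<open>Connectivity\<close>

text \<open>The shape of the proof is dictated by triangles. If the ends of the contracted edge
  share a neighbor of degree two, the contraction turns this neighbor into a leaf, and the leaf
  components of the contraction no longer follow from those of \<open>G\<close>. In a forest the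
  ends share no neighbor. On a cycle they share one only if the cycle is a triangle. With two roots,
  the contracted edge can be chosen so that some root lies off it; in a triangle this root is the
  third vertex, and its degree only drops from at least three to at least two. With one root, the
  third vertex of the last triangle has degree two and does become a leaf, so that case carries the
  type of \<open>G\<close> without \<open>e\<close> through an induction of its own. All graphs of
  an expansion live on the same vertex set, which makes their functions homogeneous of the same
  degree and their coefficients comparable. Non-trivial rooted trees are replaced by a degree
  condition and uniqueness of the cycle by a condition on bridges, since both can be followed
  through a contraction.\<close>

definition conn :: "'a set set \<Rightarrow> 'a \<Rightarrow> 'a \<Rightarrow> bool" where
  "conn E x y \<longleftrightarrow> y \<in> component E x"

lemma conn_iff_rtrancl: "conn E x y \<longleftrightarrow> (x, y) \<in> {(u, w). {u, w} \<in> E}\<^sup>*"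
  by (simp add: conn_def component_def)

lemma conn_refl [simp]: "conn E x x"
  by (simp add: conn_iff_rtrancl)

lemma conn_edge: "{x, y} \<in> E \<Longrightarrow> conn E x y"
  by (auto simp: conn_iff_rtrancl)

lemma conn_trans: "conn E x y \<Longrightarrow> conn E y z \<Longrightarrow> conn E x z"
  by (auto simp: conn_iff_rtrancl)

lemma conn_sym: "conn E x y \<Longrightarrow> conn E y x"
proof -
  have "sym ({(u, w). {u, w} \<in> E}\<^sup>*)"
    by (rule sym_rtrancl) (auto simp: sym_def insert_commute)
  then show "conn E x y \<Longrightarrow> conn E y x"
    by (auto simp: conn_iff_rtrancl dest: symD)
qed

lemma conn_induct [consumes 1, case_names refl step]:
  assumes "conn E x y" and "P x"
    and "\<And>y z. conn E x y \<Longrightarrow> {y, z} \<in> E \<Longrightarrow> P y \<Longrightarrow> P z"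
  shows "P y"
  using assms(1)[unfolded conn_iff_rtrancl]
proof (induction rule: rtrancl_induct)
  case (step y z)
  then show ?case using assms(3)[of y z] by (simp add: conn_iff_rtrancl)
qed (rule assms(2))

text \<open>Walks are lifted edge by edge. For contractions, each edge is lifted to a walk of the
  original graph.\<close>

lemma conn_lift:
  assumes "conn E x y" and "\<And>p q. {p, q} \<in> E \<Longrightarrow> conn F p q"
  shows "conn F x y"
  using assms(1) by (induction rule: conn_induct) (auto intro: conn_trans assms(2))

lemma conn_mono: "E \<subseteq> F \<Longrightarrow> conn E x y \<Longrightarrow> conn F x y"
  by (erule conn_lift) (auto intro: conn_edge)

text \<open>The tool for bounding components from above: a walk cannot leave a vertex set that no
  edge leaves.\<close>

lemma conn_closed:
  assumes "conn E x y" and "x \<in> A" and "\<And>p q. {p, q} \<in> E \<Longrightarrow> p \<in> A \<Longrightarrow> q \<in> A"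
  shows "y \<in> A"
  using assms(1) by (induction rule: conn_induct) (auto intro: assms(2,3))

lemma component_eq_iff: "component E x = component E y \<longleftrightarrow> conn E x y"
proof
  assume "component E x = component E y"
  then show "conn E x y"
    by (metis conn_def conn_refl)
next
  assume "conn E x y"
  then show "component E x = component E y"
    unfolding set_eq_iff conn_def[symmetric] by (meson conn_sym conn_trans)
qed

lemma singleton_notin_components:
  assumes "conn E x y" "x \<noteq> y"
  shows "{x} \<notin> components V E"
proof
  assume "{x} \<in> components V E"
  then obtain z where z: "component E z = {x}" by (auto simp: components_def)
  then have "conn E z x" by (simp add: conn_def)
  then have "component E x = {x}" using z component_eq_iff[of E z x] by simp
  then show False using assms by (auto simp: conn_def)
qed

lemma component_mono: "E \<subseteq> F \<Longrightarrow> component E x \<subseteq> component F x"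
  using conn_mono[of E F x] by (auto simp: conn_def)

lemma self_in_component [simp]: "x \<in> component E x"
  by (simp add: component_def)

lemma component_subset:
  assumes "simple_graph V E" and "x \<in> V"
  shows "component E x \<subseteq> V"
proof
  fix y assume "y \<in> component E x"
  then have "conn E x y" by (simp add: conn_def)
  then show "y \<in> V"
    by (rule conn_closed) (use assms in \<open>auto simp: simple_graph_def\<close>)
qed

lemma partition_on_components:
  assumes "simple_graph V E"
  shows "partition_on V (components V E)"
proof (rule partition_onI)
  show "\<Union> (components V E) = V"
    using component_subset[OF assms] by (fastforce simp: components_def)
  show "{} \<notin> components V E"
    by (auto simp: components_def) (metis empty_iff self_in_component)
  show "disjnt p p'" if pp: "p \<in> components V E" "p' \<in> components V E" "p \<noteq> p'" for p p'
  proof -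
    obtain x y where "p = component E x" "p' = component E y"
      using pp by (auto simp: components_def)
    with pp show ?thesis
      by (auto simp: disjnt_iff) (metis component_eq_iff conn_def)+
  qed
qed

section \<open>Types of set partitions\<close>

definition block_sizes :: "'a set set \<Rightarrow> nat multiset" where
  "block_sizes P = image_mset card (mset_set P)"

text \<open>A single Dershowitz-Manna step. Comparisons of types cancel a common part
  \<open>I\<close> and dominate what is left.\<close>

lemma union_less_multisetI:
  fixes K J I :: "'b::linorder multiset"
  assumes "J \<noteq> {#}" and "\<And>k. k \<in># K \<Longrightarrow> \<exists>j\<in>#J. k < j"
  shows "I + K < I + J"
proof -
  have "(I + K, I + J) \<in> mult {(x, y). x < y}"
    by (rule one_step_implies_mult) (use assms in auto)
  then show ?thesis
    by (simp add: mult\<^sub>H\<^sub>O less_multiset\<^sub>H\<^sub>O)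
qed

lemma block_sizes_less:
  assumes fin: "finite P" "finite Q" and "Q - P \<noteq> {}"
    and lt: "\<And>A. A \<in> P - Q \<Longrightarrow> \<exists>B\<in>Q - P. card A < card B"
  shows "block_sizes P < block_sizes Q"
proof -
  have split: "block_sizes R = block_sizes (R \<inter> S) + block_sizes (R - S)" if "finite R" for R S :: "'a set set"
    using mset_set_Union[of "R \<inter> S" "R - S"] that
    by (simp add: block_sizes_def Int_Diff_disjoint Int_Diff_Un)
  have "block_sizes (P \<inter> Q) + block_sizes (P - Q) < block_sizes (P \<inter> Q) + block_sizes (Q - P)"
    by (rule union_less_multisetI)
      (use assms in \<open>auto simp: block_sizes_def mset_set_empty_iff\<close>)
  then show ?thesis
    using split[OF fin(1), of Q] split[OF fin(2), of P] by (simp add: Int_commute)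
qed

text \<open>A block of \<open>P\<close> outside \<open>Q\<close> lies properly inside a block of
  \<open>Q\<close>, and that larger block cannot belong to \<open>P\<close>, whose blocks are
  disjoint. Once the common blocks cancel, every remaining block of \<open>P\<close> is
  dominated.\<close>

lemma block_sizes_refine:
  assumes V: "finite V" and P: "partition_on V P" and Q: "partition_on V Q"
    and ref: "\<And>A. A \<in> P \<Longrightarrow> \<exists>B\<in>Q. A \<subseteq> B" and ne: "P \<noteq> Q"
  shows "block_sizes P < block_sizes Q"
proof (rule block_sizes_less)
  show fin: "finite P" "finite Q"
    using V P Q finite_elements by blast+
  show step: "\<exists>B\<in>Q - P. card A < card B" if A: "A \<in> P - Q" for A
  proof -
    obtain B where B: "B \<in> Q" "A \<subseteq> B" using ref A by blast
    have "A \<noteq> B" using A B by blast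
    have "B \<notin> P"
    proof
      assume "B \<in> P"
      with A \<open>A \<noteq> B\<close> partition_onD2[OF P] have "A \<inter> B = {}" by (auto simp: disjoint_def)
      moreover have "A \<noteq> {}" using A P partition_onD3 by blast
      ultimately show False using B by blast
    qed
    moreover have "finite B" using B V partition_onD1[OF Q] by (metis Union_upper finite_subset)
    ultimately show ?thesis using B \<open>A \<noteq> B\<close> psubset_card_mono[of B A] by auto
  qed
  show "Q - P \<noteq> {}"
  proof
    assume sub: "Q - P = {}"
    then have "P - Q = {}" using step by blast
    with sub ne show False by blast
  qed
qed

lemma components_refine:
  assumes "simple_graph V F" and "E \<subseteq> F" and ne: "components V E \<noteq> components V F"
  shows "block_sizes (components V E) < block_sizes (components V F)"
proof -
  have E: "simple_graph V E" and "finite V" using assms by (auto simp: simple_graph_def)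
  show ?thesis
  proof (rule block_sizes_refine[of V])
    show "\<exists>B\<in>components V F. A \<subseteq> B" if "A \<in> components V E" for A
      using that component_mono[OF \<open>E \<subseteq> F\<close>] by (auto simp: components_def)
  qed (use E assms \<open>finite V\<close> partition_on_components in auto)
qed

lemma components_refine_le:
  assumes "simple_graph V F" and "E \<subseteq> F"
  shows "block_sizes (components V E) \<le> block_sizes (components V F)"
  using components_refine[OF assms] by (cases "components V E = components V F") auto

lemma sum_block_sizes:
  assumes "finite V" "partition_on V P"
  shows "\<Sum>\<^sub># (block_sizes P) = card V"
proof -
  have "finite P" "\<Union> P = V" "disjoint P"
    using assms finite_elements partition_onD1 partition_onD2 by blast+
  moreover have "finite A" if "A \<in> P" for A
    using that \<open>\<Union> P = V\<close> assms(1) by (meson Union_upper finite_subset)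
  ultimately show ?thesis
    using card_Union_disjoint[of P]
    by (auto simp: block_sizes_def sum_unfold_sum_mset[symmetric] disjoint_def pairwise_def disjnt_def)
qed

lemma block_sizes_pos:
  assumes "finite V" "partition_on V P"
  shows "0 \<notin># block_sizes P"
proof
  assume "0 \<in># block_sizes P"
  then obtain A where "A \<in> P" "card A = 0"
    using finite_elements[OF assms] by (auto simp: block_sizes_def)
  then show False
    using assms by (metis card_0_eq finite_subset partition_onD1 partition_onD3 Union_upper)
qed

section \<open>Leaf components\<close>

definition nbrs :: "'a set set \<Rightarrow> 'a \<Rightarrow> 'a set" where
  "nbrs E x = {y. {x, y} \<in> E}"

text \<open>Degree zero is included: an isolated vertex is a leaf component with itself as
  center.\<close>

definition nonleaves :: "'a set \<Rightarrow> 'a set set \<Rightarrow> 'a set" where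
  "nonleaves V E = {x \<in> V. degree E x \<noteq> 1}"

definition leaf_star :: "'a set set \<Rightarrow> 'a \<Rightarrow> 'a set" where
  "leaf_star E x = insert x {y \<in> nbrs E x. degree E y = 1}"

text \<open>Both vertices of such a component are leaves, so it has no center in
  \<open>nonleaves\<close> and is counted separately.\<close>

definition isolated_edges :: "'a set set \<Rightarrow> 'a set set" where
  "isolated_edges E = {e \<in> E. \<forall>x\<in>e. degree E x = 1}"

text \<open>The parts of \<open>lambda_LC\<close> as a multiset, the form in which they are
  compared.\<close>

definition lc_type :: "'a set \<Rightarrow> 'a set set \<Rightarrow> nat multiset" where
  "lc_type V E = block_sizes (components V (E - internal_edges E))"

definition deep :: "'a set \<Rightarrow> 'a set set \<Rightarrow> 'a set" where
  "deep V E = {x \<in> V. degree E x \<ge> 2 \<and> leaf_star E x = {x}}"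

lemma nbrs_sym: "y \<in> nbrs E x \<longleftrightarrow> x \<in> nbrs E y"
  by (simp add: nbrs_def insert_commute)

lemma simple_graph_finite: "simple_graph V E \<Longrightarrow> finite V \<and> finite E"
  unfolding simple_graph_def by (metis Pow_iff finite_Pow_iff finite_subset subsetI)

lemma simple_graph_subset: "simple_graph V F \<Longrightarrow> E \<subseteq> F \<Longrightarrow> simple_graph V E"
  by (auto simp: simple_graph_def)

lemma simple_graph_edgeD:
  assumes "simple_graph V E" "{x, y} \<in> E"
  shows "x \<in> V" "y \<in> V" "x \<noteq> y"
  using assms by (force simp: simple_graph_def)+

lemma simple_graph_edgeE:
  assumes "simple_graph V E" "e \<in> E"
  obtains x y where "e = {x, y}" "x \<noteq> y" "x \<in> V" "y \<in> V"
proof -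
  have "card e = 2" "e \<subseteq> V" using assms by (auto simp: simple_graph_def)
  then show thesis using that by (auto simp: card_2_iff)
qed

lemma nbrs_subset:
  assumes "simple_graph V E"
  shows "nbrs E x \<subseteq> V - {x}"
proof
  fix y assume "y \<in> nbrs E x"
  then have "{x, y} \<in> E" by (simp add: nbrs_def)
  from simple_graph_edgeD(2,3)[OF assms this] show "y \<in> V - {x}" by auto
qed

lemma finite_nbrs: "simple_graph V E \<Longrightarrow> finite (nbrs E x)"
  by (meson finite_Diff finite_subset nbrs_subset simple_graph_finite)

lemma degree_eq_card_nbrs:
  assumes "simple_graph V E"
  shows "degree E x = card (nbrs E x)"
proof -
  have "bij_betw (\<lambda>y. {x, y}) (nbrs E x) {e \<in> E. x \<in> e}"
  proof (rule bij_betw_imageI)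
    show "inj_on (\<lambda>y. {x, y}) (nbrs E x)"
      by (auto simp: inj_on_def doubleton_eq_iff)
    have "e \<in> (\<lambda>y. {x, y}) ` nbrs E x" if e: "e \<in> E" "x \<in> e" for e
    proof -
      obtain p q where "e = {p, q}" using simple_graph_edgeE[OF assms e(1)] by metis
      then show ?thesis using e by (auto simp: nbrs_def image_iff insert_commute)
    qed
    then show "(\<lambda>y. {x, y}) ` nbrs E x = {e \<in> E. x \<in> e}"
      by (auto simp: nbrs_def)
  qed
  then show ?thesis by (simp add: degree_def bij_betw_same_card)
qed

lemma degree_pos:
  assumes "simple_graph V E" "{x, y} \<in> E"
  shows "degree E x \<ge> 1" "degree E y \<ge> 1"
proof -
  have "y \<in> nbrs E x" "x \<in> nbrs E y" using assms by (auto simp: nbrs_def insert_commute)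
  then show "degree E x \<ge> 1" "degree E y \<ge> 1"
    unfolding degree_eq_card_nbrs[OF assms(1)]
    using finite_nbrs[OF assms(1)] by (auto simp: Suc_le_eq card_gt_0_iff)
qed

lemma degree_one_nbrs:
  assumes "simple_graph V E" "degree E x = 1" "y \<in> nbrs E x"
  shows "nbrs E x = {y}"
  using assms by (auto simp: degree_eq_card_nbrs card_1_singleton_iff)

lemma leaf_edge_iff:
  assumes "simple_graph V E"
  shows "{x, y} \<in> E - internal_edges E \<longleftrightarrow> {x, y} \<in> E \<and> (degree E x = 1 \<or> degree E y = 1)"
  using degree_pos[OF assms, of x y] by (auto simp: internal_edges_def)

lemma leaf_edgeI: "{x, y} \<in> E \<Longrightarrow> degree E x = 1 \<or> degree E y = 1 \<Longrightarrow> {x, y} \<in> E - internal_edges E"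
  by (auto simp: internal_edges_def)

lemma internal_edge_iff: "{x, y} \<in> internal_edges E \<longleftrightarrow> {x, y} \<in> E \<and> degree E x \<ge> 2 \<and> degree E y \<ge> 2"
  by (auto simp: internal_edges_def)

text \<open>Every edge that is not internal has a leaf as an end, and a leaf has a single neighbor.
  A walk from \<open>x\<close> along such edges therefore gets no further than the leaves at
  \<open>x\<close>.\<close>

lemma component_nonleaf:
  assumes G: "simple_graph V E" and x: "degree E x \<noteq> 1"
  shows "component (E - internal_edges E) x = leaf_star E x"
proof (intro equalityI subsetI)
  fix y assume "y \<in> component (E - internal_edges E) x"
  then have "conn (E - internal_edges E) x y" by (simp add: conn_def)
  then show "y \<in> leaf_star E x"
  proof (rule conn_closed)
    show "x \<in> leaf_star E x" by (simp add: leaf_star_def)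
    fix p q assume pq: "{p, q} \<in> E - internal_edges E" and p: "p \<in> leaf_star E x"
    then have E: "q \<in> nbrs E p" "degree E p = 1 \<or> degree E q = 1"
      using leaf_edge_iff[OF G] by (auto simp: nbrs_def)
    show "q \<in> leaf_star E x"
    proof (cases "p = x")
      case False
      then have "p \<in> nbrs E x" "degree E p = 1" using p by (auto simp: leaf_star_def)
      then have "nbrs E p = {x}" using degree_one_nbrs[OF G] nbrs_sym by metis
      then show ?thesis using E by (simp add: leaf_star_def)
    qed (use E x in \<open>auto simp: leaf_star_def\<close>)
  qed
next
  fix y assume y: "y \<in> leaf_star E x"
  have "conn (E - internal_edges E) x y"
  proof (cases "y = x")
    case False
    then show ?thesis using y by (intro conn_edge leaf_edgeI) (auto simp: leaf_star_def nbrs_def)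
  qed simp
  then show "y \<in> component (E - internal_edges E) x" by (simp add: conn_def)
qed

lemma component_isolated_edge:
  assumes G: "simple_graph V E" and xy: "{x, y} \<in> E" "degree E x = 1" "degree E y = 1"
  shows "component (E - internal_edges E) x = {x, y}"
proof (intro equalityI subsetI)
  have n: "nbrs E x = {y}" "nbrs E y = {x}"
  proof -
    have "y \<in> nbrs E x" using xy by (simp add: nbrs_def)
    then show "nbrs E x = {y}" "nbrs E y = {x}"
      using xy degree_one_nbrs[OF G] nbrs_sym by metis+
  qed
  fix z assume "z \<in> component (E - internal_edges E) x"
  then have "conn (E - internal_edges E) x z" by (simp add: conn_def)
  then show "z \<in> {x, y}"
    by (rule conn_closed) (use n in \<open>auto simp: nbrs_def\<close>)
next
  have "conn (E - internal_edges E) x y"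
    using xy by (intro conn_edge leaf_edgeI) auto
  moreover fix z assume "z \<in> {x, y}"
  ultimately show "z \<in> component (E - internal_edges E) x"
    by (auto simp: conn_def)
qed

lemma components_leaf_graph:
  assumes G: "simple_graph V E"
  shows "components V (E - internal_edges E) = leaf_star E ` nonleaves V E \<union> isolated_edges E"
proof (intro equalityI subsetI)
  fix B assume "B \<in> components V (E - internal_edges E)"
  then obtain x where x: "x \<in> V" "B = component (E - internal_edges E) x"
    by (auto simp: components_def)
  show "B \<in> leaf_star E ` nonleaves V E \<union> isolated_edges E"
  proof (cases "degree E x = 1")
    case False
    then show ?thesis using x component_nonleaf[OF G] by (auto simp: nonleaves_def)
  next
    case True
    then obtain y where "nbrs E x = {y}"
      by (auto simp: degree_eq_card_nbrs[OF G] card_1_singleton_iff)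
    then have xy: "{x, y} \<in> E" by (auto simp: nbrs_def)
    show ?thesis
    proof (cases "degree E y = 1")
      case True
      then show ?thesis
        using x xy component_isolated_edge[OF G xy] \<open>degree E x = 1\<close> by (auto simp: isolated_edges_def)
    next
      case False
      have "conn (E - internal_edges E) x y"
        using xy True by (intro conn_edge leaf_edgeI) auto
      then have "B = component (E - internal_edges E) y"
        using x by (simp add: component_eq_iff)
      then show ?thesis
        using component_nonleaf[OF G False] False simple_graph_edgeD[OF G xy]
        by (auto simp: nonleaves_def)
    qed
  qed
next
  fix B assume "B \<in> leaf_star E ` nonleaves V E \<union> isolated_edges E"
  then show "B \<in> components V (E - internal_edges E)"
  proof
    assume "B \<in> leaf_star E ` nonleaves V E"
    then show ?thesis
      using component_nonleaf[OF G] by (auto simp: nonleaves_def components_def)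
  next
    assume B: "B \<in> isolated_edges E"
    then have "B \<in> E" by (simp add: isolated_edges_def)
    then obtain x y where "B = {x, y}" "x \<in> V"
      using simple_graph_edgeE[OF G] by metis
    with B show ?thesis
      using component_isolated_edge[OF G, of x y] by (auto simp: isolated_edges_def components_def)
  qed
qed

lemma card_leaf_star:
  assumes G: "simple_graph V E"
  shows "finite (leaf_star E x)" "card (leaf_star E x) \<ge> 1"
    "card (leaf_star E x) = 1 \<longleftrightarrow> leaf_star E x = {x}"
proof -
  show f: "finite (leaf_star E x)" using finite_nbrs[OF G] by (simp add: leaf_star_def)
  show "card (leaf_star E x) \<ge> 1" using f by (auto simp: leaf_star_def Suc_le_eq card_gt_0_iff)
  show "card (leaf_star E x) = 1 \<longleftrightarrow> leaf_star E x = {x}"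
    by (auto simp: card_1_singleton_iff leaf_star_def)
qed

text \<open>A star has exactly one nonleaf, its center, and an isolated edge has none. Hence the
  blocks are pairwise distinct and can be counted by centers and isolated edges.\<close>

lemma lc_type_eq:
  assumes G: "simple_graph V E"
  shows "lc_type V E = image_mset (\<lambda>x. card (leaf_star E x)) (mset_set (nonleaves V E))
    + replicate_mset (card (isolated_edges E)) 2"
proof -
  have fin: "finite (nonleaves V E)" "finite (isolated_edges E)"
    using simple_graph_finite[OF G] by (auto simp: nonleaves_def isolated_edges_def)
  have inj: "inj_on (leaf_star E) (nonleaves V E)"
    by (auto simp: inj_on_def nonleaves_def leaf_star_def set_eq_iff)
  have disj: "leaf_star E ` nonleaves V E \<inter> isolated_edges E = {}"
    by (auto simp: nonleaves_def leaf_star_def isolated_edges_def)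
  have "image_mset card (mset_set (isolated_edges E)) = image_mset (\<lambda>_. 2) (mset_set (isolated_edges E))"
    using G fin by (intro image_mset_cong) (auto simp: isolated_edges_def simple_graph_def)
  then show ?thesis
    using mset_set_Union[OF _ _ disj] fin
    by (simp add: lc_type_def block_sizes_def components_leaf_graph[OF G] image_mset_const_eq
        image_mset_mset_set[OF inj, symmetric] multiset.map_comp o_def)
qed

text \<open>Splits off the nonleaves affected by a local change of the graph; the remaining summands
  can then be matched one by one.\<close>

lemma lc_type_split:
  assumes G: "simple_graph V E" and A: "A \<subseteq> nonleaves V E"
  shows "lc_type V E = image_mset (\<lambda>x. card (leaf_star E x)) (mset_set A)
    + (image_mset (\<lambda>x. card (leaf_star E x)) (mset_set (nonleaves V E - A))
    + replicate_mset (card (isolated_edges E)) 2)"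
proof -
  have "finite (nonleaves V E)" using simple_graph_finite[OF G] by (auto simp: nonleaves_def)
  then have "mset_set (nonleaves V E) = mset_set A + mset_set (nonleaves V E - A)"
    using A mset_set_Union[of A "nonleaves V E - A"]
    by (metis Diff_disjoint Un_Diff_cancel2 finite_Diff finite_subset sup.absorb2 sup_commute)
  then show ?thesis by (simp add: lc_type_eq[OF G])
qed

section \<open>Near-contractions\<close>

text \<open>As the edges form a set, the two edges to a common neighbor of \<open>u\<close> and
  \<open>v\<close> merge into one. Removing \<open>{u, v}\<close> beforehand avoids a loop at
  \<open>u\<close>.\<close>

definition contract :: "'a \<Rightarrow> 'a \<Rightarrow> 'a set set \<Rightarrow> 'a set set" where
  "contract u v E = (\<lambda>f. (\<lambda>x. if x = v then u else x) ` f) ` (E - {{u, v}})"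

lemma contract_edge_iff:
  assumes G: "simple_graph V E" and uv: "u \<noteq> v"
  shows "{x, y} \<in> contract u v E \<longleftrightarrow>
    x \<noteq> y \<and> x \<noteq> v \<and> y \<noteq> v \<and> ({x, y} \<in> E \<or> x = u \<and> {v, y} \<in> E \<or> y = u \<and> {x, v} \<in> E)"
    (is "?L \<longleftrightarrow> ?R")
proof
  let ?h = "\<lambda>x. if x = v then u else x"
  assume ?L
  then obtain f where f: "f \<in> E" "f \<noteq> {u, v}" "{x, y} = ?h ` f"
    by (auto simp: contract_def)
  obtain p q where pq: "f = {p, q}" "p \<noteq> q"
    using simple_graph_edgeE[OF G f(1)] by metis
  have "{x, y} = {?h p, ?h q}" using f(3) pq by simp
  then have "x = ?h p \<and> y = ?h q \<or> x = ?h q \<and> y = ?h p" by (simp only: doubleton_eq_iff)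
  then show ?R
    using f(1,2) pq uv by (auto simp: insert_commute split: if_splits)
next
  let ?h = "\<lambda>x. if x = v then u else x"
  assume R: ?R
  then consider "{x, y} \<in> E" | "x = u" "{v, y} \<in> E" | "y = u" "{x, v} \<in> E" by blast
  then show ?L
  proof cases
    case 1
    then have "{x, y} = ?h ` {x, y}" "{x, y} \<in> E - {{u, v}}" using R by auto
    then show ?thesis unfolding contract_def by blast
  next
    case 2
    then have "{x, y} = ?h ` {v, y}" "{v, y} \<in> E - {{u, v}}" using R uv by (auto simp: doubleton_eq_iff)
    then show ?thesis unfolding contract_def by blast
  next
    case 3
    then have "{x, y} = ?h ` {x, v}" "{x, v} \<in> E - {{u, v}}" using R uv by (auto simp: doubleton_eq_iff)
    then show ?thesis unfolding contract_def by blast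
  qed
qed

lemma simple_graph_contract:
  assumes G: "simple_graph V E" and uv: "{u, v} \<in> E"
  shows "simple_graph V (contract u v E)"
  unfolding simple_graph_def
proof (intro conjI ballI)
  show "finite V" using simple_graph_finite[OF G] by simp
  let ?h = "\<lambda>x. if x = v then u else x"
  fix e assume e: "e \<in> contract u v E"
  then obtain f where f: "f \<in> E" "f \<noteq> {u, v}" "e = ?h ` f"
    by (auto simp: contract_def)
  obtain p q where pq: "f = {p, q}" "p \<noteq> q" "p \<in> V" "q \<in> V"
    using simple_graph_edgeE[OF G f(1)] by metis
  have e': "e = {?h p, ?h q}" "?h p \<noteq> ?h q"
    using f pq by auto
  then show "card e = 2" by simp
  show "e \<subseteq> V"
    using e' pq simple_graph_edgeD[OF G uv] by auto
qed

lemma simple_graph_insert: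
  assumes "simple_graph V E" "u \<in> V" "v \<in> V" "u \<noteq> v"
  shows "simple_graph V (insert {u, v} E)"
  using assms by (auto simp: simple_graph_def)

lemma nbrs_insert:
  "nbrs (insert {u, v} E) x = (if x = u then insert v (nbrs E x) else if x = v then insert u (nbrs E x) else nbrs E x)"
  by (auto simp: nbrs_def doubleton_eq_iff)

lemma nbrs_contract:
  assumes G: "simple_graph V E" and uv: "u \<noteq> v"
  shows "nbrs (contract u v E) v = {}"
    and "nbrs (contract u v E) u = nbrs E u \<union> nbrs E v - {u, v}"
    and "x \<notin> {u, v} \<Longrightarrow> nbrs (contract u v E) x =
      (if v \<in> nbrs E x then insert u (nbrs E x - {v}) else nbrs E x)"
proof -
  have irr: "{a, a} \<notin> E" for a using simple_graph_edgeD(3)[OF G, of a a] by blast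
  note [simp] = nbrs_def contract_edge_iff[OF G uv]
  show "nbrs (contract u v E) v = {}" by simp
  show "nbrs (contract u v E) u = nbrs E u \<union> nbrs E v - {u, v}"
    using uv irr by (auto simp: insert_commute)
  show "nbrs (contract u v E) x = (if v \<in> nbrs E x then insert u (nbrs E x - {v}) else nbrs E x)"
    if x: "x \<notin> {u, v}"
  proof -
    have "y \<in> nbrs (contract u v E) x \<longleftrightarrow>
      y \<in> (if v \<in> nbrs E x then insert u (nbrs E x - {v}) else nbrs E x)" for y
      using x uv irr[of x] by (cases "y = u"; cases "y = v") auto
    then show ?thesis by blast
  qed
qed

text \<open>The vertex set never changes: \<open>N\<close> is the contraction of \<open>uv\<close> together with the isolated
  vertex \<open>v\<close>, and \<open>M\<close> is the near-contraction, in which \<open>v\<close> hangs as a leaf at \<open>u\<close>. The last two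
  assumptions ensure that the contraction turns no internal vertex into a leaf.\<close>

locale near_contraction =
  fixes V :: "'a set" and E :: "'a set set" and u v :: 'a
  assumes G: "simple_graph V E" and uv: "{u, v} \<in> E"
    and du: "degree E u \<ge> 2" and dv: "degree E v \<ge> 2"
    and common: "\<And>x. x \<in> nbrs E u \<Longrightarrow> x \<in> nbrs E v \<Longrightarrow> degree E x \<ge> 3"
    and dc: "card (nbrs E u \<union> nbrs E v - {u, v}) \<ge> 2"
begin

abbreviation "N \<equiv> contract u v E"
abbreviation "M \<equiv> insert {u, v} N"

lemma uv_V: "u \<in> V" "v \<in> V" "u \<noteq> v"
  using simple_graph_edgeD[OF G uv] .

lemma GN: "simple_graph V N"
  by (rule simple_graph_contract[OF G uv])

lemma GM: "simple_graph V M"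
  by (rule simple_graph_insert[OF GN uv_V])

lemmas nbrs_N = nbrs_contract[OF G uv_V(3)]

lemma deg_v: "degree N v = 0" "degree M v = 1"
  using uv_V by (auto simp: degree_eq_card_nbrs[OF GN] degree_eq_card_nbrs[OF GM] nbrs_N nbrs_insert)

lemma deg_u: "degree N u \<ge> 2" "degree M u = Suc (degree N u)"
  using uv_V dc finite_nbrs[OF G]
  by (auto simp: degree_eq_card_nbrs[OF GN] degree_eq_card_nbrs[OF GM] nbrs_N nbrs_insert)

lemma deg_M: "x \<notin> {u, v} \<Longrightarrow> degree M x = degree N x"
  by (auto simp: degree_eq_card_nbrs[OF GN] degree_eq_card_nbrs[OF GM] nbrs_N nbrs_insert)

lemma deg_N_uncommon:
  assumes x: "x \<notin> {u, v}" and un: "u \<notin> nbrs E x \<or> v \<notin> nbrs E x"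
  shows "degree N x = degree E x"
proof -
  have "card (nbrs N x) = card (nbrs E x)"
  proof (cases "v \<in> nbrs E x")
    case True
    then have "u \<notin> nbrs E x - {v}" "card (nbrs E x) > 0"
      using un finite_nbrs[OF G, of x] by (auto simp: card_gt_0_iff)
    then show ?thesis
      using True finite_nbrs[OF G, of x] by (simp add: nbrs_N(3)[OF x])
  qed (simp add: nbrs_N(3)[OF x])
  then show ?thesis by (simp add: degree_eq_card_nbrs[OF GN] degree_eq_card_nbrs[OF G])
qed

text \<open>A common neighbor of \<open>u\<close> and \<open>v\<close> loses one edge and keeps at
  least two by \<open>common\<close>; any other vertex at most exchanges its neighbor
  \<open>v\<close> for \<open>u\<close>.\<close>

lemma deg_N:
  assumes x: "x \<notin> {u, v}"
  shows "degree N x = degree E x \<or> degree N x \<ge> 2 \<and> degree E x \<ge> 2"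
proof (cases "x \<in> nbrs E u \<and> x \<in> nbrs E v")
  case True
  then have "u \<in> nbrs E x" "v \<in> nbrs E x" by (auto simp: nbrs_sym)
  then have "nbrs N x = nbrs E x - {v}" using nbrs_N(3)[OF x] uv_V by auto
  then have "degree N x = degree E x - 1"
    using \<open>v \<in> nbrs E x\<close> by (simp add: degree_eq_card_nbrs[OF GN] degree_eq_card_nbrs[OF G])
  then show ?thesis using common[of x] True by auto
next
  case False
  then have "u \<notin> nbrs E x \<or> v \<notin> nbrs E x" by (auto simp: nbrs_sym)
  then show ?thesis using deg_N_uncommon[OF x] by simp
qed

lemma deg_N_eq:
  assumes none: "nbrs E u \<inter> nbrs E v = {}"
  shows "x \<notin> {u, v} \<Longrightarrow> degree N x = degree E x" and "degree N u = degree E u + degree E v - 2"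
proof -
  assume x: "x \<notin> {u, v}"
  have "u \<notin> nbrs E x \<or> v \<notin> nbrs E x" using none by (auto simp: nbrs_sym)
  then show "degree N x = degree E x" by (rule deg_N_uncommon[OF x])
next
  have u: "u \<in> nbrs E v" "v \<in> nbrs E u" using uv by (auto simp: nbrs_def insert_commute)
  then have "nbrs N u = (nbrs E u - {v}) \<union> (nbrs E v - {u})"
    using nbrs_subset[OF G, of u] nbrs_subset[OF G, of v] nbrs_N(2) by auto
  moreover have "card \<dots> = (card (nbrs E u) - 1) + (card (nbrs E v) - 1)"
    using none u finite_nbrs[OF G] by (subst card_Un_disjoint) auto
  ultimately show "degree N u = degree E u + degree E v - 2"
    using du dv by (simp add: degree_eq_card_nbrs[OF GN] degree_eq_card_nbrs[OF G])
qed

lemma leaf_N: "degree N y = 1 \<longleftrightarrow> degree E y = 1"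
  using deg_N[of y] deg_u deg_v du dv by (cases "y = u"; cases "y = v") auto

lemma leaf_M: "degree M y = 1 \<longleftrightarrow> degree E y = 1 \<or> y = v"
  using deg_N[of y] deg_M[of y] deg_u deg_v du dv by (cases "y = u"; cases "y = v") auto

lemma leaf_star_other:
  assumes x: "x \<notin> {u, v}"
  shows "leaf_star N x = leaf_star E x" "leaf_star M x = leaf_star E x"
proof -
  have "y \<in> nbrs N x \<longleftrightarrow> y \<in> nbrs E x" if "degree E y = 1" for y
  proof -
    have "y \<noteq> u" "y \<noteq> v" using that du dv by auto
    then show ?thesis using uv_V by (auto simp: nbrs_N(3)[OF x])
  qed
  then show "leaf_star N x = leaf_star E x" by (auto simp: leaf_star_def leaf_N simp del: One_nat_def)
  moreover have "v \<notin> nbrs M x" using x uv_V by (auto simp: nbrs_insert nbrs_N(3)[OF x])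
  ultimately show "leaf_star M x = leaf_star E x"
    using x by (auto simp: leaf_star_def leaf_N leaf_M nbrs_insert simp del: One_nat_def)
qed

lemma leaf_star_merged:
  "leaf_star N u = leaf_star E u \<union> leaf_star E v - {v}"
  "leaf_star N v = {v}"
  "leaf_star M u = leaf_star E u \<union> leaf_star E v"
  using uv_V du dv by (auto simp: leaf_star_def leaf_N leaf_M nbrs_insert nbrs_N simp del: One_nat_def)

lemma leaf_star_disj: "leaf_star E u \<inter> leaf_star E v = {}"
proof -
  have "False" if y: "y \<in> nbrs E u" "y \<in> nbrs E v" "degree E y = 1" for y
    using degree_one_nbrs[OF G y(3), of u] degree_one_nbrs[OF G y(3), of v] y uv_V nbrs_sym
    by (metis singleton_inject)
  then show ?thesis using uv_V du dv by (auto simp: leaf_star_def)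
qed

lemma card_leaf_star_M: "card (leaf_star M u) = card (leaf_star E u) + card (leaf_star E v)"
  using card_Un_disjoint[OF _ _ leaf_star_disj] card_leaf_star(1)[OF G] by (simp add: leaf_star_merged)

lemma card_leaf_star_N: "card (leaf_star N u) = card (leaf_star E u) + card (leaf_star E v) - 1"
proof -
  have "v \<in> leaf_star E v" by (simp add: leaf_star_def)
  then show ?thesis
    using card_leaf_star_M card_leaf_star(1)[OF G] by (simp add: leaf_star_merged)
qed

lemma isolated_edges_same: "isolated_edges N = isolated_edges E" "isolated_edges M = isolated_edges E"
proof -
  have *: "e \<in> N \<longleftrightarrow> e \<in> E" if e1: "\<forall>x\<in>e. degree E x = 1" "card e = 2" for e
  proof -
    obtain x y where e: "e = {x, y}" "x \<noteq> y" using e1(2) by (auto simp: card_2_iff)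
    then have "x \<notin> {u, v}" "y \<notin> {u, v}" using e1(1) du dv by auto
    then show ?thesis using e by (auto simp: contract_edge_iff[OF G uv_V(3)])
  qed
  show "isolated_edges N = isolated_edges E"
    using * G GN by (auto simp: isolated_edges_def leaf_N simple_graph_def simp del: One_nat_def)
  moreover have "isolated_edges M = isolated_edges N"
  proof -
    have "{u, v} \<notin> isolated_edges M" using deg_u by (auto simp: isolated_edges_def)
    moreover have "v \<notin> e" if "e \<in> N" for e
      using that uv_V by (auto simp: contract_def)
    ultimately show ?thesis by (auto simp: isolated_edges_def leaf_M leaf_N simp del: One_nat_def)
  qed
  ultimately show "isolated_edges M = isolated_edges E" by simp
qed

lemma nonleaves_same: "nonleaves V N = nonleaves V E" "nonleaves V M = nonleaves V E - {v}"
  by (auto simp: nonleaves_def leaf_N leaf_M simp del: One_nat_def)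

text \<open>Only the blocks at \<open>u\<close> and \<open>v\<close> change. Their leaves are
  collected at \<open>u\<close>; in the contraction \<open>v\<close> remains as a block of size 1,
  in the near-contraction it is one more leaf at \<open>u\<close>. The other blocks keep their sizes
  and form \<open>R\<close>.\<close>

lemma lc_types:
  obtains R where
    "lc_type V E = {#card (leaf_star E u), card (leaf_star E v)#} + R"
    "lc_type V N = {#card (leaf_star E u) + card (leaf_star E v) - 1, 1#} + R"
    "lc_type V M = {#card (leaf_star E u) + card (leaf_star E v)#} + R"
proof -
  have finN: "finite (nonleaves V E)" using simple_graph_finite[OF G] by (simp add: nonleaves_def)
  let ?c = "\<lambda>E. image_mset (\<lambda>x. card (leaf_star E x)) (mset_set (nonleaves V E - {u, v}))"
  have c: "?c N = ?c E"
    unfolding nonleaves_same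
  proof (rule image_mset_cong)
    fix x assume "x \<in># mset_set (nonleaves V E - {u, v})"
    then have "x \<notin> {u, v}" using finN by simp
    then show "card (leaf_star N x) = card (leaf_star E x)" by (simp add: leaf_star_other)
  qed
  have c': "image_mset (\<lambda>x. card (leaf_star M x)) (mset_set (nonleaves V M - {u})) = ?c E"
    unfolding nonleaves_same Diff_insert2[symmetric] insert_commute[of v u]
  proof (rule image_mset_cong)
    fix x assume "x \<in># mset_set (nonleaves V E - {u, v})"
    then have "x \<notin> {u, v}" using finN by simp
    then show "card (leaf_star M x) = card (leaf_star E x)" by (simp add: leaf_star_other)
  qed
  have nl: "{u, v} \<subseteq> nonleaves V E" using uv_V du dv by (auto simp: nonleaves_def)
  then have nl': "{u, v} \<subseteq> nonleaves V N" "{u} \<subseteq> nonleaves V M"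
    using uv_V by (auto simp: nonleaves_same)
  show thesis
    using that[of "?c E + replicate_mset (card (isolated_edges E)) 2"]
      lc_type_split[OF G nl] lc_type_split[OF GN nl'(1)] lc_type_split[OF GM nl'(2)]
      card_leaf_star_M card_leaf_star_N uv_V c c' isolated_edges_same leaf_star_merged(2)
    by simp
qed

lemma lc_type_M: "lc_type V E < lc_type V M"
proof -
  obtain R where R: "lc_type V E = {#card (leaf_star E u), card (leaf_star E v)#} + R"
    "lc_type V M = {#card (leaf_star E u) + card (leaf_star E v)#} + R"
    by (rule lc_types)
  have "R + {#card (leaf_star E u), card (leaf_star E v)#} < R + {#card (leaf_star E u) + card (leaf_star E v)#}"
    using card_leaf_star(2)[OF G, of u] card_leaf_star(2)[OF G, of v]
    by (intro union_less_multisetI) auto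
  then show ?thesis by (simp add: R add_ac)
qed

text \<open>If both star sizes \<open>a\<close> and \<open>b\<close> are at least 2, then
  \<open>a + b - 1\<close> exceeds each of them. If one of them is 1, the pairs \<open>a\<close>,
  \<open>b\<close> and \<open>a + b - 1\<close>, \<open>1\<close> coincide, which is
  \<open>lc_type_N_eq\<close>.\<close>

lemma lc_type_N_less:
  assumes "leaf_star E u \<noteq> {u}" "leaf_star E v \<noteq> {v}"
  shows "lc_type V E < lc_type V N"
proof -
  let ?a = "card (leaf_star E u)" and ?b = "card (leaf_star E v)"
  obtain R where R: "lc_type V E = {#?a, ?b#} + R" "lc_type V N = {#?a + ?b - 1, 1#} + R"
    by (rule lc_types)
  have "?a \<ge> 2" "?b \<ge> 2"
    using card_leaf_star(2,3)[OF G, of u] card_leaf_star(2,3)[OF G, of v] assms by linarith+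
  then have "R + {#?a, ?b#} < R + {#?a + ?b - 1, 1#}"
    by (intro union_less_multisetI) auto
  then show ?thesis by (simp add: R add_ac)
qed

lemma lc_type_N_eq:
  assumes "leaf_star E u = {u} \<or> leaf_star E v = {v}"
  shows "lc_type V N = lc_type V E"
proof -
  let ?a = "card (leaf_star E u)" and ?b = "card (leaf_star E v)"
  obtain R where R: "lc_type V E = {#?a, ?b#} + R" "lc_type V N = {#?a + ?b - 1, 1#} + R"
    by (rule lc_types)
  have "?a = 1 \<or> ?b = 1"
    using card_leaf_star(3)[OF G] assms by metis
  then show ?thesis by (auto simp: R)
qed

lemma deep_finite: "finite (deep V F)" if "simple_graph V F" for F
  using simple_graph_finite[OF that] by (simp add: deep_def)

text \<open>The merged vertex is deep only if both ends were, and \<open>v\<close> becomes isolated.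
  Two deep ends thus leave one and a single deep end leaves none: the count drops by one either
  way.\<close>

lemma deep_N:
  assumes "leaf_star E u = {u} \<or> leaf_star E v = {v}"
  shows "card (deep V E) = Suc (card (deep V N))"
proof -
  have other: "x \<in> deep V N \<longleftrightarrow> x \<in> deep V E" if "x \<notin> {u, v}" for x
    using deg_N[OF that] leaf_star_other[OF that] by (auto simp: deep_def)
  have v: "v \<notin> deep V N" by (simp add: deep_def deg_v)
  have self: "x \<in> leaf_star E x" for x by (simp add: leaf_star_def)
  have u: "u \<in> deep V N \<longleftrightarrow> leaf_star E u = {u} \<and> leaf_star E v = {v}"
    using deg_u uv_V self[of u] self[of v] leaf_star_disj by (auto simp: deep_def leaf_star_merged)
  have E: "u \<in> deep V E \<longleftrightarrow> leaf_star E u = {u}" "v \<in> deep V E \<longleftrightarrow> leaf_star E v = {v}"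
    using du dv uv_V by (auto simp: deep_def)
  have "deep V E = insert v (deep V N) \<or> deep V E = insert u (deep V N) \<and> u \<notin> deep V N"
  proof (cases "leaf_star E v = {v}")
    case True
    then have "x \<in> deep V E \<longleftrightarrow> x \<in> insert v (deep V N)" for x
      using other[of x] u E by (cases "x = u"; cases "x = v") auto
    then show ?thesis by blast
  next
    case False
    then have "x \<in> deep V E \<longleftrightarrow> x \<in> insert u (deep V N)" for x
      using other[of x] u v E assms by (cases "x = u"; cases "x = v") auto
    then show ?thesis using u False by blast
  qed
  then show ?thesis using v deep_finite[OF GN] by (elim disjE) auto
qed

text \<open>Each internal edge of \<open>N\<close> or \<open>M\<close> is the image of an internal
  edge other than \<open>{u, v}\<close>; in \<open>M\<close> the edge \<open>{u, v}\<close> is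
  present, but \<open>v\<close> is a leaf there.\<close>

lemma card_internal_edges:
  "card (internal_edges N) < card (internal_edges E)"
  "card (internal_edges M) < card (internal_edges E)"
proof -
  let ?H = "\<lambda>f. (\<lambda>x. if x = v then u else x) ` f"
  have sub: "internal_edges F \<subseteq> ?H ` (internal_edges E - {{u, v}})" if F: "F = N \<or> F = M" for F
  proof
    fix e assume e: "e \<in> internal_edges F"
    then have "e \<noteq> {u, v}" using F deg_v by (auto simp: internal_edges_def)
    then have "e \<in> N" using e F by (auto simp: internal_edges_def)
    then obtain f where f: "f \<in> E" "f \<noteq> {u, v}" "e = ?H f" by (auto simp: contract_def)
    have "degree E p \<ge> 2" if "p \<in> f" for p
    proof (cases "p \<in> {u, v}")
      case False
      then have "degree F p \<ge> 2" using e f that by (auto simp: internal_edges_def)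
      then show ?thesis using deg_N[OF False] deg_M[OF False] F by auto
    qed (use du dv in auto)
    then show "e \<in> ?H ` (internal_edges E - {{u, v}})"
      using f by (auto simp: internal_edges_def)
  qed
  have fin: "finite (internal_edges E)" using simple_graph_finite[OF G] by (simp add: internal_edges_def)
  have "{u, v} \<in> internal_edges E" using uv du dv by (simp add: internal_edges_def)
  then have "card (?H ` (internal_edges E - {{u, v}})) < card (internal_edges E)"
    using fin by (meson card_Diff1_less card_image_le finite_Diff le_less_trans)
  moreover have "card (internal_edges F) \<le> card (?H ` (internal_edges E - {{u, v}}))" if "F = N \<or> F = M" for F
    using sub[OF that] fin by (intro card_mono) auto
  ultimately show "card (internal_edges N) < card (internal_edges E)"
    "card (internal_edges M) < card (internal_edges E)"
    by (auto intro: le_less_trans)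
qed

end

section \<open>Deleting and adding edges\<close>

lemma nbrs_delete:
  "nbrs (E - {{u, v}}) x = (if x = u then nbrs E u - {v} else if x = v then nbrs E v - {u} else nbrs E x)"
  by (auto simp: nbrs_def doubleton_eq_iff)

lemma degree_delete:
  assumes G: "simple_graph V E" and uv: "{u, v} \<in> E"
  shows "degree (E - {{u, v}}) x = (if x \<in> {u, v} then degree E x - 1 else degree E x)"
proof -
  have G': "simple_graph V (E - {{u, v}})" by (rule simple_graph_subset[OF G]) auto
  have "v \<in> nbrs E u" "u \<in> nbrs E v" using uv by (auto simp: nbrs_def insert_commute)
  then show ?thesis
    by (auto simp: degree_eq_card_nbrs[OF G] degree_eq_card_nbrs[OF G'] nbrs_delete)
qed

lemma degree_mono: "simple_graph V F \<Longrightarrow> E \<subseteq> F \<Longrightarrow> degree E x \<le> degree F x"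
  unfolding degree_def by (intro card_mono) (auto dest: simple_graph_finite)

locale deletion =
  fixes V :: "'a set" and E :: "'a set set" and u v :: 'a
  assumes G: "simple_graph V E" and uv: "{u, v} \<in> E"
    and du: "degree E u \<ge> 2" and dv: "degree E v \<ge> 2"
begin

abbreviation "D \<equiv> E - {{u, v}}"

lemma GD: "simple_graph V D"
  by (rule simple_graph_subset[OF G]) auto

lemma internal_D: "internal_edges D \<subseteq> internal_edges E - {{u, v}}"
proof
  fix f assume f: "f \<in> internal_edges D"
  then have "degree E x \<ge> 2" if "x \<in> f" for x
    using that degree_mono[OF G, of D x] by (force simp: internal_edges_def)
  then show "f \<in> internal_edges E - {{u, v}}" using f by (auto simp: internal_edges_def)
qed

text \<open>Deletion only lowers degrees, so an edge may stop being internal but none becomes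
  internal, and the deleted edge was internal itself.\<close>

lemma leaf_graph_D: "E - internal_edges E \<subseteq> D - internal_edges D"
proof -
  have "{u, v} \<in> internal_edges E" using uv du dv by (simp add: internal_edges_def)
  then show ?thesis using internal_D by blast
qed

lemma lc_type_D: "lc_type V E \<le> lc_type V D"
  unfolding lc_type_def
  by (rule components_refine_le[OF _ leaf_graph_D]) (rule simple_graph_subset[OF GD], auto)

lemma card_internal_edges_D: "card (internal_edges D) < card (internal_edges E)"
proof -
  have fin: "finite (internal_edges E)" using simple_graph_finite[OF G] by (simp add: internal_edges_def)
  have "{u, v} \<in> internal_edges E" using uv du dv by (simp add: internal_edges_def)
  then show ?thesis using internal_D fin by (intro psubset_card_mono) auto
qed

text \<open>The end \<open>u\<close>, formerly a block of its own, becomes a leaf and is now joined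
  to its remaining neighbor.\<close>

lemma lc_type_D_less:
  assumes u: "degree E u = 2" "leaf_star E u = {u}"
  shows "lc_type V E < lc_type V D"
  unfolding lc_type_def
proof (rule components_refine[OF _ leaf_graph_D])
  show "simple_graph V (D - internal_edges D)" by (rule simple_graph_subset[OF GD]) auto
  have du': "degree D u = 1" using u by (simp add: degree_delete[OF G uv])
  then obtain y where "nbrs D u = {y}" by (auto simp: degree_eq_card_nbrs[OF GD] card_1_singleton_iff)
  then have y: "{u, y} \<in> D" by (auto simp: nbrs_def)
  then have "conn (D - internal_edges D) u y" using du' by (intro conn_edge leaf_edgeI) auto
  moreover have "u \<noteq> y" using simple_graph_edgeD[OF GD y] by blast
  ultimately have "{u} \<notin> components V (D - internal_edges D)"
    by (rule singleton_notin_components)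
  moreover have "{u} \<in> components V (E - internal_edges E)"
    using u simple_graph_edgeD[OF G uv] by (auto simp: components_leaf_graph[OF G] nonleaves_def image_iff)
  ultimately show "components V (E - internal_edges E) \<noteq> components V (D - internal_edges D)" by blast
qed

text \<open>An edge stops being internal only if one of its ends drops to degree one. Such an end
  has degree two in \<open>E\<close>; if it has a leaf neighbor, its only edge besides
  \<open>{u, v}\<close> leads to that leaf and was not internal before.\<close>

lemma leaf_graph_D_eq:
  assumes u: "degree E u = 2 \<Longrightarrow> leaf_star E u \<noteq> {u}" and v: "degree E v = 2 \<Longrightarrow> leaf_star E v \<noteq> {v}"
  shows "D - internal_edges D = E - internal_edges E"
proof -
  have key: False
    if f: "f \<in> internal_edges E" "f \<noteq> {a, b}" "a \<in> f" and ab: "{a, b} \<in> E" "degree E b \<ge> 2"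
      and a: "degree E a = 2" "leaf_star E a \<noteq> {a}" for a b f
  proof -
    obtain y where y: "y \<in> nbrs E a" "degree E y = 1" using a(2) by (auto simp: leaf_star_def)
    have b: "b \<in> nbrs E a" using ab by (simp add: nbrs_def)
    have "b \<noteq> y" using y ab by auto
    then have "nbrs E a = {b, y}"
      using a(1) b y finite_nbrs[OF G, of a]
      by (intro card_subset_eq[symmetric]) (auto simp: degree_eq_card_nbrs[OF G])
    moreover obtain z where "f = {a, z}" "z \<in> nbrs E a"
    proof -
      have fE: "f \<in> E" using f by (simp add: internal_edges_def)
      obtain p q where "f = {p, q}" using simple_graph_edgeE[OF G fE] by metis
      then show thesis using f(3) fE that[of q] that[of p] by (auto simp: nbrs_def insert_commute)
    qed
    ultimately have "f = {a, y}" using f by auto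
    then show False using f y by (auto simp: internal_edges_def)
  qed
  have "internal_edges E - {{u, v}} \<subseteq> internal_edges D"
  proof
    fix f assume f: "f \<in> internal_edges E - {{u, v}}"
    have "degree D p \<ge> 2" if "p \<in> f" for p
    proof (rule ccontr)
      assume "\<not> degree D p \<ge> 2"
      moreover have "degree E p \<ge> 2" using f that by (auto simp: internal_edges_def)
      ultimately have "p \<in> {u, v}" "degree E p = 2"
        by (auto simp: degree_delete[OF G uv] split: if_splits)
      then show False
        using key[of f u v] key[of f v u] f that uv du dv u v by (auto simp: insert_commute)
    qed
    then show "f \<in> internal_edges D" using f by (auto simp: internal_edges_def)
  qed
  moreover have "{u, v} \<in> internal_edges E" using uv du dv by (simp add: internal_edges_def)
  ultimately show ?thesis using internal_D by blast
qed

lemma lc_type_D_eq: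
  assumes "degree E u = 2 \<Longrightarrow> leaf_star E u \<noteq> {u}" and "degree E v = 2 \<Longrightarrow> leaf_star E v \<noteq> {v}"
  shows "lc_type V D = lc_type V E"
  using leaf_graph_D_eq[OF assms] by (simp add: lc_type_def)

lemma deep_D_eq:
  assumes u: "degree E u = 2 \<Longrightarrow> leaf_star E u \<noteq> {u}" and v: "degree E v = 2 \<Longrightarrow> leaf_star E v \<noteq> {v}"
  shows "deep V D = deep V E"
proof -
  have "x \<in> deep V D \<longleftrightarrow> x \<in> deep V E" for x
  proof (cases "degree D x \<ge> 2")
    case True
    then have "degree E x \<ge> 2" by (auto simp: degree_delete[OF G uv] split: if_splits)
    then have "leaf_star D x = leaf_star E x"
      using True component_nonleaf[OF G, of x] component_nonleaf[OF GD, of x] leaf_graph_D_eq[OF u v]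
      by simp
    then show ?thesis using True \<open>degree E x \<ge> 2\<close> by (simp add: deep_def)
  next
    case False
    then have "degree E x \<ge> 2 \<Longrightarrow> x \<in> {u, v} \<and> degree E x = 2"
      by (auto simp: degree_delete[OF G uv] split: if_splits)
    then show ?thesis using False u v by (auto simp: deep_def)
  qed
  then show ?thesis by blast
qed

end

section \<open>Attaching an isolated vertex\<close>

lemma degree_insert:
  assumes G: "simple_graph V E" and uv: "{u, v} \<notin> E" "u \<noteq> v" "u \<in> V" "v \<in> V"
  shows "degree (insert {u, v} E) x = (if x \<in> {u, v} then degree E x + 1 else degree E x)"
  using degree_delete[OF simple_graph_insert[OF G uv(3,4,2)], of u v x] uv(1)
    degree_pos[OF simple_graph_insert[OF G uv(3,4,2)], of u v] by (auto split: if_splits)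

text \<open>As \<open>z\<close> is internal already, every edge that was not internal stays so,
  while \<open>w\<close> ceases to be a block of its own. In the case of one root, this puts the
  near-contraction strictly above the leading partition.\<close>

lemma lc_type_attach_leaf:
  assumes G: "simple_graph V S" and w: "w \<in> V" "degree S w = 0" and z: "z \<in> V" "degree S z \<ge> 2"
  shows "lc_type V S < lc_type V (insert {w, z} S)"
  unfolding lc_type_def
proof (rule components_refine)
  let ?S = "insert {w, z} S"
  have wz: "w \<noteq> z" "{w, z} \<notin> S" using w z degree_pos[OF G, of w z] by auto
  have GS: "simple_graph V ?S" by (rule simple_graph_insert[OF G w(1) z(1) wz(1)])
  then show "simple_graph V (?S - internal_edges ?S)" by (rule simple_graph_subset) auto
  have deg: "degree ?S x = (if x \<in> {w, z} then degree S x + 1 else degree S x)" for x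
    by (rule degree_insert[OF G wz(2,1) w(1) z(1)])
  have deg0: "degree ?S x = 1" if e: "x \<in> e" "e \<in> S" "\<not> degree S x \<ge> 2" for x e
  proof -
    obtain p q where pq: "e = {p, q}" using simple_graph_edgeE[OF G e(2)] by metis
    then have "degree S x \<ge> 1" using degree_pos[OF G, of p q] e by auto
    then show ?thesis using e w z by (auto simp: deg)
  qed
  show "S - internal_edges S \<subseteq> ?S - internal_edges ?S"
  proof
    fix e assume e: "e \<in> S - internal_edges S"
    then obtain x where "x \<in> e" "\<not> degree S x \<ge> 2" by (auto simp: internal_edges_def)
    then have "degree ?S x = 1" "x \<in> e" using deg0 e by blast+
    then have "e \<notin> internal_edges ?S" unfolding internal_edges_def by force
    then show "e \<in> ?S - internal_edges ?S" using e by blast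
  qed
  have "conn (?S - internal_edges ?S) w z"
    using w wz by (intro conn_edge leaf_edgeI) (auto simp: deg)
  then have "{w} \<notin> components V (?S - internal_edges ?S)"
    using wz(1) by (rule singleton_notin_components)
  moreover have "{w} = component (S - internal_edges S) w"
  proof -
    have "nbrs S w = {}" using w finite_nbrs[OF G, of w] by (simp add: degree_eq_card_nbrs[OF G])
    then show ?thesis using component_nonleaf[OF G, of w] w by (simp add: leaf_star_def)
  qed
  then have "{w} \<in> components V (S - internal_edges S)" using w by (auto simp: components_def)
  ultimately show "components V (S - internal_edges S) \<noteq> components V (?S - internal_edges ?S)"
    by blast
qed

text \<open>The vertex \<open>x\<close> leaves the star of \<open>y\<close> and forms a block with
  \<open>w\<close>: sizes 1 and \<open>b\<close> become 2 and \<open>b - 1\<close>, where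
  \<open>b\<close> \<ge> 2 is the size of the star of \<open>y\<close>. The result is smaller unless
  \<open>b = 2\<close>, and in that case \<open>y\<close> loses its only leaf and becomes
  deep.\<close>

lemma lc_type_extend_leaf:
  assumes G: "simple_graph V S" and w: "w \<in> V" "degree S w = 0"
    and x: "degree S x = 1" and xy: "{x, y} \<in> S" and y: "degree S y \<ge> 2"
  shows "lc_type V (insert {w, x} S) \<le> lc_type V S"
    and "lc_type V (insert {w, x} S) = lc_type V S \<Longrightarrow>
      card (deep V (insert {w, x} S)) = Suc (card (deep V S))"
proof -
  let ?S = "insert {w, x} S"
  let ?R = "image_mset (\<lambda>z. card (leaf_star S z)) (mset_set (nonleaves V S - {w, y}))
    + replicate_mset (card (isolated_edges S)) 2"
  let ?b = "card (leaf_star S y)"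
  have V: "x \<in> V" "y \<in> V" "x \<noteq> y" using simple_graph_edgeD[OF G xy] .
  have ne: "w \<noteq> x" "w \<noteq> y" "x \<noteq> y" using w x y by auto
  have nS: "nbrs S x = {y}" "nbrs S w = {}"
    using degree_one_nbrs[OF G x, of y] xy w finite_nbrs[OF G, of w]
    by (auto simp: nbrs_def degree_eq_card_nbrs[OF G])
  have wx: "{w, x} \<notin> S" using nS(2) by (auto simp: nbrs_def)
  have GS: "simple_graph V ?S" by (rule simple_graph_insert[OF G w(1) V(1) ne(1)])
  have deg: "degree ?S z = (if z \<in> {w, x} then degree S z + 1 else degree S z)" for z
    by (rule degree_insert[OF G wx ne(1) w(1) V(1)])
  have nw: "w \<notin> nbrs S z" for z using nS(2) nbrs_sym[of w S z] by auto
  have nx: "x \<in> nbrs S z \<longleftrightarrow> z = y" for z using nS(1) nbrs_sym[of x S z] by auto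
  have leaf: "degree ?S z = 1 \<longleftrightarrow> degree S z = 1 \<and> z \<noteq> x \<or> z = w" for z
    using w x by (auto simp: deg)
  have star_x: "leaf_star ?S x = {x, w}"
    using y ne w x nS by (auto simp: leaf_star_def nbrs_insert leaf simp del: One_nat_def)
  have star_w: "leaf_star S w = {w}" using nS by (simp add: leaf_star_def)
  have star_y: "leaf_star ?S y = leaf_star S y - {x}" "x \<in> leaf_star S y"
    using ne x nx[of y] nw[of y]
    by (auto simp: leaf_star_def nbrs_insert leaf simp del: One_nat_def)
  have star: "leaf_star ?S z = leaf_star S z" if "z \<notin> {w, x, y}" for z
    using that nx[of z] nw[of z]
    by (auto simp: leaf_star_def nbrs_insert leaf simp del: One_nat_def)
  have iso: "isolated_edges ?S = isolated_edges S"
  proof -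
    have "e \<in> S \<Longrightarrow> w \<notin> e" for e
      using nw nS(2) simple_graph_edgeE[OF G, of e] unfolding nbrs_def
      by (metis empty_iff insertE insert_commute mem_Collect_eq singletonD)
    moreover have e_xy: "e = {x, y}" if e: "e \<in> S" "x \<in> e" for e
    proof -
      obtain p q where "e = {p, q}" using simple_graph_edgeE[OF G e(1)] by metis
      then obtain z where "e = {x, z}" using e(2) by auto
      then show ?thesis using nS(1) e(1) by (auto simp: nbrs_def)
    qed
    ultimately have "e \<in> isolated_edges ?S \<longleftrightarrow> e \<in> isolated_edges S" for e
    proof (cases "x \<in> e \<and> e \<in> S")
      case True
      then have "y \<in> e" "degree S y \<noteq> 1" using e_xy[of e] y by auto
      then show ?thesis using True ne unfolding isolated_edges_def by (auto simp only: leaf mem_Collect_eq)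
    qed (use ne in \<open>auto simp: isolated_edges_def leaf simp del: One_nat_def\<close>)
    then show ?thesis by blast
  qed
  have nl: "nonleaves V ?S = insert x (nonleaves V S - {w})"
    using V x w by (auto simp: nonleaves_def leaf simp del: One_nat_def)
  have sub: "{w, y} \<subseteq> nonleaves V S" "{x, y} \<subseteq> nonleaves V ?S"
    using w V y ne x by (auto simp: nonleaves_def deg)
  have "nonleaves V ?S - {x, y} = nonleaves V S - {w, y}"
    using x ne unfolding nl by (auto simp: nonleaves_def)
  moreover have "image_mset (\<lambda>z. card (leaf_star ?S z)) (mset_set (nonleaves V S - {w, y}))
    = image_mset (\<lambda>z. card (leaf_star S z)) (mset_set (nonleaves V S - {w, y}))"
  proof (rule image_mset_cong)
    fix z assume "z \<in># mset_set (nonleaves V S - {w, y})"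
    then have "z \<in> nonleaves V S - {w, y}"
      using simple_graph_finite[OF G] by (simp add: nonleaves_def)
    then have "z \<notin> {w, x, y}" using x by (auto simp: nonleaves_def)
    then show "card (leaf_star ?S z) = card (leaf_star S z)" by (simp add: star)
  qed
  ultimately have R: "image_mset (\<lambda>z. card (leaf_star ?S z)) (mset_set (nonleaves V ?S - {x, y}))
    = image_mset (\<lambda>z. card (leaf_star S z)) (mset_set (nonleaves V S - {w, y}))" by simp
  have T: "lc_type V S = {#1, ?b#} + ?R" "lc_type V ?S = {#2, ?b - 1#} + ?R"
    using lc_type_split[OF G sub(1)] lc_type_split[OF GS sub(2)] ne
      card_leaf_star(1)[OF G, of y]
    unfolding R iso by (simp_all add: star_x star_y star_w)
  have self: "y \<in> leaf_star S y" by (simp add: leaf_star_def)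
  have b: "?b \<ge> 2"
    using card_mono[of "leaf_star S y" "{x, y}"] star_y(2) self ne card_leaf_star(1)[OF G, of y] by auto
  have less: "lc_type V ?S < lc_type V S" if "?b \<noteq> 2"
  proof -
    have "?R + {#2, ?b - 1#} < ?R + {#1, ?b#}"
      using b that by (intro union_less_multisetI) auto
    then show ?thesis by (simp only: T add.commute)
  qed
  have eq: "lc_type V ?S = lc_type V S" if "?b = 2"
    using that by (simp add: T add_mset_commute)
  show "lc_type V ?S \<le> lc_type V S" using less eq by fastforce
  assume "lc_type V ?S = lc_type V S"
  then have "?b = 2" using less by force
  then have by2: "leaf_star S y = {x, y}"
    using star_y(2) self ne card_leaf_star(1)[OF G, of y]
    by (intro card_subset_eq[symmetric]) auto
  have "z \<in> deep V ?S \<longleftrightarrow> z \<in> insert y (deep V S)" for z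
  proof (cases "z \<in> {w, x, y}")
    case True
    then show ?thesis using by2 star_x star_y V y ne w x by (auto simp: deep_def deg)
  next
    case False
    then show ?thesis using star[OF False] by (auto simp: deep_def deg)
  qed
  then have "deep V ?S = insert y (deep V S)" by blast
  moreover have "y \<notin> deep V S" using by2 ne by (auto simp: deep_def)
  moreover have "finite (deep V S)" using simple_graph_finite[OF G] by (simp add: deep_def)
  ultimately show "card (deep V ?S) = Suc (card (deep V S))" by simp
qed

section \<open>Forests and cycles\<close>

text \<open>A forest is a graph all of whose edges are bridges; unlike the absence of cyclic vertex
  sequences, this passes to contractions by lifting walks.\<close>

definition forest :: "'a set set \<Rightarrow> bool" where
  "forest E \<longleftrightarrow> (\<forall>x y. {x, y} \<in> E \<longrightarrow> \<not> conn (E - {{x, y}}) x y)"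

lemma forestD: "forest E \<Longrightarrow> {x, y} \<in> E \<Longrightarrow> conn (E - {{x, y}}) x y \<Longrightarrow> False"
  by (auto simp: forest_def)

lemma forest_subset:
  assumes "forest F" "E \<subseteq> F"
  shows "forest E"
proof -
  have "conn (F - {{x, y}}) x y" if "conn (E - {{x, y}}) x y" for x y
    using that by (rule conn_mono[rotated]) (use assms in auto)
  then show ?thesis using assms unfolding forest_def by blast
qed

text \<open>An edge of the contraction comes from an edge \<open>g\<close> whose image differs from
  that of \<open>f\<close>, so \<open>g\<close> is not \<open>f\<close>. Where \<open>g\<close> ends
  in \<open>v\<close> instead of \<open>u\<close>, the walk is extended along \<open>{u, v}\<close>,
  which is not \<open>f\<close> either.\<close>

lemma contract_lift_edge:
  assumes G: "simple_graph V E" and uv: "{u, v} \<in> E" and f: "f \<noteq> {u, v}"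
    and ab: "{a, b} \<in> insert {u, v} (contract u v E) - {(\<lambda>x. if x = v then u else x) ` f}"
  shows "conn (E - {f}) a b"
proof -
  let ?h = "\<lambda>x. if x = v then u else x"
  have uv': "conn (E - {f}) u v" using uv f by (intro conn_edge) auto
  have h: "conn (E - {f}) c (?h c)" for c
    using conn_sym[OF uv'] by auto
  show ?thesis
  proof (cases "{a, b} = {u, v}")
    case True
    then show ?thesis using uv' conn_sym[OF uv'] by (auto simp: doubleton_eq_iff)
  next
    case False
    then obtain g where g: "g \<in> E" "{a, b} = ?h ` g" "g \<noteq> f"
      using ab by (auto simp: contract_def)
    obtain p q where pq: "g = {p, q}" using simple_graph_edgeE[OF G g(1)] by metis
    have "conn (E - {f}) p q" using g pq by (intro conn_edge) auto
    then have "conn (E - {f}) (?h p) (?h q)"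
      using h[of q] conn_sym[OF h[of p]] conn_trans by metis
    moreover have "a = ?h p \<and> b = ?h q \<or> a = ?h q \<and> b = ?h p"
      using g(2) pq by (simp only: doubleton_eq_iff image_insert image_empty)
    ultimately show ?thesis by (auto dest: conn_sym simp del: if_split)
  qed
qed

text \<open>A walk bypassing the image of \<open>f\<close> would lift to a walk bypassing
  \<open>f\<close>. The edge \<open>{u, v}\<close> is a bridge of the near-contraction because
  \<open>v\<close> is isolated in the contraction.\<close>

lemma contract_forest:
  assumes G: "simple_graph V E" and uv: "{u, v} \<in> E" and E: "forest E"
  shows "forest (insert {u, v} (contract u v E))" "forest (contract u v E)"
proof -
  let ?h = "\<lambda>x. if x = v then u else x"
  let ?M = "insert {u, v} (contract u v E)"
  have ne: "u \<noteq> v" using simple_graph_edgeD[OF G uv] by blast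
  show *: "forest ?M"
    unfolding forest_def
  proof (intro allI impI notI)
    fix x y assume xy: "{x, y} \<in> ?M" and c: "conn (?M - {{x, y}}) x y"
    show False
    proof (cases "{x, y} = {u, v}")
      case True
      then have "conn (contract u v E) u v"
        using conn_mono[of "?M - {{x, y}}" "contract u v E" x y] c conn_sym[of "contract u v E" x y]
        by (auto simp: doubleton_eq_iff)
      then have "v \<in> - {v}"
        by (rule conn_closed) (use ne in \<open>auto simp: contract_edge_iff[OF G ne]\<close>)
      then show False by simp
    next
      case False
      then obtain f where f: "f \<in> E" "f \<noteq> {u, v}" "{x, y} = ?h ` f"
        using xy by (auto simp: contract_def)
      obtain p q where pq: "f = {p, q}" using simple_graph_edgeE[OF G f(1)] by metis
      have "conn (E - {f}) x y"
        using c unfolding f(3) by (rule conn_lift) (rule contract_lift_edge[OF G uv f(2)])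
      then have xy': "conn (E - {f}) x y" "conn (E - {f}) y x" by (auto intro: conn_sym)
      have uv': "conn (E - {f}) u v" using uv f by (intro conn_edge) auto
      have h: "conn (E - {f}) c (?h c)" for c
        using conn_sym[OF uv'] by auto
      have "{x, y} = {?h p, ?h q}" using f(3) pq by simp
      then have "conn (E - {f}) (?h p) (?h q)"
        using xy' by (simp only: doubleton_eq_iff) blast
      then have "conn (E - {f}) p q"
        using h[of p] conn_sym[OF h[of q]] conn_trans by metis
      then show False using forestD[OF E] f(1) pq by blast
    qed
  qed
  show "forest (contract u v E)" by (rule forest_subset[OF *]) auto
qed

section \<open>Paths and cycles as vertex sequences\<close>

fun path_edges :: "'a list \<Rightarrow> 'a set set" where
  "path_edges (x # y # l) = insert {x, y} (path_edges (y # l))"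
| "path_edges _ = {}"

lemma path_edges_append: "path_edges (xs @ a # ys) = path_edges (xs @ [a]) \<union> path_edges (a # ys)"
proof (induction xs)
  case (Cons x xs)
  then show ?case by (cases xs) auto
qed simp

lemma path_edges_rev: "path_edges (rev xs) = path_edges xs"
proof (induction xs rule: path_edges.induct)
  case (1 x y l)
  then show ?case using path_edges_append[of "rev l" y "[x]"] by (auto simp: insert_commute)
qed auto

lemma path_edges_subset: "e \<in> path_edges xs \<Longrightarrow> e \<subseteq> set xs"
  by (induction xs rule: path_edges.induct) auto

lemma path_edges_nth: "path_edges xs = {{xs ! i, xs ! Suc i} | i. Suc i < length xs}"
proof (induction xs rule: path_edges.induct)
  case (1 x y l)
  have "{{(x # y # l) ! i, (x # y # l) ! Suc i} | i. Suc i < length (x # y # l)}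
    = insert {x, y} {{(y # l) ! i, (y # l) ! Suc i} | i. Suc i < length (y # l)}"
    (is "?A = insert _ ?B")
  proof (intro equalityI subsetI)
    fix e assume "e \<in> ?A"
    then obtain i where i: "Suc i < length (x # y # l)" "e = {(x # y # l) ! i, (x # y # l) ! Suc i}" by blast
    then show "e \<in> insert {x, y} ?B" by (cases i) auto
  next
    fix e assume "e \<in> insert {x, y} ?B"
    then show "e \<in> ?A"
    proof
      assume "e = {x, y}"
      then show ?thesis by (auto intro!: exI[of _ 0])
    next
      assume "e \<in> ?B"
      then obtain i where "Suc i < length (y # l)" "e = {(y # l) ! i, (y # l) ! Suc i}" by blast
      then show ?thesis by (auto intro!: exI[of _ "Suc i"])
    qed
  qed
  with 1 show ?case by simp
qed auto

text \<open>Unrolling the closed sequence replaces indices modulo the length by recursion on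
  lists.\<close>

lemma cycle_edges_Cons: "cycle_edges (a # l) = path_edges (a # l @ [a])"
proof -
  have "(a # l @ [a]) ! i = (a # l) ! i \<and> (a # l @ [a]) ! Suc i = (a # l) ! (Suc i mod length (a # l))"
    if "i < length (a # l)" for i
    using that by (cases "i = length l") (auto simp: nth_append nth_Cons')
  then show ?thesis unfolding cycle_edges_def path_edges_nth
    by (intro Collect_cong ex_cong1) auto
qed

lemma cycle_edges_last:
  assumes "l \<noteq> []"
  shows "{last l, a} \<in> cycle_edges (a # l)"
proof -
  obtain k z where "l = k @ [z]" using assms by (metis rev_exhaust)
  then show ?thesis using path_edges_append[of "a # k" z "[a]"] by (auto simp: cycle_edges_Cons)
qed

lemma cycle_edges_rotate1: "cycle_edges (rotate1 xs) = cycle_edges xs"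
proof (cases xs)
  case (Cons a l)
  show ?thesis
  proof (cases l)
    case (Cons b m)
    then show ?thesis
      using \<open>xs = a # l\<close> path_edges_append[of "b # m" a "[b]"] by (auto simp: cycle_edges_Cons)
  qed (use Cons in simp)
qed simp

lemma cycle_edges_rotate: "cycle_edges (rotate n xs) = cycle_edges xs"
  by (induction n) (auto simp: cycle_edges_rotate1)

lemma cycle_edges_rev: "cycle_edges (rev xs) = cycle_edges xs"
proof (cases xs)
  case (Cons a l)
  have "cycle_edges (rev xs) = cycle_edges (rotate1 (a # rev l))"
    using Cons by simp
  also have "\<dots> = path_edges (rev (a # l @ [a]))"
    by (simp only: cycle_edges_rotate1 cycle_edges_Cons) simp
  finally show ?thesis using Cons by (simp only: path_edges_rev cycle_edges_Cons)
qed simp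

lemma is_cycle_rotate: "is_cycle E (rotate n xs) \<longleftrightarrow> is_cycle E xs"
  by (simp add: is_cycle_def cycle_edges_rotate)

lemma is_cycle_rev: "is_cycle E (rev xs) \<longleftrightarrow> is_cycle E xs"
  by (simp add: is_cycle_def cycle_edges_rev)

text \<open>When the walk returns to a vertex of the path, the path is cut back to that
  vertex.\<close>

lemma simple_path:
  assumes "conn E x y"
  shows "\<exists>p. distinct p \<and> p \<noteq> [] \<and> hd p = x \<and> last p = y \<and> path_edges p \<subseteq> E"
  using assms
proof (induction rule: conn_induct)
  case refl
  show ?case by (rule exI[of _ "[x]"]) auto
next
  case (step y z)
  then obtain p where p: "distinct p" "p \<noteq> []" "hd p = x" "last p = y" "path_edges p \<subseteq> E" by blast
  show ?case
  proof (cases "z \<in> set p")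
    case True
    then obtain ys zs where s: "p = ys @ z # zs" by (meson split_list)
    then show ?thesis using p path_edges_append[of ys z zs]
      by (intro exI[of _ "ys @ [z]"]) (auto simp: hd_append split: if_splits)
  next
    case False
    obtain q where q: "p = q @ [y]" using p by (metis append_butlast_last_id)
    then show ?thesis
      using p False step(2) path_edges_append[of q y "[z]"]
      by (intro exI[of _ "p @ [z]"]) (auto simp: hd_append)
  qed
qed

text \<open>Unicyclicity in a form that survives contraction: it speaks of bridges instead of
  uniqueness, so that \<open>contract_forest\<close> applies.\<close>

definition sole_cycle :: "'a set set \<Rightarrow> 'a list \<Rightarrow> bool" where
  "sole_cycle E vs \<longleftrightarrow> is_cycle E vs \<and> (\<forall>f\<in>cycle_edges vs. forest (E - {f}))"

text \<open>If \<open>{x, y}\<close> is not a bridge after the deletion of \<open>f\<close>, it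
  closes a simple path to a cycle that avoids \<open>f\<close> and so differs from the given
  one.\<close>

lemma unicyclic_sole_cycle:
  assumes U: "unicyclic V E" and C: "is_cycle E vs"
  shows "sole_cycle E vs"
  unfolding sole_cycle_def
proof (intro conjI ballI C)
  have G: "simple_graph V E" using U by (simp add: unicyclic_def)
  fix f assume f: "f \<in> cycle_edges vs"
  show "forest (E - {f})"
    unfolding forest_def
  proof (intro allI impI notI)
    fix x y assume xy: "{x, y} \<in> E - {f}" and c: "conn (E - {f} - {{x, y}}) x y"
    obtain p where p: "distinct p" "p \<noteq> []" "hd p = x" "last p = y" "path_edges p \<subseteq> E - {f} - {{x, y}}"
      using simple_path[OF c] by blast
    obtain l where l: "p = x # l" using p by (cases p) auto
    have "x \<noteq> y" using simple_graph_edgeD[OF G, of x y] xy by blast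
    then obtain m where m: "l = m @ [y]" using l p by (metis append_butlast_last_id last.simps)
    \<comment> \<open>Without a vertex between its ends, the path would be the excluded edge
      \<open>{x, y}\<close>. This gives the length three required of a cycle.\<close>
    have "m \<noteq> []" using p l m by auto
    then have len: "length p \<ge> 3" using l m by (cases m) auto
    have "cycle_edges p = path_edges p \<union> {{x, y}}"
      using path_edges_append[of "x # m" y "[x]"] l m by (auto simp: cycle_edges_Cons insert_commute)
    then have sub: "cycle_edges p \<subseteq> E - {f}" using p xy by auto
    then have "is_cycle E p" using len p by (auto simp: is_cycle_def)
    then have "cycle_edges p = cycle_edges vs" using U C unfolding unicyclic_def by blast
    then show False using sub f by blast
  qed
qed

lemma sole_cycle_rotate: "sole_cycle E (rotate n vs) \<longleftrightarrow> sole_cycle E vs"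
  by (simp add: sole_cycle_def is_cycle_rotate cycle_edges_rotate)

lemma sole_cycle_rev: "sole_cycle E (rev vs) \<longleftrightarrow> sole_cycle E vs"
  by (simp add: sole_cycle_def is_cycle_rev cycle_edges_rev)

text \<open>If a cycle edge outside the triangle \<open>u\<close>, \<open>v\<close>,
  \<open>x\<close> were deleted, \<open>{u, v}\<close> could still be bypassed via \<open>x\<close>,
  and no forest would be left. Hence the cycle is this triangle.\<close>

lemma sole_cycle_triangle:
  assumes G: "simple_graph V E" and C: "sole_cycle E (u # v # l)"
    and x: "x \<in> nbrs E u" "x \<in> nbrs E v"
  shows "l = [x]"
proof -
  have C': "distinct (u # v # l)" "cycle_edges (u # v # l) \<subseteq> E" "length l \<ge> 1"
    using C by (auto simp: sole_cycle_def is_cycle_def)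
  obtain y m where l: "l = y # m" using C'(3) by (cases l) auto
  have uv: "{u, v} \<in> cycle_edges (u # v # l)" by (simp add: cycle_edges_Cons)
  have E: "{u, v} \<in> E" "{u, x} \<in> E" "{v, x} \<in> E" using uv C' x by (auto simp: nbrs_def)
  have ne: "x \<noteq> u" "x \<noteq> v" using simple_graph_edgeD[OF G E(2)] simple_graph_edgeD[OF G E(3)] by auto
  have sub: "f \<in> {{u, v}, {u, x}, {v, x}}" if f: "f \<in> cycle_edges (u # v # l)" for f
  proof (rule ccontr)
    assume f': "f \<notin> {{u, v}, {u, x}, {v, x}}"
    have "forest (E - {f})" using C f by (simp add: sole_cycle_def)
    moreover have "{u, v} \<in> E - {f}" using E f' by auto
    moreover have "conn (E - {f} - {{u, v}}) u x"
      using E f' ne by (intro conn_edge) (auto simp: doubleton_eq_iff)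
    moreover have "conn (E - {f} - {{u, v}}) x v"
      using E f' ne by (intro conn_sym[OF conn_edge]) (auto simp: doubleton_eq_iff)
    ultimately show False
      using forestD[of "E - {f}" u v] conn_trans[of "E - {f} - {{u, v}}" u x v] by blast
  qed
  have "{v, y} \<in> cycle_edges (u # v # l)" using l by (simp add: cycle_edges_Cons)
  then have y: "y = x" using sub[of "{v, y}"] C'(1) l ne by (auto simp: doubleton_eq_iff)
  have "{last l, u} \<in> cycle_edges (u # v # l)"
    using cycle_edges_last[of "v # l" u] l by simp
  moreover have "last l \<noteq> v" "last l \<noteq> u" using C'(1) l last_in_set[of l] by auto
  ultimately have "last l = x" using sub[of "{last l, u}"] C'(1) ne by (auto simp: doubleton_eq_iff)
  then show ?thesis using l y C'(1) last_in_set[of m] by (auto split: if_splits)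
qed

text \<open>On a triangle with third vertex \<open>x\<close>, the edges \<open>{v, x}\<close> and
  \<open>{u, x}\<close> have the same image, so \<open>G\<close> contracts to the same graph as the
  forest \<open>G\<close> without \<open>{v, x}\<close>. On a longer cycle, every edge of the
  shortened cycle is the image of a cycle edge, whose deletion leaves a forest.\<close>

lemma sole_cycle_contract:
  assumes G: "simple_graph V E" and C: "sole_cycle E (u # v # l)"
  shows "length l = 1 \<Longrightarrow> forest (contract u v E) \<and> forest (insert {u, v} (contract u v E))"
    and "length l \<ge> 2 \<Longrightarrow>
      sole_cycle (contract u v E) (u # l) \<and> sole_cycle (insert {u, v} (contract u v E)) (u # l)"
proof -
  let ?h = "\<lambda>x. if x = v then u else x"
  let ?N = "contract u v E"
  have C': "distinct (u # v # l)" "cycle_edges (u # v # l) \<subseteq> E" "length l \<ge> 1"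
    using C by (auto simp: sole_cycle_def is_cycle_def)
  obtain x m where l: "l = x # m" using C'(3) by (cases l) auto
  have ne: "u \<noteq> v" using C' by auto
  have uv: "{u, v} \<in> cycle_edges (u # v # l)" by (simp add: cycle_edges_Cons)
  have vx: "{v, x} \<in> cycle_edges (u # v # l)" by (simp add: cycle_edges_Cons l)
  have F: "forest (contract u v (E - {f}))" "forest (insert {u, v} (contract u v (E - {f})))"
    if f: "f \<in> cycle_edges (u # v # l)" "f \<noteq> {u, v}" for f
  proof -
    have "forest (E - {f})" using C f by (simp add: sole_cycle_def)
    moreover have "simple_graph V (E - {f})" by (rule simple_graph_subset[OF G]) auto
    moreover have "{u, v} \<in> E - {f}" using uv C' f by auto
    ultimately show "forest (contract u v (E - {f}))" "forest (insert {u, v} (contract u v (E - {f})))"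
      by (simp_all only: contract_forest)
  qed
  show "forest ?N \<and> forest (insert {u, v} ?N)" if "length l = 1"
  proof -
    have ux: "{u, x} \<in> E - {{v, x}} - {{u, v}}"
    proof -
      have "m = []" using that l by simp
      then have "{x, u} \<in> cycle_edges (u # v # l)" using l by (simp add: cycle_edges_Cons)
      then have "{x, u} \<in> E" using C'(2) by blast
      then have "{u, x} \<in> E" by (simp only: insert_commute)
      moreover have "u \<noteq> x" "v \<noteq> x" using C'(1) l by auto
      ultimately show ?thesis using ne by (auto simp: doubleton_eq_iff)
    qed

    have "?h ` g \<in> (`) ?h ` (E - {{v, x}} - {{u, v}})" if g: "g \<in> E - {{u, v}}" for g
    proof (cases "g = {v, x}")
      case True
      then have "?h ` g = ?h ` {u, x}" by auto
      with ux show ?thesis by (simp only: imageI)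
    next
      case False
      with g have "g \<in> E - {{v, x}} - {{u, v}}" by simp
      then show ?thesis by (rule imageI)
    qed
    then have "?N \<subseteq> contract u v (E - {{v, x}})" unfolding contract_def by blast
    moreover have "{v, x} \<noteq> {u, v}" using C' l by (auto simp: doubleton_eq_iff)
    ultimately show ?thesis
      using F[OF vx] forest_subset by (metis insert_mono)
  qed
  show "sole_cycle ?N (u # l) \<and> sole_cycle (insert {u, v} ?N) (u # l)" if len: "length l \<ge> 2"
  proof -
    have lift: "\<exists>g\<in>cycle_edges (u # v # l) - {{u, v}}. f = ?h ` g" if f: "f \<in> cycle_edges (u # l)" for f
    proof (cases "f = {u, x}")
      case True
      then have "f = ?h ` {v, x}" using C' l by auto
      moreover have "{v, x} \<noteq> {u, v}" using C' l by (auto simp: doubleton_eq_iff)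
      ultimately show ?thesis using vx by blast
    next
      case False
      then have f': "f \<in> path_edges (x # m @ [u])" using f l by (simp add: cycle_edges_Cons)
      then have "v \<notin> f" using path_edges_subset[OF f'] C' l by auto
      then have "f = ?h ` f" "f \<noteq> {u, v}" by auto
      moreover have "f \<in> cycle_edges (u # v # l)" using f' l by (simp add: cycle_edges_Cons)
      ultimately show ?thesis by blast
    qed
    have sub: "cycle_edges (u # l) \<subseteq> ?N"
      using lift C'(2) unfolding contract_def by blast
    have "forest (?N - {f})" "forest (insert {u, v} ?N - {f})" if f: "f \<in> cycle_edges (u # l)" for f
    proof -
      obtain g where g: "g \<in> cycle_edges (u # v # l)" "g \<noteq> {u, v}" "f = ?h ` g"
        using lift[OF f] by blast
      have "?N - {f} \<subseteq> contract u v (E - {g})"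
        unfolding g(3) contract_def by blast
      then have s: "?N - {f} \<subseteq> contract u v (E - {g})"
        "insert {u, v} ?N - {f} \<subseteq> insert {u, v} (contract u v (E - {g}))" by auto
      show "forest (?N - {f})" "forest (insert {u, v} ?N - {f})"
        by (rule forest_subset[OF F(1)[OF g(1,2)] s(1)], rule forest_subset[OF F(2)[OF g(1,2)] s(2)])
    qed
    then show ?thesis using sub len C'(1) by (auto simp: sole_cycle_def is_cycle_def)
  qed
qed

section \<open>Counting edge-constrained colorings\<close>

text \<open>Inequality for \<open>r\<close> gives chromatic functions and equality gives power sums,
  so that the product formula for disjoint unions is proved once for both.\<close>

definition edge_count :: "(nat \<Rightarrow> nat \<Rightarrow> bool) \<Rightarrow> 'a set \<Rightarrow> 'a set set \<Rightarrow> series" where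
  "edge_count r V E M = of_nat (card {\<kappa> \<in> V \<rightarrow>\<^sub>E UNIV.
     (\<forall>u\<in>V. \<forall>w\<in>V. {u, w} \<in> E \<longrightarrow> r (\<kappa> u) (\<kappa> w)) \<and> image_mset \<kappa> (mset_set V) = M})"

lemma chromatic_edge_count: "chromatic V E = edge_count (\<noteq>) V E"
  by (simp add: fun_eq_iff chromatic_def edge_count_def proper_colorings_def conj_assoc)

lemma finite_colorings:
  assumes "finite V"
  shows "finite {\<kappa> \<in> V \<rightarrow>\<^sub>E UNIV. Q \<kappa> \<and> image_mset \<kappa> (mset_set V) = (M :: 'b multiset)}"
proof (rule finite_subset)
  show "finite (V \<rightarrow>\<^sub>E set_mset M)" using assms by (intro finite_PiE) auto
  show "{\<kappa> \<in> V \<rightarrow>\<^sub>E UNIV. Q \<kappa> \<and> image_mset \<kappa> (mset_set V) = M} \<subseteq> V \<rightarrow>\<^sub>E set_mset M"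
    using assms by (auto simp: PiE_def)
qed

lemma edge_count_iso:
  assumes f: "bij_betw f V V'" and E: "\<And>u w. u \<in> V \<Longrightarrow> w \<in> V \<Longrightarrow> {u, w} \<in> E \<longleftrightarrow> {f u, f w} \<in> E'"
  shows "edge_count r V E = edge_count r V' E'"
proof
  fix M
  let ?A = "{\<kappa> \<in> V \<rightarrow>\<^sub>E UNIV. (\<forall>u\<in>V. \<forall>w\<in>V. {u, w} \<in> E \<longrightarrow> r (\<kappa> u) (\<kappa> w)) \<and> image_mset \<kappa> (mset_set V) = M}"
  let ?B = "{\<kappa> \<in> V' \<rightarrow>\<^sub>E UNIV. (\<forall>u\<in>V'. \<forall>w\<in>V'. {u, w} \<in> E' \<longrightarrow> r (\<kappa> u) (\<kappa> w)) \<and> image_mset \<kappa> (mset_set V') = M}"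
  have V': "V' = f ` V" and inj: "inj_on f V" using f by (auto simp: bij_betw_def)
  have "bij_betw (\<lambda>\<kappa>. restrict (\<kappa> \<circ> f) V) ?B ?A"
  proof (rule bij_betwI[where g = "\<lambda>\<kappa>. restrict (\<kappa> \<circ> the_inv_into V f) V'"])
    have inv: "the_inv_into V f (f x) = x" if "x \<in> V" for x
      using inj that by (rule the_inv_into_f_f)
    have m1: "image_mset (restrict (\<kappa> \<circ> f) V) (mset_set V) = image_mset \<kappa> (mset_set V')" for \<kappa> :: "'b \<Rightarrow> nat"
    proof -
      have "image_mset (restrict (\<kappa> \<circ> f) V) (mset_set V) = image_mset (\<kappa> \<circ> f) (mset_set V)"
        by (cases "finite V") (auto intro!: image_mset_cong)
      then show ?thesis using image_mset_mset_set[OF inj] V' by (simp flip: multiset.map_comp)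
    qed
    show "(\<lambda>\<kappa>. restrict (\<kappa> \<circ> f) V) \<in> ?B \<rightarrow> ?A"
      using E by (auto simp: m1 V')
    have roundtrip: "restrict (restrict (\<kappa> \<circ> the_inv_into V f) V' \<circ> f) V = \<kappa>" if "\<kappa> \<in> V \<rightarrow>\<^sub>E UNIV" for \<kappa> :: "'a \<Rightarrow> nat"
    proof
      fix x
      show "restrict (restrict (\<kappa> \<circ> the_inv_into V f) V' \<circ> f) V x = \<kappa> x"
      proof (cases "x \<in> V")
        case True
        then show ?thesis using inv[OF True] V' by simp
      qed (use PiE_arb[OF that] in simp)
    qed
    show "(\<lambda>\<kappa>. restrict (\<kappa> \<circ> the_inv_into V f) V') \<in> ?A \<rightarrow> ?B"
    proof
      fix \<kappa> assume k: "\<kappa> \<in> ?A"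
      then have "image_mset (restrict (\<kappa> \<circ> the_inv_into V f) V') (mset_set V') = M"
        using m1[of "restrict (\<kappa> \<circ> the_inv_into V f) V'"] roundtrip[of \<kappa>] by auto
      then show "restrict (\<kappa> \<circ> the_inv_into V f) V' \<in> ?B"
        using k E inv by (auto simp: V')
    qed
    show "restrict (restrict (\<kappa> \<circ> the_inv_into V f) V' \<circ> f) V = \<kappa>" if "\<kappa> \<in> ?A" for \<kappa>
      using roundtrip that by auto
    show "restrict (restrict (\<kappa> \<circ> f) V \<circ> the_inv_into V f) V' = \<kappa>" if k: "\<kappa> \<in> ?B" for \<kappa>
    proof
      fix y
      have k': "\<kappa> \<in> V' \<rightarrow>\<^sub>E UNIV" using k by simp
      show "restrict (restrict (\<kappa> \<circ> f) V \<circ> the_inv_into V f) V' y = \<kappa> y"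
      proof (cases "y \<in> V'")
        case True
        then obtain x where "x \<in> V" "y = f x" using V' by blast
        then show ?thesis using inv[of x] V' by simp
      qed (use PiE_arb[OF k'] in simp)
    qed
  qed
  then show "edge_count r V E M = edge_count r V' E' M"
    by (simp add: edge_count_def bij_betw_same_card)
qed

lemma finite_submultisets: "finite {A. A \<subseteq># (M :: 'b multiset)}"
proof (induction M)
  case (add x M)
  have "{A. A \<subseteq># add_mset x M} \<subseteq> {A. A \<subseteq># M} \<union> add_mset x ` {A. A \<subseteq># M}"
  proof
    fix A assume "A \<in> {A. A \<subseteq># add_mset x M}"
    then have A: "A \<subseteq># add_mset x M" by simp
    show "A \<in> {A. A \<subseteq># M} \<union> add_mset x ` {A. A \<subseteq># M}"
    proof (cases "x \<in># A")
      case True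
      then obtain B where "A = add_mset x B" by (metis mset_add)
      then show ?thesis using A by auto
    next
      case False
      then have "A \<subseteq># M" using A by (metis diff_single_trivial subset_eq_diff_conv add_mset_add_single)
      then show ?thesis by simp
    qed
  qed
  then show ?case using add by (meson finite_UnI finite_imageI finite_subset)
qed simp

text \<open>A coloring of the union is a pair of independent colorings; grouping by the multiset
  \<open>K\<close> of colors used on \<open>A\<close> gives the convolution in
  \<open>ser_mult\<close>.\<close>

lemma edge_count_disjoint_union:
  assumes fin: "finite A" "finite B" and disj: "A \<inter> B = {}"
    and sep: "\<And>u w. {u, w} \<in> E \<Longrightarrow> u \<in> A \<Longrightarrow> w \<in> B \<Longrightarrow> False"
  shows "edge_count r (A \<union> B) E = ser_mult (edge_count r A E) (edge_count r B E)"
proof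
  fix M
  define S where "S V K = {\<kappa> \<in> V \<rightarrow>\<^sub>E UNIV.
    (\<forall>u\<in>V. \<forall>w\<in>V. {u, w} \<in> E \<longrightarrow> r (\<kappa> u) (\<kappa> w)) \<and> image_mset \<kappa> (mset_set V) = K}" for V and K :: "nat multiset"
  have finS: "finite (S V K)" if "finite V" for V K
    unfolding S_def by (rule finite_colorings[OF that])
  have AB: "image_mset \<kappa> (mset_set (A \<union> B)) = image_mset \<kappa> (mset_set A) + image_mset \<kappa> (mset_set B)" for \<kappa> :: "'a \<Rightarrow> nat"
    using mset_set_Union[OF fin disj] by simp
  have rA: "image_mset (restrict \<kappa> C) (mset_set C) = image_mset \<kappa> (mset_set C)" for \<kappa> :: "'a \<Rightarrow> nat" and C
    by (cases "finite C") (auto intro!: image_mset_cong)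
  define F where "F K = {\<kappa> \<in> S (A \<union> B) M. image_mset \<kappa> (mset_set A) = K}" for K
  have cardF: "card (F K) = card (S A K) * card (S B (M - K))" if K: "K \<subseteq># M" for K
  proof -
    have "bij_betw (\<lambda>\<kappa>. (restrict \<kappa> A, restrict \<kappa> B)) (F K) (S A K \<times> S B (M - K))"
    proof (rule bij_betwI[where g = "\<lambda>(a, b) x. if x \<in> A then a x else b x"])
      show "(\<lambda>\<kappa>. (restrict \<kappa> A, restrict \<kappa> B)) \<in> F K \<rightarrow> S A K \<times> S B (M - K)"
        by (auto simp: F_def S_def rA AB)
      show "(\<lambda>(a, b) x. if x \<in> A then a x else b x) \<in> S A K \<times> S B (M - K) \<rightarrow> F K"
      proof (clarify)
        fix a b assume a: "a \<in> S A K" and b: "b \<in> S B (M - K)"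
        let ?k = "\<lambda>x. if x \<in> A then a x else b x"
        have iA: "image_mset ?k (mset_set A) = K"
          using a fin by (auto simp: S_def intro!: image_mset_cong)
        have iB: "image_mset ?k (mset_set B) = M - K"
        proof -
          have "image_mset ?k (mset_set B) = image_mset b (mset_set B)"
            using fin disj by (intro image_mset_cong) auto
          then show ?thesis using b by (simp add: S_def)
        qed
        have "?k \<in> A \<union> B \<rightarrow>\<^sub>E UNIV" using b by (auto simp: S_def PiE_def extensional_def)
        moreover have "r (?k u) (?k w)" if uw: "u \<in> A \<union> B" "w \<in> A \<union> B" "{u, w} \<in> E" for u w
        proof -
          have "{w, u} \<in> E" using uw(3) by (simp add: insert_commute)
          then have "u \<in> A \<longleftrightarrow> w \<in> A" using sep uw disj by blast
          then show ?thesis using a b uw by (auto simp: S_def)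
        qed
        ultimately show "?k \<in> F K" using iA iB K by (simp add: F_def S_def AB)
      qed
      show "(case (restrict \<kappa> A, restrict \<kappa> B) of (a, b) \<Rightarrow> \<lambda>x. if x \<in> A then a x else b x) = \<kappa>"
        if "\<kappa> \<in> F K" for \<kappa>
        using that by (auto simp: F_def S_def fun_eq_iff PiE_def extensional_def)
      show "(restrict (case p of (a, b) \<Rightarrow> \<lambda>x. if x \<in> A then a x else b x) A,
          restrict (case p of (a, b) \<Rightarrow> \<lambda>x. if x \<in> A then a x else b x) B) = p"
        if "p \<in> S A K \<times> S B (M - K)" for p
        using that disj by (auto simp: S_def fun_eq_iff PiE_def extensional_def)
    qed
    then show ?thesis using bij_betw_same_card by (fastforce simp: card_cartesian_product)
  qed
  have "S (A \<union> B) M = (\<Union>K\<in>{K. K \<subseteq># M}. F K)"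
    by (auto simp: F_def S_def AB)
  also have "card \<dots> = (\<Sum>K\<in>{K. K \<subseteq># M}. card (F K))"
  proof (rule card_UN_disjoint)
    show "\<forall>K\<in>{K. K \<subseteq># M}. finite (F K)" using finS[of "A \<union> B" M] fin by (auto simp: F_def)
    show "\<forall>K\<in>{K. K \<subseteq># M}. \<forall>L\<in>{K. K \<subseteq># M}. K \<noteq> L \<longrightarrow> F K \<inter> F L = {}" by (auto simp: F_def)
  qed (rule finite_submultisets)
  also have "\<dots> = (\<Sum>K\<in>{K. K \<subseteq># M}. card (S A K) * card (S B (M - K)))"
    by (intro sum.cong) (auto simp: cardF)
  finally show "edge_count r (A \<union> B) E M = ser_mult (edge_count r A E) (edge_count r B E) M"
    by (simp add: edge_count_def ser_mult_def S_def)
qed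

lemma edge_count_empty: "edge_count r {} E = ser_one"
proof
  fix M
  have "{\<kappa> \<in> {} \<rightarrow>\<^sub>E UNIV. (\<forall>u\<in>{}. \<forall>w\<in>{}. {u, w} \<in> E \<longrightarrow> r (\<kappa> u) (\<kappa> w)) \<and> image_mset \<kappa> (mset_set {}) = M}
    = (if M = {#} then {\<lambda>x. undefined} else {})" by auto
  then show "edge_count r {} E M = ser_one M" by (simp add: edge_count_def ser_one_def)
qed

lemma edge_count_blocks:
  assumes "distinct Bs" and "\<And>B. B \<in> set Bs \<Longrightarrow> finite B" and "disjoint (set Bs)"
    and "\<And>u w B C. {u, w} \<in> E \<Longrightarrow> u \<in> B \<Longrightarrow> w \<in> C \<Longrightarrow> B \<in> set Bs \<Longrightarrow> C \<in> set Bs \<Longrightarrow> B = C"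
  shows "edge_count r (\<Union>(set Bs)) E = foldr (\<lambda>B. ser_mult (edge_count r B E)) Bs ser_one"
  using assms
proof (induction Bs)
  case (Cons B Bs)
  have "edge_count r (B \<union> \<Union>(set Bs)) E = ser_mult (edge_count r B E) (edge_count r (\<Union>(set Bs)) E)"
  proof (rule edge_count_disjoint_union)
    show "B \<inter> \<Union> (set Bs) = {}"
      using Cons.prems(1,3) by (auto simp: disjoint_def)
    show False if "{u, w} \<in> E" "u \<in> B" "w \<in> \<Union> (set Bs)" for u w
      using that Cons.prems(1) Cons.prems(4)[of u w B] by auto
  qed (use Cons.prems in auto)
  moreover have "edge_count r (\<Union>(set Bs)) E = foldr (\<lambda>B. ser_mult (edge_count r B E)) Bs ser_one"
    using Cons.prems by (intro Cons.IH) (auto simp: disjoint_def)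
  ultimately show ?case by simp
qed (simp add: edge_count_empty)

text \<open>The product by \<open>foldr\<close> fixes an order of the factors, so the blocks are
  listed by decreasing size, as the parts of a partition are.\<close>

lemma ordered_blocks:
  assumes "finite P"
  obtains Bs where "distinct Bs" "set Bs = P" "map card Bs = rev (sorted_list_of_multiset (block_sizes P))"
proof -
  obtain l where l: "distinct l" "set l = P" using finite_distinct_list[OF assms] by blast
  let ?l = "sort_key card l"
  have "mset_set P = mset l" using l mset_set_set by blast
  then have "map card ?l = sort (map card l)"
    by (intro properties_for_sort[symmetric]) auto
  also have "\<dots> = sorted_list_of_multiset (block_sizes P)"
    using \<open>mset_set P = mset l\<close> by (simp add: block_sizes_def flip: mset_map)
  finally show thesis using l by (intro that[of "rev ?l"]) (auto simp: rev_map[symmetric])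
qed

lemma edge_count_components:
  assumes G: "simple_graph V E" and f: "\<And>B. B \<in> components V E \<Longrightarrow> edge_count r B E = f (card B)"
  shows "edge_count r V E = foldr (\<lambda>k. ser_mult (f k))
    (rev (sorted_list_of_multiset (block_sizes (components V E)))) ser_one"
proof -
  have P: "partition_on V (components V E)" by (rule partition_on_components[OF G])
  have fin: "finite V" using simple_graph_finite[OF G] by simp
  then obtain Bs where Bs: "distinct Bs" "set Bs = components V E"
    "map card Bs = rev (sorted_list_of_multiset (block_sizes (components V E)))"
    using ordered_blocks[of "components V E"] by (auto simp: components_def)
  have "edge_count r (\<Union>(set Bs)) E = foldr (\<lambda>B. ser_mult (edge_count r B E)) Bs ser_one"
  proof (rule edge_count_blocks)
    show "disjoint (set Bs)" using partition_onD2[OF P] Bs by simp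
    show "finite B" if "B \<in> set Bs" for B
      using that Bs partition_onD1[OF P] fin by (metis Union_upper finite_subset)
    show "B = C" if uw: "{u, w} \<in> E" "u \<in> B" "w \<in> C" "B \<in> set Bs" "C \<in> set Bs" for u w B C
    proof -
      obtain x y where "B = component E x" "C = component E y" using uw Bs by (auto simp: components_def)
      moreover have "conn E u w" using uw by (intro conn_edge)
      ultimately show ?thesis using uw by (metis component_eq_iff conn_def)
    qed
  qed (rule Bs(1))
  also have "foldr (\<lambda>B. ser_mult (edge_count r B E)) Bs ser_one = foldr (\<lambda>k. ser_mult (f k)) (map card Bs) ser_one"
    using f Bs(2) unfolding foldr_map by (intro foldr_cong) auto
  finally show ?thesis using Bs partition_onD1[OF P] by simp
qed

section \<open>Star forests and the deletion-near-contraction relation\<close>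

lemma star_block:
  assumes B: "finite B" "z \<in> B"
    and E: "\<And>u w. u \<in> B \<Longrightarrow> w \<in> B \<Longrightarrow> {u, w} \<in> E \<longleftrightarrow> u \<noteq> w \<and> (u = z \<or> w = z)"
  shows "edge_count (\<noteq>) B E = star (card B)"
proof -
  have c: "card B > 0" using B by (auto simp: card_gt_0_iff)
  have "card (B - {z}) = card {1..<card B}" using B by simp
  then obtain g where g: "bij_betw g (B - {z}) {1..<card B}"
    using B by (metis finite_Diff finite_atLeastLessThan finite_same_card_bij)
  define f where "f x = (if x = z then 0 else g x)" for x
  have img: "g x \<in> {1..<card B}" if "x \<in> B" "x \<noteq> z" for x
    using g that by (auto simp: bij_betw_def)
  have "bij_betw f (insert z (B - {z})) (insert 0 {1..<card B})"
  proof (rule bij_betw_imageI)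
    have "inj_on g (B - {z})" using g by (simp add: bij_betw_def)
    then show "inj_on f (insert z (B - {z}))"
      using img by (force simp: inj_on_def f_def)
    have "f ` (B - {z}) = {1..<card B}" using g by (auto simp: f_def bij_betw_def)
    moreover have "f z = 0" by (simp add: f_def)
    ultimately show "f ` insert z (B - {z}) = insert 0 {1..<card B}" by (simp only: image_insert)
  qed
  moreover have "insert z (B - {z}) = B" "insert 0 {1..<card B} = {0..<card B}" using B c by auto
  ultimately have f: "bij_betw f B {0..<card B}" by simp
  have f0: "f x = 0 \<longleftrightarrow> x = z" if "x \<in> B" for x using img[of x] that by (auto simp: f_def)
  have fl: "f x < card B" if "x \<in> B" for x using f that by (auto simp: bij_betw_def)
  have inj: "f u = f w \<longleftrightarrow> u = w" if "u \<in> B" "w \<in> B" for u w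
    using f that by (auto simp: bij_betw_def inj_on_def)
  have "edge_count (\<noteq>) B E = edge_count (\<noteq>) {0..<card B} {{0, i} | i. 1 \<le> i \<and> i < card B}"
  proof (rule edge_count_iso[OF f])
    fix u w assume uw: "u \<in> B" "w \<in> B"
    have "{f u, f w} \<in> {{0, i} | i. 1 \<le> i \<and> i < card B} \<longleftrightarrow> f u \<noteq> f w \<and> (f u = 0 \<or> f w = 0)"
      using fl[OF uw(1)] fl[OF uw(2)] by (auto simp: doubleton_eq_iff)
    then show "{u, w} \<in> E \<longleftrightarrow> {f u, f w} \<in> {{0, i} | i. 1 \<le> i \<and> i < card B}"
      using E uw f0 inj by simp
  qed
  then show ?thesis by (simp add: star_def chromatic_edge_count)
qed

text \<open>Without internal edges every component is a star: a nonleaf with its leaves, or a single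
  edge. The star expansion then has one term, which is the base of the induction for
  forests.\<close>

lemma chromatic_star_forest:
  assumes G: "simple_graph V E" and I: "internal_edges E = {}"
  shows "chromatic V E = star_part (rev (sorted_list_of_multiset (lc_type V E)))"
proof -
  have comps: "components V E = leaf_star E ` nonleaves V E \<union> isolated_edges E"
    using components_leaf_graph[OF G] I by simp
  have "edge_count (\<noteq>) B E = star (card B)" if B: "B \<in> components V E" for B
  proof -
    have fin: "finite B"
      using B partition_onD1[OF partition_on_components[OF G]] simple_graph_finite[OF G]
      by (metis Union_upper finite_subset)
    have irr: "{a} \<notin> E" for a using simple_graph_edgeD(3)[OF G, of a a] by auto
    consider z where "z \<in> nonleaves V E" "B = leaf_star E z" | "B \<in> isolated_edges E"
      using B comps by auto
    then show ?thesis
    proof cases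
      case 1
      show ?thesis
      proof (rule star_block[OF fin])
        show "z \<in> B" using 1 by (simp add: leaf_star_def)
        fix u w assume uw: "u \<in> B" "w \<in> B"
        have leaf: "nbrs E x = {z}" if "x \<in> B" "x \<noteq> z" for x
        proof -
          have "x \<in> nbrs E z" "degree E x = 1" using that 1 by (auto simp: leaf_star_def)
          then show ?thesis using degree_one_nbrs[OF G] nbrs_sym by metis
        qed
        show "{u, w} \<in> E \<longleftrightarrow> u \<noteq> w \<and> (u = z \<or> w = z)"
        proof (cases "u = z")
          case True
          show ?thesis
          proof (cases "w = z")
            case w: False
            then have "z \<in> nbrs E w" using leaf[OF uw(2) w] by simp
            then show ?thesis using True w nbrs_sym[of w E z] by (auto simp: nbrs_def)
          qed (use True irr in simp)
        next
          case False
          then have "{u, w} \<in> E \<longleftrightarrow> w = z" using leaf[OF uw(1) False] by (simp add: nbrs_def set_eq_iff)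
          then show ?thesis using False by auto
        qed
      qed
    next
      case 2
      then have "B \<in> E" by (simp add: isolated_edges_def)
      then obtain x y where xy: "B = {x, y}" "x \<noteq> y" using simple_graph_edgeE[OF G] by metis
      show ?thesis
        using xy \<open>B \<in> E\<close> irr by (intro star_block[OF fin, of x]) (auto simp: insert_commute)
    qed
  qed
  from edge_count_components[OF G this] show ?thesis
    using I by (simp add: chromatic_edge_count star_part_def lc_type_def)
qed

text \<open>On colorings with equal colors at \<open>u\<close> and \<open>v\<close>, the deletion
  and the contraction impose the same conditions; let \<open>Z\<close> be their number. Split by
  whether these colors agree, the deletion counts \<open>Z\<close> plus the colorings of
  \<open>E\<close>, and the contraction counts \<open>Z\<close> plus those of the
  near-contraction.\<close>

lemma chromatic_near_contraction:
  assumes G: "simple_graph V E" and uv: "{u, v} \<in> E"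
  shows "chromatic V E M = chromatic V (E - {{u, v}}) M
    + chromatic V (insert {u, v} (contract u v E)) M - chromatic V (contract u v E) M"
proof -
  let ?N = "contract u v E" and ?e = "{u, v}"
  have ne: "u \<noteq> v" "u \<in> V" "v \<in> V" using simple_graph_edgeD[OF G uv] by auto
  have fin: "finite V" using simple_graph_finite[OF G] by simp
  define S where "S F = {\<kappa> \<in> proper_colorings V F. image_mset \<kappa> (mset_set V) = M}" for F
  have finS: "finite (S F)" for F
    unfolding S_def proper_colorings_def using finite_colorings[OF fin]
    by (simp add: conj_assoc)
  have ch: "chromatic V F M = of_nat (card (S F))" for F by (simp add: chromatic_def S_def)
  have ins: "S (insert ?e F) = {\<kappa> \<in> S F. \<kappa> u \<noteq> \<kappa> v}" for F
    using ne by (auto simp: S_def proper_colorings_def doubleton_eq_iff)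
  have split: "card (S F) = card (S (insert ?e F)) + card {\<kappa> \<in> S F. \<kappa> u = \<kappa> v}" for F
  proof -
    have "S F = S (insert ?e F) \<union> {\<kappa> \<in> S F. \<kappa> u = \<kappa> v}" unfolding ins by auto
    moreover have "S (insert ?e F) \<inter> {\<kappa> \<in> S F. \<kappa> u = \<kappa> v} = {}" unfolding ins by auto
    ultimately show ?thesis using finS card_Un_disjoint
      by (metis (no_types, lifting) finite_Un)
  qed
  have proper: "(\<forall>x\<in>V. \<forall>y\<in>V. {x, y} \<in> E - {?e} \<longrightarrow> \<kappa> x \<noteq> \<kappa> y) \<longleftrightarrow>
      (\<forall>x\<in>V. \<forall>y\<in>V. {x, y} \<in> ?N \<longrightarrow> \<kappa> x \<noteq> \<kappa> y)" if k: "\<kappa> u = \<kappa> v" for \<kappa> :: "'a \<Rightarrow> nat"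
  proof (intro iffI ballI impI)
    fix x y assume H: "\<forall>x\<in>V. \<forall>y\<in>V. {x, y} \<in> E - {?e} \<longrightarrow> \<kappa> x \<noteq> \<kappa> y"
      and xy: "x \<in> V" "y \<in> V" "{x, y} \<in> ?N"
    then have "x \<noteq> v" "y \<noteq> v" "x \<noteq> y" "{x, y} \<in> E \<or> x = u \<and> {v, y} \<in> E \<or> y = u \<and> {x, v} \<in> E"
      by (auto simp: contract_edge_iff[OF G ne(1)])
    moreover have "{x, y} \<noteq> ?e" "x = u \<Longrightarrow> {v, y} \<noteq> ?e" "y = u \<Longrightarrow> {x, v} \<noteq> ?e"
      using calculation ne by (auto simp: doubleton_eq_iff)
    ultimately show "\<kappa> x \<noteq> \<kappa> y" using H xy k ne by (metis Diff_iff empty_iff insert_iff)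
  next
    fix x y assume H: "\<forall>x\<in>V. \<forall>y\<in>V. {x, y} \<in> ?N \<longrightarrow> \<kappa> x \<noteq> \<kappa> y"
      and xy: "x \<in> V" "y \<in> V" "{x, y} \<in> E - {?e}"
    have "x \<noteq> y" using simple_graph_edgeD[OF G, of x y] xy by blast
    consider "x = v" | "y = v" | "x \<noteq> v" "y \<noteq> v" by blast
    then show "\<kappa> x \<noteq> \<kappa> y"
    proof cases
      case 1
      then have "{u, y} \<in> ?N" using xy \<open>x \<noteq> y\<close> ne
        by (auto simp: contract_edge_iff[OF G ne(1)] insert_commute)
      then show ?thesis using H ne xy k 1 by metis
    next
      case 2
      then have "{x, u} \<in> ?N" using xy \<open>x \<noteq> y\<close> ne
        by (auto simp: contract_edge_iff[OF G ne(1)] insert_commute)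
      then show ?thesis using H ne xy k 2 by metis
    next
      case 3
      then have "{x, y} \<in> ?N" using xy \<open>x \<noteq> y\<close> by (auto simp: contract_edge_iff[OF G ne(1)])
      then show ?thesis using H xy by blast
    qed
  qed
  have "{\<kappa> \<in> S (E - {?e}). \<kappa> u = \<kappa> v} = {\<kappa> \<in> S ?N. \<kappa> u = \<kappa> v}"
    using proper unfolding S_def proper_colorings_def by blast
  moreover have "insert ?e (E - {?e}) = E" using uv by auto
  ultimately show ?thesis using split[of "E - {?e}"] split[of ?N] by (simp add: ch)
qed

section \<open>Linear independence of the star functions\<close>

definition mono_edge :: "('a \<Rightarrow> nat) \<Rightarrow> 'a set \<Rightarrow> bool" where
  "mono_edge \<kappa> e \<longleftrightarrow> (\<exists>c. \<forall>x\<in>e. \<kappa> x = c)"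

lemma mono_edge_pair: "mono_edge \<kappa> {x, y} \<longleftrightarrow> \<kappa> x = \<kappa> y"
  by (auto simp: mono_edge_def)

text \<open>Stanley's expansion over edge sets: being proper is the product over all edges of 1
  minus the indicator of a monochromatic edge, and this product is multiplied out.\<close>

lemma chromatic_inclusion_exclusion:
  assumes G: "simple_graph V E"
  shows "chromatic V E M = (\<Sum>S\<in>Pow E. (-1) ^ card S * edge_count (=) V S M)"
proof -
  define C where "C = {\<kappa> \<in> V \<rightarrow>\<^sub>E UNIV. image_mset \<kappa> (mset_set V) = M}"
  have fin: "finite V" "finite E" using simple_graph_finite[OF G] by auto
  have finC: "finite C" using finite_colorings[OF fin(1), of "\<lambda>_. True" M] by (simp add: C_def)
  have all: "(\<forall>u\<in>V. \<forall>w\<in>V. {u, w} \<in> S \<longrightarrow> R (mono_edge \<kappa> {u, w})) \<longleftrightarrow> (\<forall>e\<in>S. R (mono_edge \<kappa> e))"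
    if S: "S \<subseteq> E" for S R and \<kappa> :: "'a \<Rightarrow> nat"
  proof
    assume H: "\<forall>u\<in>V. \<forall>w\<in>V. {u, w} \<in> S \<longrightarrow> R (mono_edge \<kappa> {u, w})"
    show "\<forall>e\<in>S. R (mono_edge \<kappa> e)"
    proof
      fix e assume e: "e \<in> S"
      then have "e \<in> E" using S by blast
      then obtain x y where "e = {x, y}" "x \<in> V" "y \<in> V" using simple_graph_edgeE[OF G] by metis
      then show "R (mono_edge \<kappa> e)" using H e by blast
    qed
  qed blast
  have count: "of_nat (card {\<kappa> \<in> C. \<forall>e\<in>S. Q \<kappa> e}) = (\<Sum>\<kappa>\<in>C. \<Prod>e\<in>S. if Q \<kappa> e then 1 else 0 :: rat)"
    if "finite S" for S and Q :: "('a \<Rightarrow> nat) \<Rightarrow> 'a set \<Rightarrow> bool"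
  proof -
    have "(\<Prod>e\<in>S. if Q \<kappa> e then 1 else 0 :: rat) = (if \<forall>e\<in>S. Q \<kappa> e then 1 else 0)" for \<kappa>
      using that by (induction S) auto
    then show ?thesis using finC by (simp add: sum.If_cases Int_def)
  qed
  have eqs: "edge_count (=) V S M = (\<Sum>\<kappa>\<in>C. \<Prod>e\<in>S. if mono_edge \<kappa> e then 1 else 0)" if S: "S \<subseteq> E" for S
  proof -
    have "finite S" using S fin finite_subset by blast
    moreover have "edge_count (=) V S M = of_nat (card {\<kappa> \<in> C. \<forall>e\<in>S. mono_edge \<kappa> e})"
      using all[OF S, of "\<lambda>b. b"] by (simp add: edge_count_def C_def mono_edge_pair conj_ac)
    ultimately show ?thesis using count by simp
  qed
  have "chromatic V E M = of_nat (card {\<kappa> \<in> C. \<forall>e\<in>E. \<not> mono_edge \<kappa> e})"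
    using all[of E Not] by (simp add: chromatic_edge_count edge_count_def C_def mono_edge_pair conj_ac)
  also have "\<dots> = (\<Sum>\<kappa>\<in>C. \<Prod>e\<in>E. if \<not> mono_edge \<kappa> e then 1 else 0)"
    by (rule count[OF fin(2)])
  also have "\<dots> = (\<Sum>\<kappa>\<in>C. \<Prod>e\<in>E. 1 - (if mono_edge \<kappa> e then 1 else 0))"
    by (intro sum.cong prod.cong) auto
  also have "\<dots> = (\<Sum>\<kappa>\<in>C. \<Sum>S\<in>Pow E. (-1) ^ card S * (\<Prod>e\<in>S. if mono_edge \<kappa> e then 1 else 0))"
    by (subst prod_diff_conv_sum[OF fin(2)]) simp
  also have "\<dots> = (\<Sum>S\<in>Pow E. (-1) ^ card S * edge_count (=) V S M)"
    by (subst sum.swap) (simp add: eqs sum_distrib_left)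
  finally show ?thesis .
qed

section \<open>Partitions as multisets, and power sums\<close>

definition parts :: "nat multiset \<Rightarrow> nat list" where
  "parts A = rev (sorted_list_of_multiset A)"

definition mparts :: "nat \<Rightarrow> nat multiset set" where
  "mparts n = {A. 0 \<notin># A \<and> \<Sum>\<^sub># A = n}"

text \<open>The edge set \<open>UNIV\<close> forces all \<open>k\<close> vertices to receive the same color.\<close>

definition power_sum :: "nat \<Rightarrow> series" where
  "power_sum k = edge_count (=) {0..<k} UNIV"

definition power_part :: "nat multiset \<Rightarrow> series" where
  "power_part A = foldr (\<lambda>k. ser_mult (power_sum k)) (parts A) ser_one"

text \<open>Equality of colors propagates along walks, so every component is monochromatic and
  contributes one power sum.\<close>

lemma edge_count_eq_power_part:
  assumes G: "simple_graph V S"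
  shows "edge_count (=) V S = power_part (block_sizes (components V S))"
  unfolding power_part_def parts_def
proof (rule edge_count_components[OF G])
  fix B assume B: "B \<in> components V S"
  have fin: "finite B"
    using B partition_onD1[OF partition_on_components[OF G]] simple_graph_finite[OF G]
    by (metis Union_upper finite_subset)
  obtain x where x: "B = component S x" using B by (auto simp: components_def)
  have "(\<forall>u\<in>B. \<forall>w\<in>B. {u, w} \<in> S \<longrightarrow> \<kappa> u = \<kappa> w) \<longleftrightarrow> (\<forall>u\<in>B. \<forall>w\<in>B. \<kappa> u = \<kappa> w)" for \<kappa> :: "'a \<Rightarrow> nat"
  proof
    assume H: "\<forall>u\<in>B. \<forall>w\<in>B. {u, w} \<in> S \<longrightarrow> \<kappa> u = \<kappa> w"
    have "\<kappa> u = \<kappa> x" if "u \<in> B" for u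
    proof -
      have "conn S x u" using that x by (simp add: conn_def)
      then show ?thesis
      proof (induction rule: conn_induct)
        case (step y z)
        then have "y \<in> B" "z \<in> B" using x conn_trans conn_edge by (metis conn_def)+
        then show ?case using H step by metis
      qed simp
    qed
    then show "\<forall>u\<in>B. \<forall>w\<in>B. \<kappa> u = \<kappa> w" by simp
  qed blast
  then have "edge_count (=) B S = edge_count (=) B UNIV"
    by (simp add: edge_count_def fun_eq_iff)
  also obtain f where "bij_betw f B {0..<card B}"
    using fin ex_bij_betw_finite_nat by blast
  then have "edge_count (=) B UNIV = power_sum (card B)"
    unfolding power_sum_def by (rule edge_count_iso) simp
  finally show "edge_count (=) B S = power_sum (card B)" .
qed

lemma leaf_endpoint_forest:
  assumes G: "simple_graph V E" and I: "internal_edges E = {}"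
  shows "forest E"
  unfolding forest_def
proof (intro allI impI notI)
  have key: False if xy: "{x, y} \<in> E" "degree E x = 1" "conn (E - {{x, y}}) x y" for x y
  proof -
    have "y \<in> nbrs E x" using xy by (simp add: nbrs_def)
    then have "nbrs E x = {y}" using xy degree_one_nbrs[OF G] by blast
    have "y \<in> {x}"
    proof (rule conn_closed[OF xy(3)])
      fix p q assume pq: "{p, q} \<in> E - {{x, y}}" "p \<in> {x}"
      then have "q \<in> nbrs E x" "q \<noteq> y" by (auto simp: nbrs_def)
      then show "q \<in> {x}" using \<open>nbrs E x = {y}\<close> by simp
    qed simp
    then show False using simple_graph_edgeD[OF G xy(1)] by simp
  qed
  fix x y assume xy: "{x, y} \<in> E" "conn (E - {{x, y}}) x y"
  then have "{x, y} \<notin> internal_edges E" using I by blast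
  then have "degree E x = 1 \<or> degree E y = 1"
    using degree_pos[OF G xy(1)] xy(1) by (auto simp: internal_edge_iff)
  then show False
    using key[of x y] key[of y x] xy conn_sym[OF xy(2)] by (auto simp: insert_commute)
qed

text \<open>Star \<open>i\<close> lives on \<open>{i} \<times> {0..<l ! i}\<close> with center
  \<open>(i, 0)\<close>. Realizing a partition by a graph makes products of stars and of power sums
  accessible through \<open>edge_count\<close>.\<close>

lemma star_forest_exists:
  assumes A: "0 \<notin># A"
  obtains V :: "(nat \<times> nat) set" and E where "simple_graph V E" "internal_edges E = {}"
    "block_sizes (components V E) = A"
proof -
  obtain l where l: "mset l = A" using ex_mset by blast
  have pos: "l ! i > 0" if "i < length l" for i
    using A l that nth_mem_mset by (metis gr0I)
  define B where "B i = {i} \<times> {0..<l ! i}" for i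
  define V where "V = (\<Union>i<length l. B i)"
  define E where "E = {{(i, 0), (i, j)} | i j. i < length l \<and> 1 \<le> j \<and> j < l ! i}"
  have G: "simple_graph V E"
    unfolding simple_graph_def
  proof (intro conjI ballI)
    show "finite V" by (auto simp: V_def B_def)
    fix e assume "e \<in> E"
    then obtain i j where e: "e = {(i, 0), (i, j)}" "i < length l" "1 \<le> j" "j < l ! i"
      by (auto simp: E_def)
    then show "card e = 2" by simp
    show "e \<subseteq> V" using e pos[of i] by (auto simp: V_def B_def)
  qed
  have edge: "{(i, j), (i', j')} \<in> E \<longleftrightarrow> i' = i \<and> i < length l \<and> j < l ! i \<and> j' < l ! i \<and> (j = 0 \<and> j' \<noteq> 0 \<or> j' = 0 \<and> j \<noteq> 0)"
    for i j i' j'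
    by (auto simp: E_def doubleton_eq_iff)
  have leaf: "degree E (i, j) = 1" if ij: "i < length l" "1 \<le> j" "j < l ! i" for i j
  proof -
    have "nbrs E (i, j) = {(i, 0)}" using ij by (auto simp: nbrs_def edge)
    then show ?thesis by (simp add: degree_eq_card_nbrs[OF G])
  qed
  have I: "internal_edges E = {}"
  proof -
    have "e \<notin> internal_edges E" for e
    proof
      assume e: "e \<in> internal_edges E"
      then obtain i j where ij: "e = {(i, 0), (i, j)}" "i < length l" "1 \<le> j" "j < l ! i"
        by (auto simp: E_def internal_edges_def)
      then have "degree E (i, j) \<ge> 2" using e by (auto simp: internal_edges_def)
      then show False using leaf ij by simp
    qed
    then show ?thesis by blast
  qed
  have comp: "component E (i, j) = B i" if ij: "i < length l" "j < l ! i" for i j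
  proof (intro equalityI subsetI)
    fix p assume "p \<in> component E (i, j)"
    then have "conn E (i, j) p" by (simp add: conn_def)
    then show "p \<in> B i"
    proof (rule conn_closed)
      show "(i, j) \<in> B i" using ij by (simp add: B_def)
      show "q \<in> B i" if "{p, q} \<in> E" "p \<in> B i" for p q
        using that by (cases p; cases q) (auto simp: edge B_def)
    qed
  next
    have center: "conn E (i, 0) (i, k)" if "k < l ! i" for k
    proof (cases "k = 0")
      case False
      then show ?thesis using that ij by (intro conn_edge) (auto simp: edge)
    qed simp
    fix p assume "p \<in> B i"
    then obtain k where "p = (i, k)" "k < l ! i" by (auto simp: B_def)
    then show "p \<in> component E (i, j)"
      using conn_trans[OF conn_sym[OF center[OF ij(2)]] center[of k]] by (simp add: conn_def)
  qed
  have "components V E = B ` {..<length l}"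
  proof -
    have "component E p \<in> B ` {..<length l}" if "p \<in> V" for p
      using that comp by (auto simp: V_def B_def)
    moreover have "B i \<in> components V E" if "i < length l" for i
      using that comp[of i 0] pos[of i] by (auto simp: components_def V_def B_def intro!: image_eqI[of _ _ "(i, 0)"])
    ultimately show ?thesis by (auto simp: components_def)
  qed
  moreover have "inj_on B {..<length l}"
  proof (rule inj_onI)
    fix i k assume ik: "i \<in> {..<length l}" "k \<in> {..<length l}" "B i = B k"
    have "(i, 0) \<in> B i" using pos[of i] ik(1) by (simp add: B_def)
    then have "(i, 0) \<in> B k" unfolding ik(3) .
    then show "i = k" by (simp add: B_def)
  qed
  ultimately have "block_sizes (components V E) = image_mset (\<lambda>i. card (B i)) (mset_set {..<length l})"
    by (simp add: block_sizes_def image_mset_mset_set[symmetric] multiset.map_comp o_def)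
  also have "\<dots> = mset (map ((!) l) [0..<length l])"
    by (simp add: B_def lessThan_atLeast0)
  also have "\<dots> = A" using l by (simp add: map_nth)
  finally show thesis using that G I by blast
qed

text \<open>A missing edge of a forest separates its ends. Hence only the full edge set has the
  components of the forest, and the diagonal coefficient of the power sum expansion cannot
  cancel.\<close>

lemma forest_components_strict:
  assumes G: "simple_graph V E" and E: "forest E" and S: "S \<subset> E"
  shows "components V S \<noteq> components V E"
proof
  assume eq: "components V S = components V E"
  obtain e where e: "e \<in> E" "e \<notin> S" using S by blast
  then obtain x y where xy: "e = {x, y}" "x \<in> V" using simple_graph_edgeE[OF G] by metis
  have "component S x \<in> components V E" using eq xy by (auto simp: components_def)
  then obtain z where z: "component S x = component E z" by (auto simp: components_def)
  have "conn E z x" using z self_in_component[of x S] by (simp add: conn_def)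
  moreover have "conn E x y" using e xy by (intro conn_edge) simp
  ultimately have "conn S x y" using z by (metis conn_def conn_trans)
  then have "conn (E - {{x, y}}) x y" by (rule conn_mono[rotated]) (use S e xy in blast)
  then show False using forestD[OF E] e xy by blast
qed

lemma mparts_block_sizes:
  assumes "simple_graph V E"
  shows "block_sizes (components V E) \<in> mparts (card V)"
  using sum_block_sizes[OF _ partition_on_components[OF assms]] block_sizes_pos[OF _ partition_on_components[OF assms]]
    simple_graph_finite[OF assms] by (simp add: mparts_def)

lemma parts_in_partitions: "A \<in> mparts n \<Longrightarrow> parts A \<in> partitions n"
  by (auto simp: parts_def mparts_def partitions_def sorted_wrt_rev sum_mset_sum_list[symmetric] simp flip: sum_list_rev)

lemma mset_parts [simp]: "mset (parts A) = A"
  by (simp add: parts_def)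

lemma parts_mset: "la \<in> partitions n \<Longrightarrow> parts (mset la) = la"
proof -
  assume "la \<in> partitions n"
  then have "sorted (rev la)" by (simp add: partitions_def sorted_wrt_rev)
  then have "sorted_list_of_multiset (mset la) = rev la"
    by (metis mset_rev sorted_list_of_multiset_mset sorted_sort_id)
  then show ?thesis by (simp add: parts_def)
qed

lemma mset_in_mparts: "la \<in> partitions n \<Longrightarrow> mset la \<in> mparts n"
  by (auto simp: partitions_def mparts_def sum_mset_sum_list)

lemma bij_parts: "bij_betw parts (mparts n) (partitions n)"
  by (rule bij_betwI[where g = mset]) (auto simp: parts_in_partitions parts_mset mset_in_mparts)

lemma finite_partitions: "finite (partitions n)"
proof (rule finite_subset)
  show "partitions n \<subseteq> {xs. set xs \<subseteq> {..n} \<and> length xs \<le> n}"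
  proof
    fix xs assume xs: "xs \<in> partitions n"
    have "length xs \<le> sum_list xs" if "0 \<notin> set xs" for xs :: "nat list"
      using that by (induction xs) auto
    then show "xs \<in> {xs. set xs \<subseteq> {..n} \<and> length xs \<le> n}"
      using xs member_le_sum_list by (auto simp: partitions_def)
  qed
qed (rule finite_lists_length_le, simp)

lemma finite_mparts: "finite (mparts n)"
  using bij_betw_finite[OF bij_parts] finite_partitions by blast

text \<open>Expand a star forest of type \<open>A\<close> over its edge subsets: their components
  refine the stars, and type \<open>A\<close> occurs only for the full edge set, so
  \<open>a A\<close> is a single sign.\<close>

lemma star_part_power_expansion:
  assumes A: "A \<in> mparts n"
  obtains a where "\<And>M. star_part (parts A) M = (\<Sum>B\<in>mparts n. a B * power_part B M)"
    and "\<And>B. a B \<noteq> 0 \<Longrightarrow> B \<le> A" and "a A \<noteq> 0"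
proof -
  obtain V :: "(nat \<times> nat) set" and E where G: "simple_graph V E" and I: "internal_edges E = {}"
    and T: "block_sizes (components V E) = A"
    by (rule star_forest_exists[of A]) (use A in \<open>auto simp: mparts_def\<close>)
  have n: "card V = n" using mparts_block_sizes[OF G] T A by (simp add: mparts_def)
  have finE: "finite E" using simple_graph_finite[OF G] by simp
  define t where "t S = block_sizes (components V S)" for S
  define a where "a B = (\<Sum>S\<in>{S \<in> Pow E. t S = B}. (-1) ^ card S :: rat)" for B
  have GS: "simple_graph V S" if "S \<in> Pow E" for S
    using that simple_graph_subset[OF G] by blast
  have t_in: "t ` Pow E \<subseteq> mparts n" using mparts_block_sizes[OF GS] n by (auto simp: t_def)
  show thesis
  proof (rule that[of a])
    fix M
    have "star_part (parts A) M = chromatic V E M"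
      using chromatic_star_forest[OF G I] T I by (simp add: lc_type_def parts_def)
    also have "\<dots> = (\<Sum>S\<in>Pow E. (-1) ^ card S * power_part (t S) M)"
      by (simp add: chromatic_inclusion_exclusion[OF G] edge_count_eq_power_part[OF GS] t_def)
    also have "\<dots> = (\<Sum>B\<in>mparts n. \<Sum>S\<in>{S \<in> Pow E. t S = B}. (-1) ^ card S * power_part (t S) M)"
      using finE by (intro sum.group[symmetric] finite_mparts t_in) simp
    also have "\<dots> = (\<Sum>B\<in>mparts n. a B * power_part B M)"
      by (intro sum.cong) (auto simp: a_def sum_distrib_right)
    finally show "star_part (parts A) M = (\<Sum>B\<in>mparts n. a B * power_part B M)" .
  next
    fix B assume "a B \<noteq> 0"
    then have "{S \<in> Pow E. t S = B} \<noteq> {}" unfolding a_def by (metis sum.empty)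
    then obtain S where "S \<subseteq> E" "t S = B" by blast
    then show "B \<le> A" using components_refine_le[OF G] T by (auto simp: t_def)
  next
    have "S = E" if "S \<subseteq> E" "t S = A" for S
    proof (rule ccontr)
      assume "S \<noteq> E"
      then have "components V S \<noteq> components V E"
        using forest_components_strict[OF G leaf_endpoint_forest[OF G I]] that by blast
      then show False using components_refine[OF G that(1)] that T by (simp add: t_def)
    qed
    then have "{S \<in> Pow E. t S = A} = {E}" using T by (auto simp: t_def)
    then show "a A \<noteq> 0" by (simp add: a_def)
  qed
qed

text \<open>The exponents of the monomial \<open>M\<close>, read as a partition.\<close>

definition exponents :: "'b multiset \<Rightarrow> nat multiset" where
  "exponents M = image_mset (count M) (mset_set (set_mset M))"

lemma exponents_image:
  assumes "finite V"
  shows "exponents (image_mset \<kappa> (mset_set V)) = block_sizes ((\<lambda>i. {x \<in> V. \<kappa> x = i}) ` \<kappa> ` V)"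
proof -
  have "inj_on (\<lambda>i. {x \<in> V. \<kappa> x = i}) (\<kappa> ` V)" by (auto simp: inj_on_def)
  moreover have "count (image_mset \<kappa> (mset_set V)) = (\<lambda>i. card {x \<in> V. \<kappa> x = i})"
  proof
    fix i
    have "{x \<in> V. i = \<kappa> x} = {x \<in> V. \<kappa> x = i}" by auto
    then show "count (image_mset \<kappa> (mset_set V)) i = card {x \<in> V. \<kappa> x = i}"
      using assms by (simp add: count_image_mset')
  qed
  ultimately show ?thesis
    using assms
    by (simp add: exponents_def block_sizes_def image_mset_mset_set[symmetric] multiset.map_comp o_def)
qed

lemma partition_on_fibers: "partition_on V ((\<lambda>i. {x \<in> V. \<kappa> x = i}) ` \<kappa> ` V)"
  by (rule partition_onI) (auto simp: disjnt_def)

text \<open>The color classes of a coloring that is constant on components are unions of components,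
  so its exponents arise by merging parts of \<open>A\<close>. Giving each component a color of its
  own attains \<open>A\<close>.\<close>

lemma power_part_triangular:
  assumes A: "A \<in> mparts n"
  shows "power_part A M \<noteq> 0 \<Longrightarrow> A \<le> exponents M"
    and "\<exists>M. exponents M = A \<and> power_part A M \<noteq> 0"
proof -
  obtain V :: "(nat \<times> nat) set" and E where G: "simple_graph V E" and T: "block_sizes (components V E) = A"
    by (rule star_forest_exists[of A]) (use A in \<open>auto simp: mparts_def\<close>)
  have fin: "finite V" using simple_graph_finite[OF G] by simp
  have P: "power_part A = edge_count (=) V E" using edge_count_eq_power_part[OF G] T by simp
  {
    assume "power_part A M \<noteq> 0"
    then have "{\<kappa> \<in> V \<rightarrow>\<^sub>E UNIV. (\<forall>u\<in>V. \<forall>w\<in>V. {u, w} \<in> E \<longrightarrow> \<kappa> u = \<kappa> w) \<and>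
        image_mset \<kappa> (mset_set V) = M} \<noteq> {}"
      unfolding P edge_count_def by (metis card.empty of_nat_0)
    then obtain \<kappa> where k: "\<forall>u\<in>V. \<forall>w\<in>V. {u, w} \<in> E \<longrightarrow> \<kappa> u = \<kappa> w" "image_mset \<kappa> (mset_set V) = M"
      by blast
    let ?Q = "(\<lambda>i. {x \<in> V. \<kappa> x = i}) ` \<kappa> ` V"
    have "\<exists>C\<in>?Q. B \<subseteq> C" if B: "B \<in> components V E" for B
    proof -
      obtain x where x: "x \<in> V" "B = component E x" using B unfolding components_def by blast
      have "y \<in> {y \<in> V. \<kappa> y = \<kappa> x}" if "y \<in> B" for y
      proof -
        have "conn E x y" using that x by (simp add: conn_def)
        then show ?thesis
        proof (rule conn_closed)
          show "q \<in> {y \<in> V. \<kappa> y = \<kappa> x}" if pq: "{p, q} \<in> E" "p \<in> {y \<in> V. \<kappa> y = \<kappa> x}" for p q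
            using k(1) pq simple_graph_edgeD(2)[OF G pq(1)] by force
        qed (use x in simp)
      qed
      then show ?thesis using x by blast
    qed
    then have "block_sizes (components V E) \<le> block_sizes ?Q"
      using block_sizes_refine[OF fin partition_on_components[OF G] partition_on_fibers[of V \<kappa>]]
      by (cases "components V E = ?Q") auto
    then show "A \<le> exponents M" using T k(2) exponents_image[OF fin, of \<kappa>] by simp
  }
  have "finite (components V E)" using fin by (simp add: components_def)
  then obtain g :: "(nat \<times> nat) set \<Rightarrow> nat" where g: "inj_on g (components V E)"
    using finite_imp_inj_to_nat_seg by blast
  define \<kappa> where "\<kappa> = restrict (\<lambda>x. g (component E x)) V"
  have k: "\<kappa> x = \<kappa> y \<longleftrightarrow> conn E x y" if "x \<in> V" "y \<in> V" for x y
    using that g component_eq_iff[of E x y] by (auto simp: \<kappa>_def components_def inj_on_def)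
  let ?M = "image_mset \<kappa> (mset_set V)"
  have fiber: "{y \<in> V. \<kappa> y = \<kappa> x} = component E x" if "x \<in> V" for x
    using that k[OF that] component_subset[OF G that] unfolding conn_def by fastforce
  then have "(\<lambda>i. {y \<in> V. \<kappa> y = i}) ` \<kappa> ` V = components V E"
    unfolding components_def image_image by (rule image_cong[OF refl])
  then have "exponents ?M = A" using exponents_image[OF fin, of \<kappa>] T by simp
  moreover have "power_part A ?M \<noteq> 0"
  proof -
    have "\<kappa> \<in> {\<kappa> \<in> V \<rightarrow>\<^sub>E UNIV. (\<forall>u\<in>V. \<forall>w\<in>V. {u, w} \<in> E \<longrightarrow> \<kappa> u = \<kappa> w) \<and> image_mset \<kappa> (mset_set V) = ?M}"
      using k conn_edge[of _ _ E] by (simp add: \<kappa>_def)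
    then show ?thesis
      unfolding P edge_count_def of_nat_eq_0_iff card_0_eq[OF finite_colorings[OF fin]] by blast
  qed
  ultimately show "\<exists>M. exponents M = A \<and> power_part A M \<noteq> 0" by blast
qed

text \<open>At a minimal index \<open>y\<close> with nonzero coefficient, triangularity kills all
  other terms of the equation for \<open>y\<close>. The dual \<open>triangular_zero_down\<close>
  takes a maximal index; one direction serves power sums against monomials, the other stars against
  power sums.\<close>

lemma triangular_zero_up:
  fixes b :: "'b::order \<Rightarrow> 'c::field"
  assumes "finite P" and "\<And>y. y \<in> P \<Longrightarrow> (\<Sum>x\<in>P. b x * f x y) = 0"
    and "\<And>x y. x \<in> P \<Longrightarrow> y \<in> P \<Longrightarrow> f x y \<noteq> 0 \<Longrightarrow> x \<le> y" and "\<And>x. x \<in> P \<Longrightarrow> f x x \<noteq> 0"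
    and "x \<in> P"
  shows "b x = 0"
proof (rule ccontr)
  assume "b x \<noteq> 0"
  then have "{x \<in> P. b x \<noteq> 0} \<noteq> {}" using assms(5) by blast
  then obtain y where y: "y \<in> P" "b y \<noteq> 0" and min: "\<And>z. z \<in> P \<Longrightarrow> b z \<noteq> 0 \<Longrightarrow> z \<le> y \<Longrightarrow> z = y"
    using finite_has_minimal[of "{x \<in> P. b x \<noteq> 0}"] assms(1) by auto
  have "(\<Sum>x\<in>P. b x * f x y) = (\<Sum>x\<in>{y}. b x * f x y)"
    using assms(1,3) y min by (intro sum.mono_neutral_right) auto
  then show False using assms(2,4) y by simp
qed

lemma triangular_zero_down:
  fixes b :: "'b::order \<Rightarrow> 'c::field"
  assumes "finite P" and "\<And>y. y \<in> P \<Longrightarrow> (\<Sum>x\<in>P. b x * f x y) = 0"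
    and "\<And>x y. x \<in> P \<Longrightarrow> y \<in> P \<Longrightarrow> f x y \<noteq> 0 \<Longrightarrow> y \<le> x" and "\<And>x. x \<in> P \<Longrightarrow> f x x \<noteq> 0"
    and "x \<in> P"
  shows "b x = 0"
proof (rule ccontr)
  assume "b x \<noteq> 0"
  then have "{x \<in> P. b x \<noteq> 0} \<noteq> {}" using assms(5) by blast
  then obtain y where y: "y \<in> P" "b y \<noteq> 0" and max: "\<And>z. z \<in> P \<Longrightarrow> b z \<noteq> 0 \<Longrightarrow> y \<le> z \<Longrightarrow> z = y"
    using finite_has_maximal[of "{x \<in> P. b x \<noteq> 0}"] assms(1) by auto
  have "(\<Sum>x\<in>P. b x * f x y) = (\<Sum>x\<in>{y}. b x * f x y)"
    using assms(1,3) y max by (intro sum.mono_neutral_right) auto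
  then show False using assms(2,4) y by simp
qed

text \<open>In terms of power sums the coefficients \<open>c\<close> become \<open>b\<close>.
  Evaluation at one monomial for each type forces \<open>b\<close> to vanish, and then the matrix
  \<open>a\<close> forces \<open>c\<close> to vanish.\<close>

lemma star_part_independent:
  assumes zero: "\<And>M. (\<Sum>la\<in>partitions n. c la * star_part la M) = 0" and la: "la \<in> partitions n"
  shows "c la = 0"
proof -
  have "\<exists>a. (\<forall>M. star_part (parts A) M = (\<Sum>B\<in>mparts n. a B * power_part B M)) \<and>
      (\<forall>B. a B \<noteq> 0 \<longrightarrow> B \<le> A) \<and> a A \<noteq> 0" if "A \<in> mparts n" for A
    using star_part_power_expansion[OF that] by metis
  then obtain a where a: "\<And>A M. A \<in> mparts n \<Longrightarrow> star_part (parts A) M = (\<Sum>B\<in>mparts n. a A B * power_part B M)"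
    "\<And>A B. A \<in> mparts n \<Longrightarrow> a A B \<noteq> 0 \<Longrightarrow> B \<le> A" "\<And>A. A \<in> mparts n \<Longrightarrow> a A A \<noteq> 0"
    by metis
  define b where "b B = (\<Sum>A\<in>mparts n. c (parts A) * a A B)" for B
  have b0: "(\<Sum>B\<in>mparts n. b B * power_part B M) = 0" for M
  proof -
    have "(\<Sum>B\<in>mparts n. b B * power_part B M) = (\<Sum>A\<in>mparts n. c (parts A) * star_part (parts A) M)"
      unfolding b_def sum_distrib_right
      by (subst sum.swap) (auto simp: a(1) sum_distrib_left mult.assoc intro!: sum.cong)
    also have "\<dots> = (\<Sum>la\<in>partitions n. c la * star_part la M)"
      by (rule sum.reindex_bij_betw[OF bij_parts])
    finally show ?thesis using zero by simp
  qed
  \<comment> \<open>The test monomials: for each type, one with these exponents on which the power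
    sum product is nonzero.\<close>
  obtain m where m: "\<And>A. A \<in> mparts n \<Longrightarrow> exponents (m A :: nat multiset) = A \<and> power_part A (m A) \<noteq> 0"
    using power_part_triangular(2) by metis
  have "b B = 0" if "B \<in> mparts n" for B
  proof (rule triangular_zero_up[OF finite_mparts _ _ _ that, where f = "\<lambda>A B. power_part A (m B)"])
    show "A \<le> B" if "A \<in> mparts n" "B \<in> mparts n" "power_part A (m B) \<noteq> 0" for A B
      using power_part_triangular(1)[OF that(1,3)] m that by simp
  qed (use b0 m in auto)
  then have "c (parts A) = 0" if "A \<in> mparts n" for A
    using triangular_zero_down[OF finite_mparts _ _ _ that, where f = a and b = "\<lambda>A. c (parts A)"] a(2,3)
    by (simp add: b_def)
  then show ?thesis using la parts_mset mset_in_mparts by metis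
qed

section \<open>Leading coefficients\<close>

text \<open>The sign \<open>(-1)\<^sup>d\<close> of the leading coefficient is recorded because contributions of equal sign
  cannot cancel.\<close>

definition has_lead :: "'a set \<Rightarrow> 'a set set \<Rightarrow> nat multiset \<Rightarrow> nat \<Rightarrow> bool" where
  "has_lead V E A d \<longleftrightarrow> A \<in> mparts (card V) \<and>
     (\<exists>c. (\<forall>M. chromatic V E M = (\<Sum>la\<in>partitions (card V). c la * star_part la M)) \<and>
       (\<forall>la\<in>partitions (card V). c la \<noteq> 0 \<longrightarrow> A \<le> mset la) \<and> c (parts A) * (-1) ^ d > 0)"

lemma lc_type_mparts:
  assumes "simple_graph V E"
  shows "lc_type V E \<in> mparts (card V)"
  unfolding lc_type_def
  by (rule mparts_block_sizes) (rule simple_graph_subset[OF assms], auto)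

text \<open>The contraction enters with a minus sign, so its exponent is one less than
  \<open>d\<close>. All terms that reach \<open>A\<close> then contribute with the sign of
  \<open>(-1) ^ d\<close>, and at least one does reach it.\<close>

lemma has_lead_combine:
  assumes eq: "\<And>M. chromatic V E M = chromatic V D M + chromatic V C M - chromatic V N M"
    and D: "has_lead V D A1 d1" and C: "has_lead V C A2 d2" and N: "has_lead V N A3 d3"
    and A: "A \<in> mparts (card V)" and le: "A \<le> A1" "A \<le> A2" "A \<le> A3"
    and sgn: "A1 = A \<Longrightarrow> d1 = d" "A2 = A \<Longrightarrow> d2 = d" "A3 = A \<Longrightarrow> d = Suc d3"
    and ex: "A1 = A \<or> A2 = A \<or> A3 = A"
  shows "has_lead V E A d"
proof -
  let ?P = "partitions (card V)"
  \<comment> \<open>Puts the three expansions on a common footing: a term whose leading type lies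
    strictly above \<open>A\<close> has coefficient zero at \<open>A\<close>.\<close>
  have lead: "\<exists>c. (\<forall>M. chromatic V F M = (\<Sum>la\<in>?P. c la * star_part la M)) \<and>
      (\<forall>la\<in>?P. c la \<noteq> 0 \<longrightarrow> A \<le> mset la) \<and>
      (if B = A then c (parts A) * (-1) ^ k > 0 else c (parts A) = 0)"
    if F: "has_lead V F B k" and AB: "A \<le> B" for F B k
  proof -
    obtain c where c: "\<forall>M. chromatic V F M = (\<Sum>la\<in>?P. c la * star_part la M)"
      "\<forall>la\<in>?P. c la \<noteq> 0 \<longrightarrow> B \<le> mset la" "c (parts B) * (-1) ^ k > 0"
      using F by (auto simp: has_lead_def)
    have "c (parts A) = 0" if "B \<noteq> A"
      using c(2) parts_in_partitions[OF A] that AB by force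
    then show ?thesis using c AB by (intro exI[of _ c]) force
  qed
  obtain c1 where c1: "\<forall>M. chromatic V D M = (\<Sum>la\<in>?P. c1 la * star_part la M)"
      "\<forall>la\<in>?P. c1 la \<noteq> 0 \<longrightarrow> A \<le> mset la"
      "if A1 = A then c1 (parts A) * (-1) ^ d1 > 0 else c1 (parts A) = 0"
    using lead[OF D le(1)] by blast
  obtain c2 where c2: "\<forall>M. chromatic V C M = (\<Sum>la\<in>?P. c2 la * star_part la M)"
      "\<forall>la\<in>?P. c2 la \<noteq> 0 \<longrightarrow> A \<le> mset la"
      "if A2 = A then c2 (parts A) * (-1) ^ d2 > 0 else c2 (parts A) = 0"
    using lead[OF C le(2)] by blast
  obtain c3 where c3: "\<forall>M. chromatic V N M = (\<Sum>la\<in>?P. c3 la * star_part la M)"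
      "\<forall>la\<in>?P. c3 la \<noteq> 0 \<longrightarrow> A \<le> mset la"
      "if A3 = A then c3 (parts A) * (-1) ^ d3 > 0 else c3 (parts A) = 0"
    using lead[OF N le(3)] by blast
  define c where "c la = c1 la + c2 la - c3 la" for la
  have "chromatic V E M = (\<Sum>la\<in>?P. c la * star_part la M)" for M
    by (simp add: eq c1(1) c2(1) c3(1) c_def algebra_simps sum.distrib sum_subtractf)
  moreover have "A \<le> mset la" if "la \<in> ?P" "c la \<noteq> 0" for la
  proof -
    have "c1 la \<noteq> 0 \<or> c2 la \<noteq> 0 \<or> c3 la \<noteq> 0" using that by (auto simp: c_def)
    then show ?thesis using that c1(2) c2(2) c3(2) by blast
  qed
  moreover have "c (parts A) * (-1) ^ d > 0"
  proof -
    have "c1 (parts A) * (-1) ^ d \<ge> 0" "A1 = A \<Longrightarrow> c1 (parts A) * (-1) ^ d > 0"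
      "c2 (parts A) * (-1) ^ d \<ge> 0" "A2 = A \<Longrightarrow> c2 (parts A) * (-1) ^ d > 0"
      "- c3 (parts A) * (-1) ^ d \<ge> 0" "A3 = A \<Longrightarrow> - c3 (parts A) * (-1) ^ d > 0"
      using c1(3) c2(3) c3(3) sgn by (auto split: if_splits)
    moreover have "c (parts A) * (-1) ^ d =
        c1 (parts A) * (-1) ^ d + c2 (parts A) * (-1) ^ d + (- c3 (parts A) * (-1) ^ d)"
      by (simp add: c_def algebra_simps)
    ultimately show ?thesis using ex by linarith
  qed
  ultimately show ?thesis using A unfolding has_lead_def by blast
qed

text \<open>Here a vertex of degree at least two has only leaf neighbors. So none is deep, the
  exponent is zero, and the only coefficient is 1.\<close>

lemma has_lead_star_forest:
  assumes G: "simple_graph V E" and I: "internal_edges E = {}"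
  shows "has_lead V E (lc_type V E) (card (deep V E))"
proof -
  have "deep V E = {}"
  proof -
    have False if x: "degree E x \<ge> 2" "leaf_star E x = {x}" for x
    proof -
      have "nbrs E x \<noteq> {}" using x by (auto simp: degree_eq_card_nbrs[OF G])
      then obtain y where y: "y \<in> nbrs E x" by blast
      then have xy: "{x, y} \<in> E" by (simp add: nbrs_def)
      then have "\<not> degree E y \<ge> 2" using I x internal_edge_iff[of x y E] by auto
      then have "y \<in> leaf_star E x" using y degree_pos[OF G xy] by (auto simp: leaf_star_def)
      then show False using x simple_graph_edgeD[OF G xy] by auto
    qed
    then show ?thesis by (auto simp: deep_def)
  qed
  moreover have T: "lc_type V E \<in> mparts (card V)" by (rule lc_type_mparts[OF G])
  let ?c = "\<lambda>la. if la = parts (lc_type V E) then 1 else 0 :: rat"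
  have "chromatic V E M = (\<Sum>la\<in>partitions (card V). ?c la * star_part la M)" for M
    using parts_in_partitions[OF T] finite_partitions chromatic_star_forest[OF G I]
    by (simp add: if_distrib[of "\<lambda>x. x * _"] sum.delta parts_def cong: if_cong)
  ultimately show ?thesis using T unfolding has_lead_def by (intro conjI exI[of _ ?c]) auto
qed

context near_contraction
begin

text \<open>Under \<open>?drop\<close> the deletion turns a deep end into a leaf and raises the
  type. But a deep end is exactly what lets the contraction keep the type, so one of the two always
  attains \<open>lc_type V E\<close>.\<close>

lemma has_lead_step:
  assumes D: "has_lead V (E - {{u, v}}) (lc_type V (E - {{u, v}})) (card (deep V (E - {{u, v}})))"
    and M: "has_lead V M (lc_type V M) (card (deep V M))"
    and N: "has_lead V N (lc_type V N) (card (deep V N))"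
  shows "has_lead V E (lc_type V E) (card (deep V E))"
proof -
  interpret d: deletion V E u v by unfold_locales (use G uv du dv in auto)
  interpret d': deletion V E v u
    by unfold_locales (use G uv du dv in \<open>simp_all add: insert_commute\<close>)
  have vu: "{v, u} = {u, v}" by auto
  let ?triv = "leaf_star E u = {u} \<or> leaf_star E v = {v}"
  let ?drop = "degree E u = 2 \<and> leaf_star E u = {u} \<or> degree E v = 2 \<and> leaf_star E v = {v}"
  have Dless: "lc_type V E < lc_type V (E - {{u, v}})" if ?drop
    using that d.lc_type_D_less d'.lc_type_D_less unfolding vu by blast
  have Deq: "lc_type V (E - {{u, v}}) = lc_type V E" "deep V (E - {{u, v}}) = deep V E" if "\<not> ?drop"
    using that d.lc_type_D_eq d.deep_D_eq by blast+
  have Nle: "lc_type V E \<le> lc_type V N" using lc_type_N_less lc_type_N_eq by fastforce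
  have Nsgn: "card (deep V E) = Suc (card (deep V N))" if "lc_type V N = lc_type V E"
    using that lc_type_N_less deep_N by force
  show ?thesis
  proof (rule has_lead_combine[OF chromatic_near_contraction[OF G uv] D M N lc_type_mparts[OF G]
        d.lc_type_D less_imp_le[OF lc_type_M] Nle])
    show "lc_type V (E - {{u, v}}) = lc_type V E \<Longrightarrow> card (deep V (E - {{u, v}})) = card (deep V E)"
      using Dless Deq by (cases ?drop) auto
    show "lc_type V M = lc_type V E \<Longrightarrow> card (deep V M) = card (deep V E)"
      using lc_type_M by simp
    show "lc_type V (E - {{u, v}}) = lc_type V E \<or> lc_type V M = lc_type V E \<or> lc_type V N = lc_type V E"
      using Deq lc_type_N_eq by blast
  qed (rule Nsgn)
qed

end

lemma has_lead_forest:
  assumes "simple_graph V E" "forest E"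
  shows "has_lead V E (lc_type V E) (card (deep V E))"
  using assms
proof (induction "card (internal_edges E)" arbitrary: E rule: less_induct)
  case less
  note G = less.prems(1) and F = less.prems(2)
  show ?case
  proof (cases "internal_edges E = {}")
    case True
    then show ?thesis by (rule has_lead_star_forest[OF G])
  next
    case False
    then obtain e where e: "e \<in> internal_edges E" by blast
    then have "e \<in> E" by (simp add: internal_edges_def)
    then obtain u v where "e = {u, v}" using simple_graph_edgeE[OF G] by metis
    then have uv: "{u, v} \<in> E" and du: "degree E u \<ge> 2" and dv: "degree E v \<ge> 2"
      using e by (auto simp: internal_edges_def)
    have ne: "u \<noteq> v" using simple_graph_edgeD[OF G uv] by blast
    have none: "nbrs E u \<inter> nbrs E v = {}"
    proof (rule ccontr)
      assume "nbrs E u \<inter> nbrs E v \<noteq> {}"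
      then obtain x where x: "{u, x} \<in> E" "{v, x} \<in> E" by (auto simp: nbrs_def)
      have "x \<noteq> u" "x \<noteq> v" using simple_graph_edgeD(3)[OF G x(1)] simple_graph_edgeD(3)[OF G x(2)] by auto
      then have "conn (E - {{u, v}}) u x" "conn (E - {{u, v}}) v x"
        using x ne by (auto intro!: conn_edge simp: doubleton_eq_iff)
      then have "conn (E - {{u, v}}) u v" using conn_sym conn_trans by metis
      then show False using forestD[OF F uv] by blast
    qed
    have "card (nbrs E u \<union> nbrs E v - {u, v}) \<ge> 2"
    proof -
      have "\<not> nbrs E u \<subseteq> {v}" "\<not> nbrs E v \<subseteq> {u}"
        using du dv card_mono[of "{v}" "nbrs E u"] card_mono[of "{u}" "nbrs E v"]
        by (auto simp: degree_eq_card_nbrs[OF G])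
      then obtain a b where ab: "a \<in> nbrs E u" "a \<noteq> v" "b \<in> nbrs E v" "b \<noteq> u" by blast
      then have "a \<noteq> b" using none by blast
      moreover have "{a, b} \<subseteq> nbrs E u \<union> nbrs E v - {u, v}"
        using ab nbrs_subset[OF G, of u] nbrs_subset[OF G, of v] by blast
      ultimately show ?thesis
        using card_mono[of "nbrs E u \<union> nbrs E v - {u, v}" "{a, b}"] finite_nbrs[OF G] by simp
    qed
    then interpret near_contraction V E u v
      by unfold_locales (use G uv du dv none in auto)
    interpret d: deletion V E u v by unfold_locales (use G uv du dv in auto)
    have FD: "forest (E - {{u, v}})" by (rule forest_subset[OF F]) auto
    show ?thesis
      by (rule has_lead_step)
        (rule less.hyps; fact d.card_internal_edges_D d.GD FD card_internal_edges GM GN contract_forest[OF G uv F])+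
  qed
qed

section \<open>Choosing an edge of the cycle\<close>

lemma rotation_to:
  assumes "x \<in> set vs"
  obtains n l where "rotate n vs = x # l"
proof -
  obtain ys zs where "vs = ys @ x # zs" using assms by (meson split_list)
  then have "rotate (length ys) vs = x # zs @ ys" by (simp add: rotate_append)
  then show thesis by (rule that)
qed

text \<open>Going round from \<open>p\<close>, either \<open>P\<close> fails at some step or it
  holds everywhere. Applied to roots, this finds a cycle edge starting at a root; if there are at
  least two roots, one of them lies off this edge.\<close>

lemma rotation_boundary:
  assumes len: "length vs \<ge> 2" and p: "p \<in> set vs" "P p"
  obtains n u v l where "rotate n vs = u # v # l" "P u" "\<not> P v \<or> (\<forall>x\<in>set vs. P x)"
proof -
  let ?k = "length vs"
  have "\<exists>n. P (vs ! (n mod ?k)) \<and> (\<not> P (vs ! (Suc n mod ?k)) \<or> (\<forall>x\<in>set vs. P x))"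
  proof (rule ccontr)
    assume H: "\<not> ?thesis"
    obtain i where i: "i < ?k" "vs ! i = p" using p by (meson in_set_conv_nth)
    have step: "P (vs ! ((i + m) mod ?k))" for m
    proof (induction m)
      case (Suc m)
      then show ?case using H by auto
    qed (use i p in simp)
    \<comment> \<open>Modulo the length, index \<open>j\<close> is reached from index
      \<open>i\<close> in \<open>j + (?k - i)\<close> steps.\<close>
    have "P (vs ! j)" if "j < ?k" for j
      using step[of "j + (?k - i)"] that i by (simp add: add.commute add.left_commute)
    then have "\<forall>x\<in>set vs. P x" by (metis in_set_conv_nth)
    then show False using H i p by (metis mod_less)
  qed
  then obtain n where n: "P (vs ! (n mod ?k))" "\<not> P (vs ! (Suc n mod ?k)) \<or> (\<forall>x\<in>set vs. P x)" by blast
  obtain u v l where r: "rotate n vs = u # v # l"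
    using len length_rotate[of n vs] by (cases "rotate n vs"; cases "tl (rotate n vs)") auto
  have "u = vs ! (n mod ?k)" "v = vs ! (Suc n mod ?k)"
  proof -
    have "rotate n vs ! 0 = vs ! ((n + 0) mod ?k)" "rotate n vs ! 1 = vs ! ((n + 1) mod ?k)"
      by (rule nth_rotate, use len in linarith)+
    then show "u = vs ! (n mod ?k)" "v = vs ! (Suc n mod ?k)" unfolding r by simp_all
  qed
  then show thesis using n r that by blast
qed

lemma cycle_neighbors:
  assumes "is_cycle E (a # l)"
  shows "{a, y} \<in> cycle_edges (a # l) \<longleftrightarrow> y \<in> {hd l, last l}" and "hd l \<noteq> last l"
proof -
  have C: "distinct (a # l)" "length l \<ge> 2" using assms by (auto simp: is_cycle_def)
  obtain b m where b: "l = b # m" "m \<noteq> []" using C(2) by (cases l; cases "tl l") auto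
  obtain k z where z: "l = k @ [z]" using b by (metis rev_exhaust list.discI)
  have ends: "hd l = b" "last l = z" using b z by (simp, metis last_snoc)
  show "hd l \<noteq> last l" using C(1) b last_in_set[of m] by auto
  have "cycle_edges (a # l) = insert {a, b} (path_edges (l @ [a]))" using b by (simp add: cycle_edges_Cons)
  also have "path_edges (l @ [a]) = path_edges l \<union> {{z, a}}"
    using path_edges_append[of k z "[a]"] z by simp
  finally have ce: "cycle_edges (a # l) = insert {a, b} (path_edges l \<union> {{z, a}})" .
  have "{a, y} \<notin> path_edges l" using path_edges_subset[of "{a, y}" l] C(1) by auto
  then show "{a, y} \<in> cycle_edges (a # l) \<longleftrightarrow> y \<in> {hd l, last l}"
    unfolding ce ends by (auto simp: doubleton_eq_iff)
qed

text \<open>A cycle vertex has exactly two neighbors along cycle edges, so its rooted tree is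
  non-trivial exactly if there is a third neighbor. Roots are treated as cycle vertices of degree at
  least three from here on.\<close>

lemma cycle_degree:
  assumes G: "simple_graph V E" and C: "is_cycle E vs" and x: "x \<in> set vs"
  shows "degree E x \<ge> 2" and "card (rooted_tree E vs x) > 1 \<longleftrightarrow> degree E x \<ge> 3"
proof -
  obtain n l where r: "rotate n vs = x # l" using rotation_to[OF x] .
  have C': "is_cycle E (x # l)" and ce: "cycle_edges vs = cycle_edges (x # l)"
    using C is_cycle_rotate[of E n vs] cycle_edges_rotate[of n vs] by (auto simp: r)
  let ?F = "E - cycle_edges vs"
  have GF: "simple_graph V ?F" by (rule simple_graph_subset[OF G]) auto
  have sub: "{hd l, last l} \<subseteq> nbrs E x"
    using cycle_neighbors(1)[OF C'] C' by (auto simp: nbrs_def is_cycle_def)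
  have two: "card {hd l, last l} = 2" using cycle_neighbors(2)[OF C'] by simp
  show "degree E x \<ge> 2"
    using card_mono[OF finite_nbrs[OF G] sub] two by (simp add: degree_eq_card_nbrs[OF G])
  have "nbrs ?F x = nbrs E x - {hd l, last l}"
    using cycle_neighbors(1)[OF C'] by (auto simp: nbrs_def ce)
  then have card: "card (nbrs ?F x) = degree E x - 2"
    using card_Diff_subset[OF _ sub] two by (simp add: degree_eq_card_nbrs[OF G])
  have "card (component ?F x) > 1 \<longleftrightarrow> nbrs ?F x \<noteq> {}"
  proof
    assume "nbrs ?F x \<noteq> {}"
    then obtain y where y: "{x, y} \<in> ?F" by (auto simp: nbrs_def)
    then have "{x, y} \<subseteq> component ?F x" using conn_edge[OF y] by (simp add: conn_def)
    moreover have "x \<in> V" "x \<noteq> y" using simple_graph_edgeD[OF GF y] by auto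
    moreover have "finite (component ?F x)"
      using component_subset[OF GF \<open>x \<in> V\<close>] simple_graph_finite[OF G] finite_subset by blast
    ultimately show "card (component ?F x) > 1" using card_mono[of "component ?F x" "{x, y}"] by simp
  next
    assume c: "card (component ?F x) > 1"
    show "nbrs ?F x \<noteq> {}"
    proof
      assume none: "nbrs ?F x = {}"
      have "y = x" if "conn ?F x y" for y
      proof -
        have "y \<in> {x}" by (rule conn_closed[OF that]) (use none in \<open>auto simp: nbrs_def\<close>)
        then show ?thesis by simp
      qed
      then have "component ?F x = {x}" by (auto simp: conn_def)
      then show False using c by simp
    qed
  qed
  then show "card (rooted_tree E vs x) > 1 \<longleftrightarrow> degree E x \<ge> 3"
    using card finite_nbrs[OF GF, of x] by (auto simp: rooted_tree_def)
qed

lemma sole_cycle_delete_forest: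
  "sole_cycle E vs \<Longrightarrow> f \<in> cycle_edges vs \<Longrightarrow> forest (E - {f})"
  by (simp add: sole_cycle_def)

text \<open>The contracted edge is chosen so that a root remains in \<open>l\<close>. In a triangle
  this root is the third vertex, as \<open>common\<close> requires. On a longer cycle it survives as
  a second root next to \<open>u\<close>, which still has degree at least
  \<open>3 + 2 - 2\<close>.\<close>

lemma has_lead_two_roots:
  assumes "simple_graph V E" "sole_cycle E vs"
    and "p \<in> set vs" "q \<in> set vs" "p \<noteq> q" "degree E p \<ge> 3" "degree E q \<ge> 3"
  shows "has_lead V E (lc_type V E) (card (deep V E))"
  using assms
proof (induction "length vs" arbitrary: E vs p q rule: less_induct)
  case less
  note G = less.prems(1)
  have "length vs \<ge> 2" using less.prems(2) by (simp add: sole_cycle_def is_cycle_def)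
  then obtain n u v l where r: "rotate n vs = u # v # l" and u: "degree E u \<ge> 3"
    and bd: "\<not> degree E v \<ge> 3 \<or> (\<forall>x\<in>set vs. degree E x \<ge> 3)"
    by (rule rotation_boundary[where P = "\<lambda>x. degree E x \<ge> 3", OF _ less.prems(3,6)]) (rule that)
  have C: "sole_cycle E (u # v # l)" using less.prems(2) sole_cycle_rotate[of E n vs] r by simp
  have setv: "set vs = insert u (insert v (set l))" using r by (metis list.set(2) set_rotate)
  have lenv: "length vs = Suc (Suc (length l))" using r length_rotate[of n vs] by simp
  have C': "is_cycle E (u # v # l)" using C by (simp add: sole_cycle_def)
  have dist: "distinct (u # v # l)" "length l \<ge> 1" using C' by (auto simp: is_cycle_def)
  have uvc: "{u, v} \<in> cycle_edges (u # v # l)" by (simp add: cycle_edges_Cons)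
  then have uv: "{u, v} \<in> E" using C' by (auto simp: is_cycle_def)
  have dv: "degree E v \<ge> 2" by (rule cycle_degree(1)[OF G C']) simp
  have other: "\<exists>y\<in>set l. degree E y \<ge> 3"
  proof (cases "\<forall>x\<in>set vs. degree E x \<ge> 3")
    case True
    then show ?thesis using dist(2) setv by (cases l) auto
  next
    case False
    then have "p \<noteq> v" "q \<noteq> v" using bd less.prems by auto
    then show ?thesis using less.prems setv by auto
  qed
  have fin: "finite (nbrs E u \<union> nbrs E v - {u, v})" using finite_nbrs[OF G] by simp
  have dc: "card (nbrs E u \<union> nbrs E v - {u, v}) \<ge> 2"
  proof -
    have "nbrs E u - {v} \<subseteq> nbrs E u \<union> nbrs E v - {u, v}" using nbrs_subset[OF G, of u] by blast
    then have "card (nbrs E u - {v}) \<le> card (nbrs E u \<union> nbrs E v - {u, v})" by (rule card_mono[OF fin])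
    moreover have "card (nbrs E u - {v}) \<ge> 2"
      using u finite_nbrs[OF G, of u] by (auto simp: degree_eq_card_nbrs[OF G] card_Diff_singleton_if)
    ultimately show ?thesis by simp
  qed
  interpret near_contraction V E u v
  proof unfold_locales
    fix x assume "x \<in> nbrs E u" "x \<in> nbrs E v"
    then have "l = [x]" by (rule sole_cycle_triangle[OF G C])
    then show "degree E x \<ge> 3" using other by simp
  qed (use G uv u dv dc in auto)
  have "has_lead V N (lc_type V N) (card (deep V N)) \<and> has_lead V M (lc_type V M) (card (deep V M))"
  proof (cases "length l = 1")
    case True
    then show ?thesis using sole_cycle_contract(1)[OF G C] has_lead_forest GN GM by blast
  next
    case False
    then have len: "length l \<ge> 2" using dist by linarith
    have none: "nbrs E u \<inter> nbrs E v = {}"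
      using sole_cycle_triangle[OF G C] False by fastforce
    obtain y where y: "y \<in> set l" "degree E y \<ge> 3" using other by blast
    then have yuv: "y \<notin> {u, v}" using dist by auto
    have "degree N u \<ge> 3" "degree N y \<ge> 3"
      using deg_N_eq[OF none] u dv y yuv by auto
    moreover have "degree M u \<ge> 3" "degree M y \<ge> 3"
      using deg_N_eq[OF none] u dv y yuv deg_u deg_M[OF yuv] by auto
    moreover have "sole_cycle N (u # l)" "sole_cycle M (u # l)"
      using sole_cycle_contract(2)[OF G C len] by auto
    ultimately show ?thesis
      using less.hyps[of "u # l" N u y] less.hyps[of "u # l" M u y] GN GM lenv y yuv by auto
  qed
  moreover have "has_lead V (E - {{u, v}}) (lc_type V (E - {{u, v}})) (card (deep V (E - {{u, v}})))"
    using sole_cycle_delete_forest[OF C uvc] simple_graph_subset[OF G] by (intro has_lead_forest) auto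
  ultimately show ?case using has_lead_step by blast
qed

section \<open>A single root\<close>

lemma simple_graph_eqI:
  assumes A: "simple_graph V A" and B: "simple_graph V B" and e: "\<And>x y. {x, y} \<in> A \<longleftrightarrow> {x, y} \<in> B"
  shows "A = B"
proof (intro equalityI subsetI)
  fix f assume f: "f \<in> A"
  obtain x y where "f = {x, y}" using simple_graph_edgeE[OF A f] by metis
  then show "f \<in> B" using f e by simp
next
  fix f assume f: "f \<in> B"
  obtain x y where "f = {x, y}" using simple_graph_edgeE[OF B f] by metis
  then show "f \<in> A" using f e by simp
qed

text \<open>\<open>D\<close> opens the cycle to a path hanging at \<open>v\<close> that ends in
  \<open>x\<close> and \<open>w\<close>, and \<open>S\<close> cuts off \<open>w\<close>. The
  contraction is \<open>S\<close> with \<open>{v, x}\<close> added, so its leading type is that of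
  \<open>S\<close>; the near-contraction leads at \<open>S\<close> with the leaf \<open>w\<close> at
  \<open>v\<close>. By \<open>lc_type_extend_leaf\<close> the former is at least the type of
  \<open>D\<close>, with matching sign if equal; the latter is strictly larger.\<close>

lemma has_lead_one_root:
  assumes "simple_graph V E" "sole_cycle E (v # w # l)" "degree E v \<ge> 3"
    and "\<And>y. y \<in> set (w # l) \<Longrightarrow> degree E y = 2"
  shows "has_lead V E (lc_type V (E - {{v, w}})) (card (deep V (E - {{v, w}})))"
  using assms
proof (induction "length l" arbitrary: E w l rule: less_induct)
  case less
  note G = less.prems(1) and C = less.prems(2) and d3 = less.prems(3) and d2 = less.prems(4)
  have C': "is_cycle E (v # w # l)" using C by (simp add: sole_cycle_def)
  have dist: "distinct (v # w # l)" "length l \<ge> 1" and ceE: "cycle_edges (v # w # l) \<subseteq> E"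
    using C' by (auto simp: is_cycle_def)
  obtain x m where l: "l = x # m" using dist(2) by (cases l) auto
  have ne: "v \<noteq> w" "v \<noteq> x" "w \<noteq> x" using dist l by auto
  \<comment> \<open>The vertex after \<open>x\<close> on the cycle, which is the root
    \<open>v\<close> if the cycle is a triangle.\<close>
  define z where "z = hd (m @ [v])"
  have z: "z \<noteq> w" "z \<noteq> x" "z = v \<or> z \<in> set m"
    using dist l by (auto simp: z_def hd_append split: if_splits)
  have ce: "{v, w} \<in> cycle_edges (v # w # l)" "{w, x} \<in> cycle_edges (v # w # l)" "{x, z} \<in> cycle_edges (v # w # l)"
    by (simp_all add: cycle_edges_Cons l z_def) (cases m; simp)
  then have vw: "{v, w} \<in> E" and wx: "{w, x} \<in> E" and xz: "{x, z} \<in> E" using ceE by auto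
  have dw: "degree E w = 2" and dx: "degree E x = 2" using d2 l by auto
  have nw: "nbrs E w = {v, x}"
  proof (rule card_subset_eq[symmetric])
    show "{v, x} \<subseteq> nbrs E w" using vw wx by (auto simp: nbrs_def insert_commute)
    show "card {v, x} = card (nbrs E w)" using dw ne by (simp add: degree_eq_card_nbrs[OF G])
  qed (rule finite_nbrs[OF G])
  have nx: "nbrs E x = {w, z}"
  proof (rule card_subset_eq[symmetric])
    have "w \<in> nbrs E x" using wx nbrs_sym[of w E x] by (auto simp: nbrs_def)
    then show "{w, z} \<subseteq> nbrs E x" using xz by (auto simp: nbrs_def)
    show "card {w, z} = card (nbrs E x)" using dx z by (simp add: degree_eq_card_nbrs[OF G])
  qed (rule finite_nbrs[OF G])
  define D where "D = E - {{v, w}}"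
  define S where "S = D - {{w, x}}"
  have GD: "simple_graph V D" and GS: "simple_graph V S"
    by (rule simple_graph_subset[OF G], auto simp: D_def S_def)+
  have V: "v \<in> V" "w \<in> V" "x \<in> V"
    using simple_graph_edgeD[OF G vw] simple_graph_edgeD[OF G wx] by auto
  have wxD: "{w, x} \<in> D" using wx ne by (auto simp: D_def doubleton_eq_iff)
  have DS: "D = insert {w, x} S" using wxD by (auto simp: S_def)
  have degS: "degree S w = 0" "degree S x = 1" "degree S v = degree E v - 1"
    "y \<notin> {v, w, x} \<Longrightarrow> degree S y = degree E y" for y
    using dw dx ne unfolding S_def degree_delete[OF GD wxD] unfolding D_def degree_delete[OF G vw]
    by auto
  have xzS: "{x, z} \<in> S" using xz z ne by (auto simp: S_def D_def doubleton_eq_iff)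
  have dz: "degree S z \<ge> 2"
  proof (cases "z = v")
    case False
    then have "z \<in> set m" using z by simp
    then show ?thesis using degS(4)[of z] d2[of z] z False l by simp
  qed (use degS d3 in simp)
  have dvS: "degree S v \<ge> 2" using degS d3 by simp
  note ext = lc_type_extend_leaf[OF GS V(2) degS(1,2) xzS dz, folded DS]
  have att: "lc_type V S < lc_type V (insert {v, w} S)"
    using lc_type_attach_leaf[OF GS V(2) degS(1) V(1) dvS] by (simp only: insert_commute)
  have dc: "card (nbrs E v \<union> nbrs E w - {v, w}) \<ge> 2"
  proof -
    have "nbrs E v - {w} \<subseteq> nbrs E v \<union> nbrs E w - {v, w}" using nbrs_subset[OF G, of v] by blast
    then have "card (nbrs E v - {w}) \<le> card (nbrs E v \<union> nbrs E w - {v, w})"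
      using finite_nbrs[OF G] by (intro card_mono) auto
    moreover have "card (nbrs E v - {w}) \<ge> 2"
      using d3 finite_nbrs[OF G, of v] by (auto simp: degree_eq_card_nbrs[OF G] card_Diff_singleton_if)
    ultimately show ?thesis by simp
  qed
  have GN: "simple_graph V (contract v w E)" by (rule simple_graph_contract[OF G vw])
  have N: "contract v w E = insert {v, x} S"
  proof (rule simple_graph_eqI[OF GN simple_graph_insert[OF GS V(1,3) ne(2)]])
    fix a b
    have irr: "{a, a} \<notin> E" "{a, a} \<notin> contract v w E"
      using simple_graph_edgeD(3)[OF G, of a a] simple_graph_edgeD(3)[OF GN, of a a] by blast+
    have wa: "{w, b} \<in> E \<longleftrightarrow> b = v \<or> b = x" using nw by (auto simp: nbrs_def)
    have aw: "{a, w} \<in> E \<longleftrightarrow> a = v \<or> a = x" using nw by (auto simp: nbrs_def insert_commute)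
    show "{a, b} \<in> contract v w E \<longleftrightarrow> {a, b} \<in> insert {v, x} S"
      using ne irr wa aw
      by (cases "a = w"; cases "b = w"; cases "a = b")
        (auto simp: contract_edge_iff[OF G ne(1)] S_def D_def doubleton_eq_iff)
  qed
  let ?N = "contract v w E" and ?M = "insert {v, w} (contract v w E)"
  have GM: "simple_graph V ?M" by (rule simple_graph_insert[OF GN V(1,2) ne(1)])
  \<comment> \<open>The near-contraction will lie strictly above the claimed type, so its exponent
    \<open>d\<close> may stay unspecified.\<close>
  have leads: "has_lead V ?N (lc_type V S) (card (deep V S)) \<and>
      (\<exists>d. has_lead V ?M (lc_type V (insert {v, w} S)) d)"
  proof (cases "length l = 1")
    case True
    \<comment> \<open>On a triangle, \<open>{v, x}\<close> already belongs to \<open>S\<close>, so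
      the contraction is \<open>S\<close> itself, a forest whose lead is known.\<close>
    then have "z = v" using l by (simp add: z_def)
    then have "{v, x} \<in> S" using xzS by (simp add: insert_commute)
    then have "?N = S" "?M = insert {v, w} S" using N by auto
    then show ?thesis
      using sole_cycle_contract(1)[OF G C True] has_lead_forest[of V] GN GM by metis
  next
    case False
    then have len: "length l \<ge> 2" using dist by linarith
    have none: "nbrs E v \<inter> nbrs E w = {}"
      using sole_cycle_triangle[OF G C] False by fastforce
    interpret near_contraction V E v w
      by unfold_locales (use G vw d3 dw none dc in auto)
    have dN: "degree ?N v \<ge> 3" using deg_N_eq(2)[OF none] d3 dw by simp
    then have dM: "degree ?M v \<ge> 3" using deg_u by simp
    have other: "degree ?N y = 2" "degree ?M y = 2" if "y \<in> set (x # m)" for y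
    proof -
      have y: "y \<notin> {v, w}" "degree E y = 2" using that dist l d2[of y] by auto
      then show "degree ?N y = 2" "degree ?M y = 2" using deg_N_eq(1)[OF none] deg_M by auto
    qed
    have cyc: "sole_cycle ?N (v # x # m)" "sole_cycle ?M (v # x # m)"
      using sole_cycle_contract(2)[OF G C len] l by auto
    have vxS: "{v, x} \<notin> S"
    proof
      assume "{v, x} \<in> S"
      then have "x \<in> nbrs E v" by (simp add: S_def D_def nbrs_def)
      then show False using none nw by auto
    qed
    then have NS: "?N - {{v, x}} = S" "?M - {{v, x}} = insert {v, w} S"
      using N ne by (auto simp: doubleton_eq_iff)
    have "has_lead V ?N (lc_type V (?N - {{v, x}})) (card (deep V (?N - {{v, x}})))"
      by (rule less.hyps[OF _ GN cyc(1) dN other(1)]) (simp_all add: l)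
    moreover have "has_lead V ?M (lc_type V (?M - {{v, x}})) (card (deep V (?M - {{v, x}})))"
      by (rule less.hyps[OF _ GM cyc(2) dM other(2)]) (simp_all add: l)
    ultimately show ?thesis unfolding NS by blast
  qed
  then obtain d where M: "has_lead V ?M (lc_type V (insert {v, w} S)) d" by blast
  have leadD: "has_lead V D (lc_type V D) (card (deep V D))"
    using sole_cycle_delete_forest[OF C ce(1)] by (intro has_lead_forest GD) (simp add: D_def)
  have "has_lead V E (lc_type V D) (card (deep V D))"
  proof (rule has_lead_combine[OF _ leadD M conjunct1[OF leads] lc_type_mparts[OF GD]])
    show "chromatic V E K = chromatic V D K + chromatic V ?M K - chromatic V ?N K" for K
      unfolding D_def by (rule chromatic_near_contraction[OF G vw])
    show "lc_type V D \<le> lc_type V S" by (rule ext(1))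
    then show "lc_type V D \<le> lc_type V (insert {v, w} S)" using att by simp
    show "lc_type V (insert {v, w} S) = lc_type V D \<Longrightarrow> d = card (deep V D)"
      using att ext(1) by simp
    show "lc_type V S = lc_type V D \<Longrightarrow> card (deep V D) = Suc (card (deep V S))"
      using ext(2) by simp
  qed auto
  then show ?case by (simp add: D_def)
qed

section \<open>The lexicographic order on partitions\<close>

text \<open>Beyond the common prefix, all parts of \<open>la\<close> are at most
  \<open>la ! j\<close> and hence dominated by the single part \<open>mu ! j\<close>.\<close>

lemma lex_less_mset_less:
  assumes la: "la \<in> partitions n" and j: "j < length la" "j < length mu"
    "\<forall>i<j. la ! i = mu ! i" "la ! j < mu ! j"
  shows "mset la < mset mu"
proof -
  have t: "take j la = take j mu" using j by (intro nth_take_lemma) auto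
  have "mset (take j la) + mset (drop j la) < mset (take j la) + mset (drop j mu)"
  proof (rule union_less_multisetI)
    show "mset (drop j mu) \<noteq> {#}" using j by simp
    fix k assume "k \<in># mset (drop j la)"
    then obtain i where i: "k = la ! (j + i)" "j + i < length la"
      by (auto simp: in_set_conv_nth)
    then have "k \<le> la ! j" using la j(1)
      by (cases "i = 0") (auto simp: partitions_def sorted_wrt_iff_nth_less)
    moreover have "mu ! j \<in># mset (drop j mu)" using j(2) by (simp add: Cons_nth_drop_Suc[symmetric])
    ultimately show "\<exists>b\<in>#mset (drop j mu). k < b" using j(4) le_less_trans by blast
  qed
  also have "mset (take j la) + mset (drop j la) = mset la" by (metis append_take_drop_id mset_append)
  also have "mset (take j la) + mset (drop j mu) = mset mu" unfolding t by (metis append_take_drop_id mset_append)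
  finally show ?thesis .
qed

lemma lex_le_iff:
  assumes la: "la \<in> partitions n" and mu: "mu \<in> partitions n"
  shows "lex_le la mu \<longleftrightarrow> mset la \<le> mset mu"
proof
  assume "lex_le la mu"
  then show "mset la \<le> mset mu"
    using lex_less_mset_less[OF la] unfolding lex_le_def by (metis less_imp_le order_refl)
next
  assume le: "mset la \<le> mset mu"
  show "lex_le la mu"
  proof (cases "la = mu")
    case False
    \<comment> \<open>A partition is not a proper prefix of another one of the same number: the
      extra parts would be positive with sum zero.\<close>
    have prefix: "xs = ys" if xs: "xs \<in> partitions n" and ys: "ys \<in> partitions n" and len: "length xs \<le> length ys"
      and eq: "\<forall>i<length xs. xs ! i = ys ! i" for xs ys :: "nat list"
    proof -
      have "xs = take (length xs) ys" using len eq by (intro nth_equalityI) auto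
      then obtain zs where zs: "ys = xs @ zs" by (metis append_take_drop_id)
      then have "sum_list zs = 0" "0 \<notin> set zs" using xs ys by (auto simp: partitions_def)
      then have "zs = []" by (cases zs) auto
      then show ?thesis using zs by simp
    qed
    have ex: "\<exists>j. j < length la \<and> j < length mu \<and> la ! j \<noteq> mu ! j"
    proof (rule ccontr)
      assume H: "\<not> ?thesis"
      then have "la = mu"
      proof (cases "length la \<le> length mu")
        case True
        then show ?thesis using prefix[OF la mu] H by auto
      next
        case False
        then show ?thesis using prefix[OF mu la] H by auto
      qed
      with False show False ..
    qed
    define j where "j = (LEAST j. j < length la \<and> j < length mu \<and> la ! j \<noteq> mu ! j)"
    have j: "j < length la" "j < length mu" "la ! j \<noteq> mu ! j"
      using LeastI_ex[OF ex] by (auto simp: j_def)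
    have eq: "\<forall>i<j. la ! i = mu ! i"
      using not_less_Least[of _ "\<lambda>j. j < length la \<and> j < length mu \<and> la ! j \<noteq> mu ! j"] j
      by (auto simp: j_def[symmetric])
    have "\<not> mu ! j < la ! j"
    proof
      assume "mu ! j < la ! j"
      then have "mset mu < mset la" using lex_less_mset_less[OF mu j(2,1)] eq by simp
      then show False using le by simp
    qed
    then show ?thesis using j eq unfolding lex_le_def by (metis linorder_neqE_nat)
  qed (simp add: lex_le_def)
qed

text \<open>Resolves both definite descriptions: linear independence makes the coefficient family
  unique, and antisymmetry of the order makes the smallest partition unique.\<close>

lemma lambda_lead_eq:
  assumes "has_lead V E A d"
  shows "lambda_lead (card V) (chromatic V E) = parts A"
proof -
  let ?n = "card V" and ?f = "chromatic V E"
  obtain c where A: "A \<in> mparts ?n" and c: "\<And>M. ?f M = (\<Sum>la\<in>partitions ?n. c la * star_part la M)"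
    "\<And>la. la \<in> partitions ?n \<Longrightarrow> c la \<noteq> 0 \<Longrightarrow> A \<le> mset la" and cA: "c (parts A) \<noteq> 0"
    using assms unfolding has_lead_def by fastforce
  let ?c = "\<lambda>la. if la \<in> partitions ?n then c la else 0"
  have co: "star_coeff ?n ?f = ?c"
    unfolding star_coeff_def
  proof (rule the_equality)
    show "(\<forall>la. la \<notin> partitions ?n \<longrightarrow> ?c la = 0) \<and> (\<forall>M. ?f M = (\<Sum>la\<in>partitions ?n. ?c la * star_part la M))"
      by (auto simp: c(1) intro!: sum.cong)
    fix c' assume c': "(\<forall>la. la \<notin> partitions ?n \<longrightarrow> c' la = 0) \<and> (\<forall>M. ?f M = (\<Sum>la\<in>partitions ?n. c' la * star_part la M))"
    have "(\<Sum>la\<in>partitions ?n. (c' la - c la) * star_part la M) = 0" for M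
      using c' c(1)[of M] by (simp add: left_diff_distrib sum_subtractf)
    then have "c' la - c la = 0" if "la \<in> partitions ?n" for la
      using star_part_independent[where n = ?n and c = "\<lambda>la. c' la - c la"] that by blast
    then show "c' = ?c" using c' by fastforce
  qed
  have pA: "parts A \<in> partitions ?n" by (rule parts_in_partitions[OF A])
  show ?thesis
    unfolding lambda_lead_def co
  proof (rule the_equality)
    show "parts A \<in> partitions ?n \<and> ?c (parts A) \<noteq> 0 \<and>
        (\<forall>mu\<in>partitions ?n. ?c mu \<noteq> 0 \<longrightarrow> lex_le (parts A) mu)"
      using pA cA c(2) by (auto simp: lex_le_iff)
    fix la assume la: "la \<in> partitions ?n \<and> ?c la \<noteq> 0 \<and>
        (\<forall>mu\<in>partitions ?n. ?c mu \<noteq> 0 \<longrightarrow> lex_le la mu)"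
    then have "lex_le la (parts A)" using pA cA by simp
    then have "mset la \<le> A" using lex_le_iff[of la ?n "parts A"] la pA by simp
    moreover have "la \<in> partitions ?n" "c la \<noteq> 0" using la by (auto split: if_splits)
    then have "A \<le> mset la" by (rule c(2))
    ultimately have "mset la = A" by simp
    then show "la = parts A" using parts_mset[of la ?n] la by simp
  qed
qed

lemma lambda_LC_eq: "lambda_LC V E = parts (lc_type V E)"
  by (simp add: lambda_LC_def parts_def lc_type_def block_sizes_def)

theorem theorem5p6:
  fixes V :: "'a set" and E :: "'a set set" and vs :: "'a list" and r :: nat
  assumes "unicyclic V E"
    and "is_cycle E vs"
    and "r = card (nontrivial_roots E vs)"
    and "r \<ge> 1"
  shows "(r = 1 \<longrightarrow>
            (\<forall>v e. v \<in> nontrivial_roots E vs \<and> e \<in> cycle_edges vs \<and> v \<in> e \<longrightarrow>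
               lambda_lead (card V) (chromatic V E) = lambda_LC V (E - {e}))) \<and>
         (r \<ge> 2 \<longrightarrow> lambda_lead (card V) (chromatic V E) = lambda_LC V E)"
proof (intro conjI impI allI)
  have G: "simple_graph V E" using assms(1) by (simp add: unicyclic_def)
  have C: "sole_cycle E vs" by (rule unicyclic_sole_cycle[OF assms(1,2)])
  have roots: "nontrivial_roots E vs = {x \<in> set vs. degree E x \<ge> 3}"
    using cycle_degree(2)[OF G assms(2)] by (auto simp: nontrivial_roots_def)
  {
    assume "r \<ge> 2"
    then have "\<not> card (nontrivial_roots E vs) \<le> 1" using assms(3) by simp
    then obtain p q where "p \<in> nontrivial_roots E vs" "q \<in> nontrivial_roots E vs" "p \<noteq> q"
      by (metis card_le_Suc0_iff_eq One_nat_def card.infinite le0)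
    then have "has_lead V E (lc_type V E) (card (deep V E))"
      using has_lead_two_roots[OF G C, of p q] roots by simp
    then show "lambda_lead (card V) (chromatic V E) = lambda_LC V E"
      by (simp add: lambda_lead_eq lambda_LC_eq)
  next
    fix v e
    assume "r = 1" and ve: "v \<in> nontrivial_roots E vs \<and> e \<in> cycle_edges vs \<and> v \<in> e"
    then have "nontrivial_roots E vs = {v}" using assms(3) by (auto simp: card_1_singleton_iff)
    then have d2: "degree E y = 2" if "y \<in> set vs" "y \<noteq> v" for y
      using that roots cycle_degree(1)[OF G assms(2), of y] by fastforce
    have v: "v \<in> set vs" "degree E v \<ge> 3" using ve roots by auto
    obtain n l where rot: "rotate n vs = v # l" using rotation_to[OF v(1)] .
    have Cl: "sole_cycle E (v # l)" and ce: "cycle_edges vs = cycle_edges (v # l)"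
      using C sole_cycle_rotate[of E n vs] cycle_edges_rotate[of n vs] rot by auto
    \<comment> \<open>Run backwards from \<open>v\<close>, the cycle starts with the other cycle
      edge at \<open>v\<close>; the two directions cover both choices of \<open>e\<close>.\<close>
    have "rotate1 (v # rev l) = rev (v # l)" by simp
    then have Cr: "sole_cycle E (v # rev l)"
      using Cl sole_cycle_rev[of E "v # l"] sole_cycle_rotate[of E 1 "v # rev l"] by simp
    have setv: "set vs = insert v (set l)" using rot by (metis list.set(2) set_rotate)
    have cl: "is_cycle E (v # l)" using Cl by (simp add: sole_cycle_def)
    have dist: "distinct (v # l)" "l \<noteq> []" using cl by (auto simp: is_cycle_def)
    have "e \<in> E" using ve assms(2) by (auto simp: is_cycle_def)
    then obtain a b where "e = {a, b}" using simple_graph_edgeE[OF G] by metis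
    then obtain y where y: "e = {v, y}" using ve by auto
    have lead: "has_lead V E (lc_type V (E - {{v, y}})) (card (deep V (E - {{v, y}})))"
      if Ck: "sole_cycle E (v # k)" and k: "set k = set l" "k \<noteq> []" "hd k = y" for k
    proof -
      have "k = y # tl k" using k by (cases k) auto
      then show ?thesis
        using has_lead_one_root[OF G, of v y "tl k"] Ck v(2) k dist d2 setv by fastforce
    qed
    have "y = hd l \<or> y = hd (rev l)"
      using cycle_neighbors(1)[OF cl, of y] ve ce y by (auto simp: hd_rev)
    then have "has_lead V E (lc_type V (E - {{v, y}})) (card (deep V (E - {{v, y}})))"
      using lead[OF Cl] lead[OF Cr] dist by auto
    then show "lambda_lead (card V) (chromatic V E) = lambda_LC V (E - {e})"
      by (simp add: lambda_lead_eq lambda_LC_eq y)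
  }
qed

end
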